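(* Let $Q=\mathbb{R}^+\times\mathbb{R}^+$, $g_1,g_2\in\mathcal{S}([0,\infty))$, $h_1\in C^\infty([0,\infty))$, and let $f_1,f_2\in C^\infty(\overline{Q})$ be such that for every $T>0$ and $j=1,2$, $$\sup\Big\{x^E\Big|\frac{\partial^{n+l}f_j(x,t)}{\partial x^n\partial t^l}\Big|:\ x>0,\ 0\le t\le T\Big\}<\infty\quad\text{for all nonnegative integers } n,l,E.$$ Assume that $h_1(0)=g_1(0)$ and $h_1'(0)=-g_2'(0)+f_1(0,0)$, and let $(\Psi_1,\Psi_2)$ be the pair defined in the context, extended to $\overline{Q}\setminus\{(0,0)\}$. Then $(\Psi_1,\Psi_2)$ is unique in the following sense. Suppose $\mathcal{Y}_1(x,t)$ and $\mathcal{Y}_2(x,t)$ are $C^1$ functions for $(x,t)\in\overline{Q}\setminus\{(0,0)\}$ which satisfy $$\partial_t\mathcal{Y}_1=-\partial_x\mathcal{Y}_2-im\mathcal{Y}_1+f_1,\qquad\partial_t\mathcal{Y}_2=-\partial_x\mathcal{Y}_1+im\mathcal{Y}_2+f_2\qquad\text{in } Q,$$ $$\lim_{t\to0^+}\mathcal{Y}_1(x,t)=g_1(x),\quad\lim_{t\to0^+}\mathcal{Y}_2(x,t)=g_2(x)\ \ (x\in\mathbb{R}^+),\qquad\lim_{x\to0^+}\mathcal{Y}_1(x,t)=h_1(t)\ \ (t\in\mathbb{R}^+),$$ and $$\lim_{x\to+\infty}\mathcal{Y}_1(x,t)=0\quad\text{and}\quad\sup_{x\ge1}|\mathcal{Y}_2(x,t)|<+\infty\qquad\text{for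 every } t>0.$$ Suppose in addition that for every $T>0$ there exists a positive function $B_T(x)$ with $\int_0^\infty B_T(x)\,dx<+\infty$ such that, for $0<t\le T$ and all $x>0$, $$|\mathcal{Y}_1(x,t)|^2\le B_T(x),\quad|\mathcal{Y}_2(x,t)|^2\le B_T(x),\quad|\partial\mathcal{Y}_1(x,t)/\partial t|^2\le B_T(x),\quad|\partial\mathcal{Y}_2(x,t)/\partial t|^2\le B_T(x).$$ Then $(\Psi_1(x,t),\Psi_2(x,t))\equiv(\mathcal{Y}_1(x,t),\mathcal{Y}_2(x,t))$.
   Context: Fix a real number $m\ge 0$. $\mathbb{R}^+=(0,\infty)$. $\mathcal{S}([0,\infty))$ is the space of (complex-valued) $C^\infty$ functions $g$ on $[0,\infty)$ with $\sup_{x\ge0}x^a|g^{(b)}(x)|<\infty$ for all nonnegative integers $a,b$. For $\lambda\in\mathbb{R}$: $\rho(\lambda)=\sqrt{\lambda^2+m^2}$ (nonnegative root), $\omega_1(\lambda)=i\rho(\lambda)$, $\omega_2(\lambda)=-i\rho(\lambda)$, $\hat g_j(\lambda)=\int_0^\infty e^{-i\lambda y}g_j(y)\,dy$ ($j=1,2$). For $x>0$, $t>0$, $x\ne t$ set $$\mathcal{G}_{1,1}=\int_{-\infty}^{\infty}e^{i\lambda x-\omega_1(\lambda)t}\{\lambda\hat g_2(\lambda)+[i\omega_2(\lambda)+m]\hat g_1(\lambda)\}\tfrac{d\lambda}{2\rho(\lambda)},\quad \mathcal{G}_{1,2}=\int_{-\infty}^{\infty}e^{i\lambda x-\omega_1(\lambda)t}\{\lambda\hat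 g_2(-\lambda)-[i\omega_2(\lambda)+m]\hat g_1(-\lambda)\}\tfrac{d\lambda}{2\rho(\lambda)},$$ $$\mathcal{G}_{1,3}=\int_{-\infty}^{\infty}e^{i\lambda x-\omega_2(\lambda)t}\{\lambda\hat g_2(\lambda)+[i\omega_1(\lambda)+m]\hat g_1(\lambda)\}\tfrac{d\lambda}{2\rho(\lambda)},\quad \mathcal{G}_{1,4}=\int_{-\infty}^{\infty}e^{i\lambda x-\omega_2(\lambda)t}\{\lambda\hat g_2(-\lambda)-[i\omega_1(\lambda)+m]\hat g_1(-\lambda)\}\tfrac{d\lambda}{2\rho(\lambda)},$$ $$\mathcal{G}_{2,1}=\int_{-\infty}^{\infty}e^{i\lambda x-\omega_1(\lambda)t}\{\lambda\hat g_1(\lambda)-[i\omega_1(\lambda)+m]\hat g_2(\lambda)\}\tfrac{d\lambda}{2\rho(\lambda)},\quad \mathcal{G}_{2,2}=\int_{-\infty}^{\infty}e^{i\lambda x-\omega_1(\lambda)t}\{\lambda\hat g_1(-\lambda)+[i\omega_1(\lambda)+m]\hat g_2(-\lambda)\}\tfrac{d\lambda}{2\rho(\lambda)},$$ $$\mathcal{G}_{2,3}=\int_{-\infty}^{\infty}e^{i\lambda x-\omega_2(\lambda)t}\{\lambda\hat g_1(\lambda)-[i\omega_2(\lambda)+m]\hat g_2(\lambda)\}\tfrac{d\lambda}{2\rho(\lambda)},\quad \mathcal{G}_{2,4}=\int_{-\infty}^{\infty}e^{i\lambda x-\omega_2(\lambda)t}\{\lambda\hat g_1(-\lambda)+[i\omega_2(\lambda)+m]\hat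 g_2(-\lambda)\}\tfrac{d\lambda}{2\rho(\lambda)},$$ and, for $s=1,2$, $$\mathcal{H}_{1,s}=\int_{-\infty}^{\infty}e^{i\lambda x-\omega_s(\lambda)t}\Big[\int_0^t h_1(\tau)e^{\omega_s(\lambda)\tau}d\tau\Big]\tfrac{\lambda\,d\lambda}{\rho(\lambda)},\quad \mathcal{H}_{2,s}=\int_{-\infty}^{\infty}e^{i\lambda x-\omega_s(\lambda)t}\Big[\int_0^t h_1(\tau)e^{\omega_s(\lambda)\tau}d\tau\Big]\tfrac{[i\omega_s(\lambda)+m]\,d\lambda}{\rho(\lambda)}.$$ The $\mathcal{G}$- and $\mathcal{H}$-integrals are understood in the generalized sense $\lim_{A\to\infty}\int_0^A+\lim_{A\to\infty}\int_{-A}^0$. For $f\in\{f_1,f_2\}$, $\omega\in\{\omega_1,\omega_2\}$: $\hat f(\lambda,t)=\int_0^\infty e^{-i\lambda y}f(y,t)\,dy$ and $\tilde{\hat f}(\lambda,\omega,t)=\int_0^te^{\omega(\lambda)\tau}\hat f(\lambda,\tau)\,d\tau$; in $\tilde{\hat f}(-\lambda,\omega,t)$ one replaces $\hat f(\lambda,\tau)$ by $\hat f(-\lambda,\tau)$ (note $\omega(-\lambda)=\omega(\lambda)$). Set $$\mathcal{F}_{1,1}=\int_{-\infty}^\infty e^{i\lambda x-\omega_1(\lambda)t}\{\lambda\tilde{\hat f}_2(\lambda,\omega_1,t)+[i\omega_2(\lambda)+m]\tilde{\hat f}_1(\lambda,\omega_1,t)\}\tfrac{d\lambda}{2\rho(\lambda)}+\int_{-\infty}^\infty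 e^{i\lambda x-\omega_1(\lambda)t}\{\lambda\tilde{\hat f}_2(-\lambda,\omega_1,t)-[i\omega_2(\lambda)+m]\tilde{\hat f}_1(-\lambda,\omega_1,t)\}\tfrac{d\lambda}{2\rho(\lambda)},$$ $$\mathcal{F}_{1,2}=-\int_{-\infty}^\infty e^{i\lambda x-\omega_2(\lambda)t}\{\lambda\tilde{\hat f}_2(\lambda,\omega_2,t)+[i\omega_1(\lambda)+m]\tilde{\hat f}_1(\lambda,\omega_2,t)\}\tfrac{d\lambda}{2\rho(\lambda)}-\int_{-\infty}^\infty e^{i\lambda x-\omega_2(\lambda)t}\{\lambda\tilde{\hat f}_2(-\lambda,\omega_2,t)-[i\omega_1(\lambda)+m]\tilde{\hat f}_1(-\lambda,\omega_2,t)\}\tfrac{d\lambda}{2\rho(\lambda)},$$ $$\mathcal{F}_{2,1}=\int_{-\infty}^\infty e^{i\lambda x-\omega_1(\lambda)t}\{\lambda\tilde{\hat f}_1(\lambda,\omega_1,t)-[i\omega_1(\lambda)+m]\tilde{\hat f}_2(\lambda,\omega_1,t)\}\tfrac{d\lambda}{2\rho(\lambda)}-\int_{-\infty}^\infty e^{i\lambda x-\omega_1(\lambda)t}\{\lambda\tilde{\hat f}_1(-\lambda,\omega_1,t)+[i\omega_1(\lambda)+m]\tilde{\hat f}_2(-\lambda,\omega_1,t)\}\tfrac{d\lambda}{2\rho(\lambda)},$$ $$\mathcal{F}_{2,2}=-\int_{-\infty}^\infty e^{i\lambda x-\omega_2(\lambda)t}\{\lambda\tilde{\hat f}_1(\lambda,\omega_2,t)-[i\omega_2(\lambda)+m]\tilde{\hat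 f}_2(\lambda,\omega_2,t)\}\tfrac{d\lambda}{2\rho(\lambda)}+\int_{-\infty}^\infty e^{i\lambda x-\omega_2(\lambda)t}\{\lambda\tilde{\hat f}_1(-\lambda,\omega_2,t)+[i\omega_2(\lambda)+m]\tilde{\hat f}_2(-\lambda,\omega_2,t)\}\tfrac{d\lambda}{2\rho(\lambda)}.$$ For $x>0$, $t>0$, $x\ne t$, the functions $\Psi_1,\Psi_2$ are defined by $$2\pi\Psi_1=\mathcal{G}_{1,1}+\mathcal{G}_{1,2}-\mathcal{G}_{1,3}-\mathcal{G}_{1,4}+\mathcal{H}_{1,1}-\mathcal{H}_{1,2}+\mathcal{F}_{1,1}+\mathcal{F}_{1,2},$$ $$2\pi\Psi_2=\mathcal{G}_{2,1}-\mathcal{G}_{2,2}-\mathcal{G}_{2,3}+\mathcal{G}_{2,4}-\mathcal{H}_{2,1}+\mathcal{H}_{2,2}+\mathcal{F}_{2,1}+\mathcal{F}_{2,2}.$$ According to the paper, under the two compatibility conditions these functions extend to $C^1$ functions on $\overline{Q}\setminus\{(0,0)\}$ (across the diagonal $x=t>0$ and up to the open half-axes); the extensions are denoted by the same symbols. *)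

theory Defs
  imports "HOL-Analysis.Analysis"
begin

section \<open>Smooth functions on the closed half-line and the closed quadrant\<close>

text \<open>Derivatives are taken within \<open>{0..}\<close>: one-sided at \<open>0\<close>, ordinary at
  interior points.  Values of functions at negative arguments are irrelevant throughout.\<close>

definition hderiv :: "(real \<Rightarrow> complex) \<Rightarrow> real \<Rightarrow> complex" where
  "hderiv g x = vector_derivative g (at x within {0..})"

definition half_line_smooth :: "(real \<Rightarrow> complex) \<Rightarrow> bool" where
  "half_line_smooth g \<longleftrightarrow>
     (\<forall>n. \<forall>x\<ge>0. (hderiv ^^ n) g differentiable (at x within {0..}))"

definition half_line_schwartz :: "(real \<Rightarrow> complex) \<Rightarrow> bool" where
  "half_line_schwartz g \<longleftrightarrow> half_line_smooth g \<and>
     (\<forall>a b. bdd_above ((\<lambda>x. x ^ a * cmod ((hderiv ^^ b) g x)) ` {0..}))"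

definition Quad :: "(real \<times> real) set" where
  "Quad = {0<..} \<times> {0<..}"

definition Quad_closed :: "(real \<times> real) set" where
  "Quad_closed = {0..} \<times> {0..}"

definition dx :: "(real \<Rightarrow> real \<Rightarrow> complex) \<Rightarrow> real \<Rightarrow> real \<Rightarrow> complex" where
  "dx u x t = vector_derivative (\<lambda>y. u y t) (at x within {0..})"

definition dt :: "(real \<Rightarrow> real \<Rightarrow> complex) \<Rightarrow> real \<Rightarrow> real \<Rightarrow> complex" where
  "dt u x t = vector_derivative (\<lambda>s. u x s) (at t within {0..})"

text \<open>\<open>Ck_on k S u\<close>: all partial derivatives of \<open>u\<close> of order at most \<open>k\<close>, in any order of
  differentiation, exist and are continuous on \<open>S\<close>.  Meant for \<open>S \<subseteq> Quad_closed\<close> that are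
  relatively open in \<open>Quad_closed\<close>.\<close>

primrec Ck_on :: "nat \<Rightarrow> (real \<times> real) set \<Rightarrow> (real \<Rightarrow> real \<Rightarrow> complex) \<Rightarrow> bool" where
  "Ck_on 0 S u \<longleftrightarrow> continuous_on S (\<lambda>(x, t). u x t)"
| "Ck_on (Suc k) S u \<longleftrightarrow> continuous_on S (\<lambda>(x, t). u x t) \<and>
     (\<forall>(x, t)\<in>S. (\<lambda>y. u y t) differentiable (at x within {0..}) \<and>
                  (\<lambda>s. u x s) differentiable (at t within {0..})) \<and>
     Ck_on k S (dx u) \<and> Ck_on k S (dt u)"

definition quad_smooth :: "(real \<Rightarrow> real \<Rightarrow> complex) \<Rightarrow> bool" where
  "quad_smooth u \<longleftrightarrow> (\<forall>k. Ck_on k Quad_closed u)"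

definition rapidly_decreasing_in_x :: "(real \<Rightarrow> real \<Rightarrow> complex) \<Rightarrow> bool" where
  "rapidly_decreasing_in_x u \<longleftrightarrow>
     (\<forall>T>0. \<forall>n l E. bdd_above
        ((\<lambda>(x, t). x ^ E * cmod ((dx ^^ n) ((dt ^^ l) u) x t)) ` ({0<..} \<times> {0..T})))"

section \<open>Transforms\<close>

definition rho :: "real \<Rightarrow> real \<Rightarrow> real" where
  "rho m l = sqrt (l\<^sup>2 + m\<^sup>2)"

definition omega1 :: "real \<Rightarrow> real \<Rightarrow> complex" where
  "omega1 m l = \<i> * of_real (rho m l)"

definition omega2 :: "real \<Rightarrow> real \<Rightarrow> complex" where
  "omega2 m l = - \<i> * of_real (rho m l)"

definition hat :: "(real \<Rightarrow> complex) \<Rightarrow> real \<Rightarrow> complex" where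
  "hat g l = (LINT y:{0<..}|lborel. exp (- \<i> * of_real l * of_real y) * g y)"

text \<open>The second argument is the frequency of the spatial transform; the exponent \<open>w\<close> is passed
  as a number, so that the frequency can be reflected independently of it.\<close>

definition tilde_hat :: "(real \<Rightarrow> real \<Rightarrow> complex) \<Rightarrow> real \<Rightarrow> complex \<Rightarrow> real \<Rightarrow> complex" where
  "tilde_hat f l w t =
     (LINT \<tau>:{0..t}|lborel. exp (w * of_real \<tau>) * hat (\<lambda>y. f y \<tau>) l)"

definition time_transform :: "(real \<Rightarrow> complex) \<Rightarrow> complex \<Rightarrow> real \<Rightarrow> complex" where
  "time_transform h w t = (LINT \<tau>:{0..t}|lborel. h \<tau> * exp (w * of_real \<tau>))"

definition gen_integral :: "(real \<Rightarrow> complex) \<Rightarrow> complex" where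
  "gen_integral F = Lim at_top (\<lambda>A::real. LINT l:{0..A}|lborel. F l)
                  + Lim at_top (\<lambda>A::real. LINT l:{-A..0}|lborel. F l)"

definition kern :: "complex \<Rightarrow> real \<Rightarrow> real \<Rightarrow> real \<Rightarrow> complex" where
  "kern w l x t = exp (\<i> * of_real l * of_real x - w * of_real t)"

section \<open>The solution formula\<close>

text \<open>For \<open>m = 0\<close> the integrands divide by \<open>rho m 0 = 0\<close> at the single point \<open>l = 0\<close>,
  which does not affect the integrals.\<close>

definition G11 where
  "G11 (m::real) g1 g2 x t = gen_integral (\<lambda>l. kern (omega1 m l) l x t *
     (of_real l * hat g2 l + (\<i> * omega2 m l + of_real m) * hat g1 l)
       / of_real (2 * rho m l))"

definition G12 where
  "G12 (m::real) g1 g2 x t = gen_integral (\<lambda>l. kern (omega1 m l) l x t *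
     (of_real l * hat g2 (-l) - (\<i> * omega2 m l + of_real m) * hat g1 (-l))
       / of_real (2 * rho m l))"

definition G13 where
  "G13 (m::real) g1 g2 x t = gen_integral (\<lambda>l. kern (omega2 m l) l x t *
     (of_real l * hat g2 l + (\<i> * omega1 m l + of_real m) * hat g1 l)
       / of_real (2 * rho m l))"

definition G14 where
  "G14 (m::real) g1 g2 x t = gen_integral (\<lambda>l. kern (omega2 m l) l x t *
     (of_real l * hat g2 (-l) - (\<i> * omega1 m l + of_real m) * hat g1 (-l))
       / of_real (2 * rho m l))"

definition G21 where
  "G21 (m::real) g1 g2 x t = gen_integral (\<lambda>l. kern (omega1 m l) l x t *
     (of_real l * hat g1 l - (\<i> * omega1 m l + of_real m) * hat g2 l)
       / of_real (2 * rho m l))"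

definition G22 where
  "G22 (m::real) g1 g2 x t = gen_integral (\<lambda>l. kern (omega1 m l) l x t *
     (of_real l * hat g1 (-l) + (\<i> * omega1 m l + of_real m) * hat g2 (-l))
       / of_real (2 * rho m l))"

definition G23 where
  "G23 (m::real) g1 g2 x t = gen_integral (\<lambda>l. kern (omega2 m l) l x t *
     (of_real l * hat g1 l - (\<i> * omega2 m l + of_real m) * hat g2 l)
       / of_real (2 * rho m l))"

definition G24 where
  "G24 (m::real) g1 g2 x t = gen_integral (\<lambda>l. kern (omega2 m l) l x t *
     (of_real l * hat g1 (-l) + (\<i> * omega2 m l + of_real m) * hat g2 (-l))
       / of_real (2 * rho m l))"

definition H11 where
  "H11 (m::real) h1 x t = gen_integral (\<lambda>l. kern (omega1 m l) l x t *
     time_transform h1 (omega1 m l) t * of_real l / of_real (rho m l))"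

definition H12 where
  "H12 (m::real) h1 x t = gen_integral (\<lambda>l. kern (omega2 m l) l x t *
     time_transform h1 (omega2 m l) t * of_real l / of_real (rho m l))"

definition H21 where
  "H21 (m::real) h1 x t = gen_integral (\<lambda>l. kern (omega1 m l) l x t *
     time_transform h1 (omega1 m l) t * (\<i> * omega1 m l + of_real m) / of_real (rho m l))"

definition H22 where
  "H22 (m::real) h1 x t = gen_integral (\<lambda>l. kern (omega2 m l) l x t *
     time_transform h1 (omega2 m l) t * (\<i> * omega2 m l + of_real m) / of_real (rho m l))"

text \<open>The following integrals are ordinary Lebesgue integrals over the whole line.\<close>

definition F11 where
  "F11 (m::real) f1 f2 x t =
     (LINT l|lborel. kern (omega1 m l) l x t *
        (of_real l * tilde_hat f2 l (omega1 m l) t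
          + (\<i> * omega2 m l + of_real m) * tilde_hat f1 l (omega1 m l) t)
        / of_real (2 * rho m l))
   + (LINT l|lborel. kern (omega1 m l) l x t *
        (of_real l * tilde_hat f2 (-l) (omega1 m l) t
          - (\<i> * omega2 m l + of_real m) * tilde_hat f1 (-l) (omega1 m l) t)
        / of_real (2 * rho m l))"

definition F12 where
  "F12 (m::real) f1 f2 x t =
   - (LINT l|lborel. kern (omega2 m l) l x t *
        (of_real l * tilde_hat f2 l (omega2 m l) t
          + (\<i> * omega1 m l + of_real m) * tilde_hat f1 l (omega2 m l) t)
        / of_real (2 * rho m l))
   - (LINT l|lborel. kern (omega2 m l) l x t *
        (of_real l * tilde_hat f2 (-l) (omega2 m l) t
          - (\<i> * omega1 m l + of_real m) * tilde_hat f1 (-l) (omega2 m l) t)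
        / of_real (2 * rho m l))"

definition F21 where
  "F21 (m::real) f1 f2 x t =
     (LINT l|lborel. kern (omega1 m l) l x t *
        (of_real l * tilde_hat f1 l (omega1 m l) t
          - (\<i> * omega1 m l + of_real m) * tilde_hat f2 l (omega1 m l) t)
        / of_real (2 * rho m l))
   - (LINT l|lborel. kern (omega1 m l) l x t *
        (of_real l * tilde_hat f1 (-l) (omega1 m l) t
          + (\<i> * omega1 m l + of_real m) * tilde_hat f2 (-l) (omega1 m l) t)
        / of_real (2 * rho m l))"

definition F22 where
  "F22 (m::real) f1 f2 x t =
   - (LINT l|lborel. kern (omega2 m l) l x t *
        (of_real l * tilde_hat f1 l (omega2 m l) t
          - (\<i> * omega2 m l + of_real m) * tilde_hat f2 l (omega2 m l) t)
        / of_real (2 * rho m l))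
   + (LINT l|lborel. kern (omega2 m l) l x t *
        (of_real l * tilde_hat f1 (-l) (omega2 m l) t
          + (\<i> * omega2 m l + of_real m) * tilde_hat f2 (-l) (omega2 m l) t)
        / of_real (2 * rho m l))"

definition Psi1_formula where
  "Psi1_formula m g1 g2 h1 f1 f2 x t =
     (G11 m g1 g2 x t + G12 m g1 g2 x t - G13 m g1 g2 x t - G14 m g1 g2 x t
      + H11 m h1 x t - H12 m h1 x t + F11 m f1 f2 x t + F12 m f1 f2 x t)
     / of_real (2 * pi)"

definition Psi2_formula where
  "Psi2_formula m g1 g2 h1 f1 f2 x t =
     (G21 m g1 g2 x t - G22 m g1 g2 x t - G23 m g1 g2 x t + G24 m g1 g2 x t
      - H21 m h1 x t + H22 m h1 x t + F21 m f1 f2 x t + F22 m f1 f2 x t)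
     / of_real (2 * pi)"

text \<open>The formulas are meaningful off the diagonal of the open quadrant.  As this set is dense in
  the closed quadrant, an extension that is continuous on the closed quadrant minus the origin is
  unique, and is given on the diagonal and on the half-axes by the limit along the set.\<close>

definition off_diag :: "(real \<times> real) set" where
  "off_diag = {(x, t). 0 < x \<and> 0 < t \<and> x \<noteq> t}"

definition extend_off_diag :: "(real \<Rightarrow> real \<Rightarrow> complex) \<Rightarrow> real \<Rightarrow> real \<Rightarrow> complex" where
  "extend_off_diag u x t =
     (if (x, t) \<in> off_diag then u x t
      else Lim (at (x, t) within off_diag) (\<lambda>(y, s). u y s))"

definition Psi1 where
  "Psi1 m g1 g2 h1 f1 f2 = extend_off_diag (Psi1_formula m g1 g2 h1 f1 f2)"

definition Psi2 where
  "Psi2 m g1 g2 h1 f1 f2 = extend_off_diag (Psi2_formula m g1 g2 h1 f1 f2)"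

end

theory Submission
  imports Defs "HOL-Probability.Sinc_Integral"
begin

text \<open>
  For real \<open>l\<close> the sine transform of \<open>Y1(\<cdot>, t)\<close> and the cosine transform of \<open>Y2(\<cdot>, t)\<close> on the
  half-line satisfy a \<open>2 \<times> 2\<close> linear system of ordinary differential equations in \<open>t\<close>.  Integration
  by parts in \<open>x\<close> produces boundary values at \<open>x = 0\<close>: the unknown \<open>Y2(0, t)\<close> is multiplied by
  \<open>sin 0\<close> and drops out, the prescribed \<open>Y1(0, t) = h1 t\<close> is multiplied by \<open>cos 0\<close> and stays.  The
  system has the eigenvalues \<open>\<plusminus>\<i> rho\<close>.  Pairing it with a left eigenvector and applying Duhamel's
  formula gives, for each sign, exactly the combination of transforms of \<open>g\<close>, \<open>h\<close> and \<open>f\<close> that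
  appears in the solution formula.  With the eigenvectors normalised to \<open>(m \<plusminus> rho, l)\<close>, the
  difference of the two signs is \<open>2 rho\<close> times the Fourier transform of the odd extension of \<open>Y1\<close>;
  normalised to \<open>(l, \<plusminus>rho - m)\<close>, it is \<open>2 rho\<close> times that of the even extension of \<open>Y2\<close>.  Fourier
  inversion of these two extensions identifies the formula with the solution at every point of the
  open quadrant off the diagonal, and continuity does the rest.

  Three points need care.

  First, \<open>Y1(\<cdot>, t)\<close> and \<open>Y2(\<cdot>, t)\<close> are only known to be square integrable, so their transforms are taken over
  \<open>[0, R]\<close>.  After division by \<open>rho\<close> the flux through \<open>x = R\<close> is at most a multiple of \<open>sqrt (B R)\<close>,
  uniformly in \<open>l\<close>, and an integrable \<open>B\<close> takes arbitrarily small values arbitrarily far out.  Along a suitable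
  sequence of radii the truncated transforms therefore converge uniformly in \<open>l\<close>
  (\<open>evolution\<close>, \<open>transform_of_solution\<close>).  The initial values are reached by dominated convergence,
  because \<open>\<bar>Y\<bar> \<le> (1 + B) / 2\<close>.

  Second, uniform approximation by truncated transforms suffices for Dirichlet's proof of the
  inversion theorem: far from \<open>x\<close> the kernel \<open>sin (A (x - y)) / (x - y)\<close> is square integrable, just
  like the function (\<open>half_line_fourier_inversion\<close>).

  Third, the formula is a sum of many improper integrals, each a limit of its own, and inversion
  can be applied to the sum only because each of them converges.  Integrating the transforms of the
  data by parts shows that every integrand is, near \<open>\<plusminus>\<infinity>\<close>, a sum of terms
  \<open>c e^{\<i> s l} / l + O(l^{-2})\<close> with \<open>s\<close> one of \<open>\<plusminus>x\<close>, \<open>\<plusminus>x - t\<close>, \<open>\<plusminus>x + t\<close>.  These frequencies are nonzero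
  exactly because \<open>x, t > 0\<close> and \<open>x \<noteq> t\<close>
  (\<open>initial_term_converges\<close>, \<open>boundary_term_converges\<close>); the source terms are \<open>O(l^{-2})\<close>
  (\<open>source_term_integrable\<close>).
\<close>

section \<open>Fourier inversion on the half-line by Dirichlet's kernel\<close>

text \<open>Approximate \<open>v\<close> uniformly by a polynomial and integrate the polynomial by parts once.  The bound
  has to be uniform in the phase \<open>c\<close>, because \<open>c\<close> will be proportional to \<open>A\<close>.\<close>

lemma riemann_lebesgue_sin:
  fixes v :: "real \<Rightarrow> complex"
  assumes ab: "a \<le> b" and v: "continuous_on {a..b} v" and e: "e > 0"
  shows "\<exists>A0>0. \<forall>A\<ge>A0. \<forall>c. norm (integral {a..b} (\<lambda>y. of_real (sin (A * y + c)) * v y)) < e"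
proof -
  \<comment> \<open>The \<open>+ 1\<close> keeps the denominator positive for \<open>a = b\<close>.\<close>
  define e' where "e' = e / (2 * (b - a + 1))"
  have e': "e' > 0" using e ab by (simp add: e'_def)
  obtain p where p: "polynomial_function p" "\<And>y. y \<in> {a..b} \<Longrightarrow> norm (v y - p y) < e'"
    using Stone_Weierstrass_polynomial_function[OF compact_Icc v e'] by blast
  obtain p' where p': "polynomial_function p'" "\<And>y. (p has_vector_derivative p' y) (at y)"
    using has_vector_derivative_polynomial_function[OF p(1)] by blast
  have cp: "continuous_on {a..b} p" and cp': "continuous_on {a..b} p'"
    using p p' by (auto intro: continuous_on_polymonial_function)
  obtain M where M: "\<And>y. y \<in> {a..b} \<Longrightarrow> norm (p' y) \<le> M"
    using compact_imp_bounded[OF compact_continuous_image[OF cp' compact_Icc]]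
    unfolding bounded_iff by (metis imageI)
  have M0: "M \<ge> 0" using M[of a] ab by (auto intro: order_trans[OF norm_ge_zero])
  define N where "N = norm (p a) + norm (p b) + M * (b - a)"
  have N0: "N \<ge> 0" using M0 ab by (simp add: N_def)
  \<comment> \<open>Integration by parts bounds the integral of the polynomial by \<open>N / A\<close>.\<close>
  define A0 where "A0 = 2 * (N + 1) / e"
  have A0: "A0 > 0" using N0 e by (simp add: A0_def)
  show ?thesis
  proof (intro exI[of _ A0] conjI allI impI A0)
    fix A c :: real assume A: "A0 \<le> A"
    have Apos: "A > 0" using A A0 by linarith
    let ?s = "\<lambda>y. complex_of_real (sin (A * y + c))"
    let ?co = "\<lambda>y. complex_of_real (cos (A * y + c))"
    have cs: "continuous_on {a..b} ?s" "continuous_on {a..b} ?co"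
      by (intro continuous_intros)+
    define F where "F = (\<lambda>y. - (?co y / of_real A) * p y)"
    have dF: "(F has_vector_derivative (?s y * p y - ?co y / of_real A * p' y)) (at y within {a..b})" for y
    proof -
      have "((\<lambda>y. - (?co y / of_real A)) has_vector_derivative ?s y) (at y)"
        using Apos by (auto intro!: derivative_eq_intros simp: field_simps)
      from has_vector_derivative_mult[OF this p'(2)[of y]]
      show ?thesis unfolding F_def
        by (auto intro: has_vector_derivative_at_within simp: algebra_simps)
    qed
    have "((\<lambda>y. ?s y * p y - ?co y / of_real A * p' y) has_integral (F b - F a)) {a..b}"
      by (rule fundamental_theorem_of_calculus[OF ab dF])
    moreover have i2: "(\<lambda>y. ?co y / of_real A * p' y) integrable_on {a..b}"
      using Apos by (intro integrable_continuous_interval continuous_intros cp' cs) auto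
    ultimately have "((\<lambda>y. (?s y * p y - ?co y / of_real A * p' y) + ?co y / of_real A * p' y)
        has_integral (F b - F a + integral {a..b} (\<lambda>y. ?co y / of_real A * p' y))) {a..b}"
      by (intro has_integral_add integrable_integral)
    then have ip: "integral {a..b} (\<lambda>y. ?s y * p y)
        = F b - F a + integral {a..b} (\<lambda>y. ?co y / of_real A * p' y)"
      by (intro integral_unique) simp
    have nF: "norm (F y) \<le> norm (p y) / A" for y
      using Apos by (simp add: F_def norm_mult norm_divide mult_right_le_one_le
          mult_left_le_one_le divide_right_mono)
    have "norm (integral {a..b} (\<lambda>y. ?co y / of_real A * p' y)) \<le> M / A * (b - a)"
    proof (rule integral_bound[OF ab])
      show "continuous_on {a..b} (\<lambda>y. ?co y / of_real A * p' y)"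
        using Apos by (intro continuous_intros cp' cs) auto
      fix y assume y: "y \<in> {a..b}"
      have "\<bar>cos (A * y + c)\<bar> * norm (p' y) \<le> 1 * M"
        by (intro mult_mono M y) auto
      then show "norm (?co y / of_real A * p' y) \<le> M / A"
        using Apos by (simp add: norm_mult norm_divide divide_right_mono)
    qed
    then have "norm (integral {a..b} (\<lambda>y. ?s y * p y)) \<le> norm (p b) / A + norm (p a) / A + M / A * (b - a)"
      unfolding ip using nF[of a] nF[of b]
      by (smt (verit) norm_triangle_ineq norm_triangle_ineq4)
    also have "\<dots> = N / A" by (simp add: N_def algebra_simps add_divide_distrib diff_divide_distrib)
    also have "\<dots> < e / 2"
    proof -
      have "N < A0 * (e / 2)" using e by (simp add: A0_def)
      also have "\<dots> \<le> A * (e / 2)" using A e by (intro mult_right_mono) auto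
      finally show ?thesis using Apos by (simp add: field_simps)
    qed
    finally have 1: "norm (integral {a..b} (\<lambda>y. ?s y * p y)) < e / 2" .
    have 2: "norm (integral {a..b} (\<lambda>y. ?s y * (v y - p y))) \<le> e' * (b - a)"
    proof (rule integral_bound[OF ab])
      show "continuous_on {a..b} (\<lambda>y. ?s y * (v y - p y))"
        by (intro continuous_intros cs v cp)
      fix y assume y: "y \<in> {a..b}"
      have "\<bar>sin (A * y + c)\<bar> * norm (v y - p y) \<le> 1 * e'"
        using p(2)[OF y] by (intro mult_mono) auto
      then show "norm (?s y * (v y - p y)) \<le> e'" by (simp add: norm_mult)
    qed
    have 3: "e' * (b - a) \<le> e / 2" unfolding e'_def using e ab by (simp add: field_simps)
    have vp: "integral {a..b} (\<lambda>y. ?s y * v y)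
       = integral {a..b} (\<lambda>y. ?s y * p y) + integral {a..b} (\<lambda>y. ?s y * (v y - p y))"
      by (subst integral_add[symmetric])
        (auto intro!: integrable_continuous_interval continuous_intros v cp simp: algebra_simps)
    have split: "r < e" if "r \<le> p + q" "p < e / 2" "q \<le> s" "s \<le> e / 2" for p q r s :: real
      using that by linarith
    have "norm (integral {a..b} (\<lambda>y. ?s y * v y)) \<le> norm (integral {a..b} (\<lambda>y. ?s y * p y))
        + norm (integral {a..b} (\<lambda>y. ?s y * (v y - p y)))"
      unfolding vp by (rule norm_triangle_ineq)
    then show "norm (integral {a..b} (\<lambda>y. ?s y * v y)) < e"
      by (rule split) (rule 1 2 3)+
  qed
qed

text \<open>The continuous function \<open>sin (A z) / z\<close>; up to the factor \<open>2\<close> it is the integral of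
  \<open>e^{\<i> l z}\<close> over \<open>\<bar>l\<bar> \<le> A\<close>.\<close>

definition dirichlet_kernel :: "real \<Rightarrow> real \<Rightarrow> real" where
  "dirichlet_kernel A z = A * sinc (A * z)"

lemma dirichlet_kernel_eq: "z \<noteq> 0 \<Longrightarrow> dirichlet_kernel A z = sin (A * z) / z"
  by (auto simp: dirichlet_kernel_def)

lemma dirichlet_kernel_minus: "dirichlet_kernel A (- z) = dirichlet_kernel A z"
  by (simp add: dirichlet_kernel_def)

lemma continuous_on_dirichlet_kernel [continuous_intros]:
  "continuous_on S f \<Longrightarrow> continuous_on S (\<lambda>x. dirichlet_kernel A (f x))"
  unfolding dirichlet_kernel_def by (intro continuous_intros)

lemma integral_exp_symmetric:
  assumes "A \<ge> 0"
  shows "integral {-A..A} (\<lambda>l. exp (\<i> * of_real l * of_real z)) = of_real (2 * dirichlet_kernel A z)"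
proof (cases "z = 0")
  case True
  then show ?thesis using assms by (simp add: dirichlet_kernel_def scaleR_conv_of_real)
next
  case False
  have "((\<lambda>l. exp (\<i> * of_real l * of_real z)) has_integral
      (exp (\<i> * of_real A * of_real z) / (\<i> * of_real z) - exp (\<i> * of_real (-A) * of_real z) / (\<i> * of_real z))) {-A..A}"
  proof (rule fundamental_theorem_of_calculus)
    show "-A \<le> A" using assms by simp
    fix l :: real
    have "((\<lambda>w. exp (\<i> * w * of_real z) / (\<i> * of_real z)) has_field_derivative
        exp (\<i> * of_real l * of_real z)) (at (of_real l))"
      using False by (auto intro!: derivative_eq_intros simp: field_simps)
    then have "((\<lambda>w. exp (\<i> * of_real w * of_real z) / (\<i> * of_real z)) has_vector_derivative
        exp (\<i> * of_real l * of_real z)) (at l)"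
      by (rule has_vector_derivative_real_field)
    then show "((\<lambda>w. exp (\<i> * of_real w * of_real z) / (\<i> * of_real z)) has_vector_derivative
        exp (\<i> * of_real l * of_real z)) (at l within {-A..A})"
      by (rule has_vector_derivative_at_within)
  qed
  then have "integral {-A..A} (\<lambda>l. exp (\<i> * of_real l * of_real z)) =
      (exp (\<i> * of_real (A * z)) - exp (- (\<i> * of_real (A * z)))) / (\<i> * of_real z)"
    by (simp add: integral_unique diff_divide_distrib mult.assoc)
  also have "exp (\<i> * of_real (A * z)) - exp (- (\<i> * of_real (A * z))) = 2 * \<i> * of_real (sin (A * z))"
    by (simp add: sin_of_real[symmetric] sin_exp_eq exp_minus field_simps)
  finally show ?thesis using False by (simp add: dirichlet_kernel_eq)
qed

text \<open>The antiderivative is the sine integral, whose limits at \<open>\<plusminus>\<infinity>\<close> are \<open>\<plusminus>\<pi> / 2\<close>.\<close>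

lemma dirichlet_kernel_integral_limit:
  assumes "0 < x" "x < b"
  shows "((\<lambda>A. integral {0..b} (\<lambda>y. dirichlet_kernel A (y - x))) \<longlongrightarrow> pi) at_top"
proof -
  have *: "integral {0..b} (\<lambda>y. dirichlet_kernel A (y - x)) = Si (A * (b - x)) + Si (A * x)" if "A > 0" for A
  proof -
    have "((\<lambda>y. dirichlet_kernel A (y - x)) has_integral (Si (A * (b - x)) - Si (A * (0 - x)))) {0..b}"
    proof (rule fundamental_theorem_of_calculus)
      show "0 \<le> b" using assms by simp
      fix y
      have "((\<lambda>y. Si (A * (y - x))) has_real_derivative sinc (A * (y - x)) * A) (at y)"
        by (rule DERIV_chain2[OF DERIV_Si]) (auto intro!: derivative_eq_intros)
      then show "((\<lambda>y. Si (A * (y - x))) has_vector_derivative dirichlet_kernel A (y - x)) (at y within {0..b})"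
        unfolding dirichlet_kernel_def has_real_derivative_iff_has_vector_derivative[symmetric]
        by (auto intro: has_field_derivative_at_within simp: mult.commute)
    qed
    then have "integral {0..b} (\<lambda>y. dirichlet_kernel A (y - x)) = Si (A * (b - x)) - Si (- (A * x))"
      by (simp add: integral_unique)
    then show ?thesis using Si_neg[of "A * x"] that assms by simp
  qed
  have lim: "((\<lambda>A. Si (A * c)) \<longlongrightarrow> pi / 2) at_top" if "c > 0" for c
    by (rule filterlim_compose[OF Si_at_top])
      (rule filterlim_at_top_mult_tendsto_pos[OF tendsto_const that filterlim_ident])
  have "((\<lambda>A. Si (A * (b - x)) + Si (A * x)) \<longlongrightarrow> pi / 2 + pi / 2) at_top"
    by (intro tendsto_add lim) (use assms in auto)
  then have "((\<lambda>A. Si (A * (b - x)) + Si (A * x)) \<longlongrightarrow> pi) at_top" by simp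
  then show ?thesis
    by (rule Lim_transform_eventually)
      (rule eventually_mono[OF eventually_gt_at_top[of 0]], simp add: *)
qed

lemma sine_integral_limit:
  fixes v :: "real \<Rightarrow> complex"
  assumes ab: "a \<le> b" and v: "continuous_on {a..b} v"
  shows "((\<lambda>A. integral {a..b} (\<lambda>y. of_real (sin (A * (y - z))) * v y)) \<longlongrightarrow> 0) at_top"
proof (rule tendstoI)
  fix e :: real assume "e > 0"
  from riemann_lebesgue_sin[OF ab v this] obtain A0 where A0: "\<And>A c. A \<ge> A0 \<Longrightarrow>
     norm (integral {a..b} (\<lambda>y. of_real (sin (A * y + c)) * v y)) < e" by blast
  have "dist (integral {a..b} (\<lambda>y. of_real (sin (A * (y - z))) * v y)) 0 < e" if "A \<ge> A0" for A
    using A0[OF that, of "- A * z"] by (simp add: right_diff_distrib)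
  then show "\<forall>\<^sub>F A in at_top. dist (integral {a..b} (\<lambda>y. of_real (sin (A * (y - z))) * v y)) 0 < e"
    by (rule eventually_mono[OF eventually_ge_at_top[of A0]])
qed

text \<open>Subtracting \<open>u x\<close> turns the kernel into \<open>sin (A (y - x))\<close> times the difference quotient of \<open>u\<close> at
  \<open>x\<close>, a continuous function; its integral vanishes in the limit by the Riemann-Lebesgue lemma.\<close>

lemma dirichlet_limit_inside:
  fixes u :: "real \<Rightarrow> complex"
  assumes x: "0 < x" "x < b" and u: "continuous_on {0..b} u"
    and du: "(u has_vector_derivative d) (at x)"
  shows "((\<lambda>A. integral {0..b} (\<lambda>y. of_real (dirichlet_kernel A (y - x)) * u y)) \<longlongrightarrow> of_real pi * u x) at_top"
proof -
  \<comment> \<open>The difference quotient, continued by the derivative.\<close>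
  define q where "q = (\<lambda>y. if y = x then d else (u y - u x) / of_real (y - x))"
  have q: "continuous_on {0..b} q"
    unfolding continuous_on_eq_continuous_within
  proof
    fix y assume y: "y \<in> {0..b}"
    show "continuous (at y within {0..b}) q"
    proof (cases "y = x")
      case False
      have "continuous (at y within {0..b}) (\<lambda>y. (u y - u x) / of_real (y - x))"
        using u y False by (intro continuous_intros) (auto simp: continuous_on_eq_continuous_within)
      then show ?thesis
      proof (rule continuous_transform_within[of _ _ _ "\<bar>y - x\<bar>"])
        show "0 < \<bar>y - x\<bar>" using False by simp
        show "(u z - u x) / of_real (z - x) = q z" if "dist z y < \<bar>y - x\<bar>" for z
          using that by (auto simp: q_def dist_real_def)
      qed (use y in auto)
    next
      case True
      have "((\<lambda>y. ((u y - u x) - (y - x) *\<^sub>R d) /\<^sub>R norm (y - x)) \<longlongrightarrow> 0) (at x)"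
        using du unfolding has_vector_derivative_def has_derivative_at_within by simp
      then have "((\<lambda>y. norm (((u y - u x) - (y - x) *\<^sub>R d) /\<^sub>R norm (y - x))) \<longlongrightarrow> 0) (at x)"
        by (rule tendsto_norm_zero)
      moreover have "\<forall>\<^sub>F y in at x. norm (((u y - u x) - (y - x) *\<^sub>R d) /\<^sub>R norm (y - x)) = norm (q y - d)"
      proof (rule eventually_at_filter[THEN iffD2], rule always_eventually, intro allI impI)
        fix y assume "y \<noteq> x"
        then have "(u y - u x) - (y - x) *\<^sub>R d = (q y - d) * of_real (y - x)"
          by (simp add: q_def scaleR_conv_of_real field_simps)
        then show "norm (((u y - u x) - (y - x) *\<^sub>R d) /\<^sub>R norm (y - x)) = norm (q y - d)"
          using \<open>y \<noteq> x\<close> by (simp add: norm_mult del: of_real_diff)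
      qed
      ultimately have "((\<lambda>y. norm (q y - d)) \<longlongrightarrow> 0) (at x)"
        by (rule Lim_transform_eventually)
      then have "(q \<longlongrightarrow> d) (at x)"
        by (simp add: tendsto_norm_zero_iff LIM_zero_iff)
      then show ?thesis
        using True by (auto simp: continuous_within q_def intro: tendsto_within_subset)
    qed
  qed
  have eq: "integral {0..b} (\<lambda>y. of_real (dirichlet_kernel A (y - x)) * u y)
     = integral {0..b} (\<lambda>y. of_real (sin (A * (y - x))) * q y)
       + of_real (integral {0..b} (\<lambda>y. dirichlet_kernel A (y - x))) * u x" for A
  proof -
    have 1: "of_real (dirichlet_kernel A (y - x)) * u y
       = of_real (sin (A * (y - x))) * q y + of_real (dirichlet_kernel A (y - x)) * u x" for y
    proof (cases "y = x")
      case False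
      have alg: "c / D * a = c * ((a - b) / D) + c / D * b" if "D \<noteq> 0" for a b c D :: complex
        using that by (simp add: field_simps)
      show ?thesis using alg[of "of_real (y - x)" "of_real (sin (A * (y - x)))" "u y" "u x"] False
        by (simp add: q_def dirichlet_kernel_eq)
    qed (simp add: q_def)
    have 2: "integral {0..b} (\<lambda>y. of_real (dirichlet_kernel A (y - x)) * u x)
        = of_real (integral {0..b} (\<lambda>y. dirichlet_kernel A (y - x))) * u x"
    proof -
      have "((\<lambda>y. dirichlet_kernel A (y - x)) has_integral (integral {0..b} (\<lambda>y. dirichlet_kernel A (y - x)))) {0..b}"
        by (intro integrable_integral integrable_continuous_interval continuous_intros)
      from has_integral_mult_left[OF has_integral_of_real[OF this], of "u x"]
      show ?thesis by (rule integral_unique)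
    qed
    have "integral {0..b} (\<lambda>y. of_real (dirichlet_kernel A (y - x)) * u y)
       = integral {0..b} (\<lambda>y. of_real (sin (A * (y - x))) * q y + of_real (dirichlet_kernel A (y - x)) * u x)"
      by (rule integral_cong) (rule 1)
    also have "\<dots> = integral {0..b} (\<lambda>y. of_real (sin (A * (y - x))) * q y)
       + integral {0..b} (\<lambda>y. of_real (dirichlet_kernel A (y - x)) * u x)"
      by (rule integral_add; intro integrable_continuous_interval continuous_intros q)
    finally show ?thesis unfolding 2 .
  qed
  have b: "0 \<le> b" using x by simp
  have "((\<lambda>A. integral {0..b} (\<lambda>y. of_real (sin (A * (y - x))) * q y)
       + of_real (integral {0..b} (\<lambda>y. dirichlet_kernel A (y - x))) * u x) \<longlongrightarrow> 0 + of_real pi * u x) at_top"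
    by (intro tendsto_add tendsto_mult tendsto_of_real tendsto_const sine_integral_limit[OF b q]
        dirichlet_kernel_integral_limit x)
  then show ?thesis unfolding eq by simp
qed

text \<open>The point \<open>- x\<close> lies outside the interval, so the quotient by \<open>y + x\<close> is harmless and only the
  Riemann-Lebesgue lemma is left.\<close>

lemma dirichlet_limit_outside:
  fixes u :: "real \<Rightarrow> complex"
  assumes x: "0 < x" "0 \<le> b" and u: "continuous_on {0..b} u"
  shows "((\<lambda>A. integral {0..b} (\<lambda>y. of_real (dirichlet_kernel A (y + x)) * u y)) \<longlongrightarrow> 0) at_top"
proof -
  have v: "continuous_on {0..b} (\<lambda>y. u y / of_real (y + x))"
    using x by (intro continuous_intros u) (auto simp flip: of_real_add)
  have eq: "integral {0..b} (\<lambda>y. of_real (dirichlet_kernel A (y + x)) * u y)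
      = integral {0..b} (\<lambda>y. of_real (sin (A * (y - (- x)))) * (u y / of_real (y + x)))" for A
    by (rule integral_cong) (use x in \<open>auto simp: dirichlet_kernel_eq\<close>)
  show ?thesis unfolding eq by (rule sine_integral_limit[OF x(2) v])
qed

definition trunc_hat :: "real \<Rightarrow> (real \<Rightarrow> complex) \<Rightarrow> real \<Rightarrow> complex" where
  "trunc_hat R u l = integral {0..R} (\<lambda>y. exp (- \<i> * of_real l * of_real y) * u y)"

lemma continuous_on_trunc_hat:
  assumes u: "continuous_on {0..R} u"
  shows "continuous_on T (\<lambda>l. trunc_hat R u (s * l))"
proof -
  have "continuous_on (T \<times> cbox 0 R) (\<lambda>(l, y). exp (- \<i> * of_real (s * l) * of_real y) * u y)"
    unfolding case_prod_beta
    by (intro continuous_intros continuous_on_compose2[OF u]) auto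
  from integral_continuous_on_param[OF this] show ?thesis
    by (simp add: trunc_hat_def cbox_interval)
qed

text \<open>Interchanging the two integrations produces Dirichlet's kernel.  The sign \<open>s\<close> covers both the
  transform and its reflection, that is, both halves of an odd or even extension.\<close>

lemma trunc_hat_fourier_integral:
  assumes R: "R \<ge> 0" and A: "A \<ge> 0" and u: "continuous_on {0..R} u"
  shows "integral {-A..A} (\<lambda>l. exp (\<i> * of_real l * of_real x) * trunc_hat R u (s * l))
       = 2 * integral {0..R} (\<lambda>y. of_real (dirichlet_kernel A (x - s * y)) * u y)"
proof -
  let ?k = "\<lambda>l y. exp (\<i> * of_real l * of_real (x - s * y)) * u y"
  have c: "continuous_on (cbox (-A, 0) (A, R)) (\<lambda>(l, y). ?k l y)"
    unfolding case_prod_beta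
    by (intro continuous_intros continuous_on_compose2[OF u]) (auto simp: cbox_Pair_eq)
  have "exp (\<i> * of_real l * of_real x) * trunc_hat R u (s * l) = integral {0..R} (?k l)" for l
  proof -
    have "exp (\<i> * of_real l * of_real x) * (exp (- \<i> * of_real (s * l) * of_real y) * u y) = ?k l y" for y
    proof -
      have "\<i> * of_real l * of_real x + - \<i> * of_real (s * l) * of_real y = \<i> * of_real l * of_real (x - s * y)"
        by (simp add: algebra_simps)
      then show ?thesis by (metis exp_add mult.assoc)
    qed
    then show ?thesis unfolding trunc_hat_def integral_mult_right[symmetric] by presburger
  qed
  then have "integral {-A..A} (\<lambda>l. exp (\<i> * of_real l * of_real x) * trunc_hat R u (s * l))
      = integral {-A..A} (\<lambda>l. integral {0..R} (?k l))"
    by presburger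
  also have "\<dots> = integral {0..R} (\<lambda>y. integral {-A..A} (\<lambda>l. ?k l y))"
    using integral_swap_continuous[OF c] by (simp add: cbox_interval)
  also have "\<dots> = integral {0..R} (\<lambda>y. 2 * (of_real (dirichlet_kernel A (x - s * y)) * u y))"
    by (intro integral_cong) (simp add: integral_exp_symmetric[OF A] del: of_real_diff)
  finally show ?thesis by simp
qed

lemma integrable_tail_small:
  fixes B :: "real \<Rightarrow> real"
  assumes B: "set_integrable lebesgue {0<..} B" and e: "e > 0"
  shows "\<exists>b>c. \<forall>R\<ge>b. integral {b..R} B < e"
proof -
  have "set_integrable lebesgue {1..} B"
    by (rule set_integrable_subset[OF B]) auto
  then have lim: "((\<lambda>b. LINT x:{1..b}|lebesgue. B x) \<longlongrightarrow> (LINT x:{1..}|lebesgue. B x)) at_top"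
    by (intro tendsto_set_lebesgue_integral_at_top) auto
  define L where "L = (LINT x:{1..}|lebesgue. B x)"
  from tendstoD[OF lim, of "e/2"] e obtain b0 where
    b0: "\<And>b. b \<ge> b0 \<Longrightarrow> \<bar>(LINT x:{1..b}|lebesgue. B x) - L\<bar> < e / 2"
    by (auto simp: eventually_at_top_linorder dist_real_def L_def)
  have si: "set_integrable lebesgue {1..b} B" for b
    by (rule set_integrable_subset[OF B]) auto
  define b where "b = max (max b0 (c + 1)) 1"
  show ?thesis
  proof (intro exI[of _ b] conjI allI impI)
    fix R assume R: "b \<le> R"
    have "integral {1..b} B + integral {b..R} B = integral {1..R} B"
      by (rule Henstock_Kurzweil_Integration.integral_combine)
        (use R set_lebesgue_integral_eq_integral[OF si] in \<open>auto simp: b_def\<close>)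
    then show "integral {b..R} B < e"
      using b0[of b] b0[of R] R set_lebesgue_integral_eq_integral(2)[OF si, of b]
        set_lebesgue_integral_eq_integral(2)[OF si, of R] unfolding b_def by linarith
  qed (simp add: b_def)
qed

text \<open>Otherwise \<open>B \<ge> e\<close> on a half-line, contradicting integrability.  This supplies radii at which a
  solution dominated by \<open>B\<close> is small.\<close>

lemma integrable_small_points:
  fixes B :: "real \<Rightarrow> real"
  assumes B: "set_integrable lebesgue {0<..} B" and e: "e > 0"
  shows "\<exists>R>c. B R < e"
proof (rule ccontr)
  assume "\<not> ?thesis"
  then have ge: "R > c \<Longrightarrow> B R \<ge> e" for R by force
  obtain b where b: "b > max c 0" "\<And>R. R \<ge> b \<Longrightarrow> integral {b..R} B < e"
    using integrable_tail_small[OF B e] by blast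
  have "set_integrable lebesgue {b..b+1} B"
    by (rule set_integrable_subset[OF B]) (use b in auto)
  then have "integral {b..b+1} (\<lambda>_. e) \<le> integral {b..b+1} B"
    by (intro integral_le set_lebesgue_integral_eq_integral(1) ge) (use b in auto)
  then show False using b(2)[of "b+1"] by simp
qed

text \<open>Far from \<open>z\<close> both factors of the integrand are square integrable, and
  \<open>2 \<bar>u\<bar> / (y - z) \<le> \<bar>u\<bar>\<^sup>2 + 1 / (y - z)\<^sup>2\<close>.  The bound does not depend on \<open>A\<close> or, apart from the
  tail of \<open>B\<close>, on \<open>R\<close>.\<close>

lemma dirichlet_kernel_far_bound:
  fixes u :: "real \<Rightarrow> complex"
  assumes B: "set_integrable lebesgue {0<..} B" and uB: "\<And>y. y > 0 \<Longrightarrow> (norm (u y))\<^sup>2 \<le> B y"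
    and u: "continuous_on {0..} u" and b: "0 < b" "z < b" "b \<le> R"
  shows "norm (integral {b..R} (\<lambda>y. of_real (dirichlet_kernel A (y - z)) * u y)) \<le> (integral {b..R} B + 1 / (b - z)) / 2"
proof -
  have iB: "B integrable_on {b..R}"
    by (intro set_lebesgue_integral_eq_integral(1) set_integrable_subset[OF B]) (use b in auto)
  have "((\<lambda>y. 1 / (y - z)^2) has_integral (- 1 / (R - z) - (- 1 / (b - z)))) {b..R}"
    by (rule fundamental_theorem_of_calculus[where f = "\<lambda>y. - 1 / (y - z)", OF b(3)])
      (use b in \<open>auto intro!: derivative_eq_intros simp: has_real_derivative_iff_has_vector_derivative[symmetric] power2_eq_square\<close>)
  note i2 = this
  have hi: "((\<lambda>y. (B y + 1 / (y - z)^2) / 2) has_integral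
      (integral {b..R} B + (- 1 / (R - z) - (- 1 / (b - z)))) / 2) {b..R}"
    by (intro has_integral_divide has_integral_add i2 integrable_integral iB)
  have "norm (integral {b..R} (\<lambda>y. of_real (dirichlet_kernel A (y - z)) * u y)) \<le> integral {b..R} (\<lambda>y. (B y + 1 / (y - z)^2) / 2)"
  proof (rule integral_norm_bound_integral)
    show "(\<lambda>y. of_real (dirichlet_kernel A (y - z)) * u y) integrable_on {b..R}"
      by (intro integrable_continuous_interval continuous_intros continuous_on_subset[OF u]) (use b in auto)
    show "(\<lambda>y. (B y + 1 / (y - z)^2) / 2) integrable_on {b..R}" using hi by blast
    fix y assume y: "y \<in> {b..R}"
    have yz: "y - z > 0" using y b by auto
    have "norm (of_real (dirichlet_kernel A (y - z)) * u y) \<le> 1 / (y - z) * norm (u y)"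
    proof -
      have "\<bar>dirichlet_kernel A (y - z)\<bar> \<le> 1 / (y - z)"
        using yz by (simp add: dirichlet_kernel_eq divide_right_mono)
      then show ?thesis unfolding norm_mult norm_of_real by (rule mult_right_mono) simp
    qed
    also have "\<dots> \<le> ((norm (u y))\<^sup>2 + (1 / (y - z))\<^sup>2) / 2"
      using sum_squares_bound[of "norm (u y)" "1 / (y - z)"] by (simp add: mult.commute)
    also have "\<dots> \<le> (B y + 1 / (y - z)^2) / 2"
      using uB[of y] y b by (simp add: power_divide)
    finally show "norm (of_real (dirichlet_kernel A (y - z)) * u y) \<le> (B y + 1 / (y - z)^2) / 2" .
  qed
  also have "\<dots> = (integral {b..R} B + (- 1 / (R - z) - (- 1 / (b - z)))) / 2"
    by (rule integral_unique[OF hi])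
  also have "\<dots> \<le> (integral {b..R} B + 1 / (b - z)) / 2"
    using b by simp
  finally show ?thesis .
qed

text \<open>Inversion for the extension of \<open>u\<close> to the line by \<open>\<kappa> u(- y)\<close>; \<open>\<kappa> = - 1\<close> is the odd and \<open>\<kappa> = 1\<close> the even
  one.  The transform \<open>S\<close> need not be a convergent integral: it is only assumed to be a limit of
  truncated transforms, uniform in the frequency.  For fixed \<open>A\<close> one lets the truncation tend to
  infinity.  The resulting Dirichlet integral is split at a large \<open>b\<close>; its far part is small
  uniformly in \<open>A\<close>, and on \<open>[0, b]\<close> the limits above apply.\<close>

theorem half_line_fourier_inversion:
  fixes u :: "real \<Rightarrow> complex"
  assumes B: "set_integrable lebesgue {0<..} B" and uB: "\<And>y. y > 0 \<Longrightarrow> (norm (u y))\<^sup>2 \<le> B y"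
    and u: "continuous_on {0..} u" and x: "x > 0" and du: "(u has_vector_derivative d) (at x)"
    and R: "filterlim R at_top sequentially"
    and \<delta>: "\<delta> \<longlonglongrightarrow> 0"
    and S: "\<And>A. set_integrable lborel {-A..A} (\<lambda>l. exp (\<i> * of_real l * of_real x) * S l)"
    and approx: "\<And>n l. l \<noteq> 0 \<Longrightarrow> norm (trunc_hat (R n) u l + \<kappa> * trunc_hat (R n) u (- l) - S l) \<le> \<delta> n"
    and lim: "((\<lambda>A. LINT l:{-A..A}|lborel. exp (\<i> * of_real l * of_real x) * S l) \<longlongrightarrow> L) at_top"
  shows "L = 2 * of_real pi * u x"
proof -
  define E where "E = (\<lambda>A R. integral {0..R} (\<lambda>y. of_real (dirichlet_kernel A (x - y)) * u y)
       + \<kappa> * integral {0..R} (\<lambda>y. of_real (dirichlet_kernel A (x + y)) * u y))"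
  define P where "P = (\<lambda>A. LINT l:{-A..A}|lborel. exp (\<i> * of_real l * of_real x) * S l)"
  have near: "(\<lambda>n. 2 * E A (R n)) \<longlonglongrightarrow> P A" if A: "A > 0" for A
  proof -
    have "\<forall>\<^sub>F n in sequentially. norm (2 * E A (R n) - P A) \<le> 2 * A * \<delta> n"
      using filterlim_at_top[THEN iffD1, OF R, rule_format, of 0]
    proof eventually_elim
      fix n assume Rn: "0 \<le> R n"
      have un: "continuous_on {0..R n} u" by (rule continuous_on_subset[OF u]) auto
      let ?e = "\<lambda>l. exp (\<i> * of_real l * of_real x)"
      let ?H = "\<lambda>s l. ?e l * trunc_hat (R n) u (s * l)"
      have Hi: "?H s integrable_on {-A..A}" for s
        by (intro integrable_continuous_interval continuous_intros continuous_on_trunc_hat un)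
      have iH: "((\<lambda>l. ?H 1 l + \<kappa> * ?H (-1) l) has_integral 2 * E A (R n)) {-A..A}"
      proof -
        have "((\<lambda>l. ?H 1 l + \<kappa> * ?H (-1) l) has_integral
            (integral {-A..A} (?H 1) + \<kappa> * integral {-A..A} (?H (-1)))) {-A..A}"
          by (intro has_integral_add has_integral_mult_right integrable_integral Hi)
        then show ?thesis
          using trunc_hat_fourier_integral[OF Rn less_imp_le[OF A] un, of x 1]
            trunc_hat_fourier_integral[OF Rn less_imp_le[OF A] un, of x "-1"]
          by (simp add: E_def algebra_simps)
      qed
      have iP: "((\<lambda>l. ?e l * S l) has_integral P A) {-A..A}"
        using set_borel_integral_eq_integral[OF S[of A]] unfolding P_def
        by (simp add: has_integral_integral)
      have iD: "((\<lambda>l. ?H 1 l + \<kappa> * ?H (-1) l - ?e l * S l) has_integral (2 * E A (R n) - P A)) {-A..A}"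
        by (intro has_integral_diff iH iP)
      \<comment> \<open>The approximation is not assumed at frequency \<open>0\<close>, a null set.\<close>
      have iD': "((\<lambda>l. if l = 0 then 0 else ?H 1 l + \<kappa> * ?H (-1) l - ?e l * S l) has_integral
          (2 * E A (R n) - P A)) {-A..A}"
        by (rule has_integral_spike[OF negligible_sing[of 0] _ iD]) auto
      have \<delta>n: "0 \<le> \<delta> n" using approx[of 1 n] by (rule order_trans[OF norm_ge_zero]) simp
      have "norm (integral {-A..A} (\<lambda>l. if l = 0 then 0 else ?H 1 l + \<kappa> * ?H (-1) l - ?e l * S l))
         \<le> integral {-A..A} (\<lambda>_. \<delta> n)"
      proof (rule integral_norm_bound_integral)
        fix l
        have "?H 1 l + \<kappa> * ?H (-1) l - ?e l * S l
            = ?e l * (trunc_hat (R n) u l + \<kappa> * trunc_hat (R n) u (- l) - S l)"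
          by (simp add: algebra_simps)
        then show "norm (if l = 0 then 0 else ?H 1 l + \<kappa> * ?H (-1) l - ?e l * S l) \<le> \<delta> n"
          using approx[of l n] \<delta>n by (simp add: norm_mult norm_exp_i_times mult.assoc flip: of_real_mult)
      qed (use iD' in auto)
      then show "norm (2 * E A (R n) - P A) \<le> 2 * A * \<delta> n"
        using A by (simp add: integral_unique[OF iD'])
    qed
    moreover have "(\<lambda>n. 2 * A * \<delta> n) \<longlonglongrightarrow> 0"
      using tendsto_mult_left[OF \<delta>, of "2 * A"] by simp
    ultimately have "(\<lambda>n. 2 * E A (R n) - P A) \<longlonglongrightarrow> 0"
      by (rule Lim_null_comparison)
    then show ?thesis by (simp add: LIM_zero_iff)
  qed
  have close: "norm (L - 2 * of_real pi * u x) \<le> 2 * (1 + norm \<kappa>) * e" if e: "e > 0" for e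
  proof -
    obtain b where b: "b > x + 1 / e" "\<And>R. R \<ge> b \<Longrightarrow> integral {b..R} B < e"
      using integrable_tail_small[OF B e] by blast
    have bx: "b > x" "b > 0" "- x < b"
      using b(1) x e by (smt (verit) divide_pos_pos)+
    have inv: "1 / (b - x) \<le> e" "1 / (b - (- x)) \<le> e"
    proof -
      show 1: "1 / (b - x) \<le> e" using b(1) e bx by (simp add: field_simps)
      have "1 / (b - (- x)) \<le> 1 / (b - x)" using bx x by (intro divide_left_mono) auto
      with 1 show "1 / (b - (- x)) \<le> e" by simp
    qed
    define I where "I = (\<lambda>s. \<lambda>A R. integral {0..R} (\<lambda>y. of_real (dirichlet_kernel A (y - s)) * u y))"
    have EI: "E A R = I x A R + \<kappa> * I (- x) A R" for A R
      using dirichlet_kernel_minus[of A "y - x" for y] by (simp add: E_def I_def add.commute)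
    have far: "norm (I s A R - I s A b) \<le> e" if s: "s = x \<or> s = - x" and Rb: "R \<ge> b" for s A R
    proof -
      have "I s A b + integral {b..R} (\<lambda>y. of_real (dirichlet_kernel A (y - s)) * u y) = I s A R"
        unfolding I_def using Rb bx
        by (intro Henstock_Kurzweil_Integration.integral_combine integrable_continuous_interval
            continuous_intros continuous_on_subset[OF u]) auto
      then have "I s A R - I s A b = integral {b..R} (\<lambda>y. of_real (dirichlet_kernel A (y - s)) * u y)"
        by (simp add: algebra_simps)
      also have "norm \<dots> \<le> (integral {b..R} B + 1 / (b - s)) / 2"
        by (rule dirichlet_kernel_far_bound[OF B uB u]) (use bx s Rb in auto)
      also have "\<dots> \<le> e" using inv b(2)[OF Rb] s by auto
      finally show ?thesis .
    qed
    have Efar: "norm (E A R - E A b) \<le> (1 + norm \<kappa>) * e" if Rb: "R \<ge> b" for A R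
    proof -
      have "E A R - E A b = (I x A R - I x A b) + \<kappa> * (I (- x) A R - I (- x) A b)"
        by (simp add: EI algebra_simps)
      also have "norm \<dots> \<le> norm (I x A R - I x A b) + norm \<kappa> * norm (I (- x) A R - I (- x) A b)"
        unfolding norm_mult[symmetric] by (rule norm_triangle_ineq)
      also have "\<dots> \<le> e + norm \<kappa> * e"
        by (intro add_mono mult_left_mono far Rb) auto
      finally show ?thesis by (simp add: algebra_simps)
    qed
    have PE: "norm (P A - 2 * E A b) \<le> 2 * (1 + norm \<kappa>) * e" if A: "A > 0" for A
    proof (rule tendsto_upperbound)
      show "(\<lambda>n. norm (2 * E A (R n) - 2 * E A b)) \<longlonglongrightarrow> norm (P A - 2 * E A b)"
        by (intro tendsto_intros near A)
      have "norm (2 * E A R - 2 * E A b) \<le> 2 * (1 + norm \<kappa>) * e" if "R \<ge> b" for R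
      proof -
        have "2 * E A R - 2 * E A b = 2 * (E A R - E A b)" by simp
        then have "norm (2 * E A R - 2 * E A b) = 2 * norm (E A R - E A b)" by (simp only: norm_mult) simp
        also have "\<dots> \<le> 2 * ((1 + norm \<kappa>) * e)" using Efar[OF that, of A] by simp
        finally show ?thesis by (simp only: mult.assoc)
      qed
      then show "\<forall>\<^sub>F n in sequentially. norm (2 * E A (R n) - 2 * E A b) \<le> 2 * (1 + norm \<kappa>) * e"
        using filterlim_at_top[THEN iffD1, OF R, rule_format, of b] by (auto elim: eventually_mono)
    qed simp
    have ub: "continuous_on {0..b} u" by (rule continuous_on_subset[OF u]) auto
    have "((\<lambda>A. E A b) \<longlongrightarrow> of_real pi * u x + \<kappa> * 0) at_top"
      unfolding EI I_def using dirichlet_limit_outside[OF x less_imp_le[OF bx(2)] ub]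
      by (intro tendsto_add tendsto_mult tendsto_const dirichlet_limit_inside[OF x bx(1) ub du]) simp
    then have "((\<lambda>A. norm (P A - 2 * E A b)) \<longlongrightarrow> norm (L - 2 * (of_real pi * u x + \<kappa> * 0))) at_top"
      unfolding P_def by (intro tendsto_intros lim)
    then have "norm (L - 2 * (of_real pi * u x + \<kappa> * 0)) \<le> 2 * (1 + norm \<kappa>) * e"
      by (rule tendsto_upperbound) (rule eventually_mono[OF eventually_gt_at_top[of 0]], rule PE, simp_all)
    then show ?thesis by (simp add: mult.assoc)
  qed
  have "norm (L - 2 * of_real pi * u x) \<le> 0"
  proof (rule field_le_epsilon)
    fix e :: real assume "e > 0"
    have k: "2 * (1 + norm \<kappa>) > 0" by (smt (verit) norm_ge_zero)
    show "norm (L - 2 * of_real pi * u x) \<le> 0 + e"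
      using close[of "e / (2 * (1 + norm \<kappa>))"] k \<open>e > 0\<close> by simp
  qed
  then show ?thesis by simp
qed

section \<open>Truncated transforms of functions on the quadrant\<close>

abbreviation punctured_quad :: "(real \<times> real) set" where
  "punctured_quad \<equiv> Quad_closed - {(0, 0)}"

lemma Ck_on_SucD:
  assumes "Ck_on (Suc k) S u"
  shows "continuous_on S (\<lambda>(x, t). u x t)" "Ck_on k S (dx u)" "Ck_on k S (dt u)"
    and "(x, t) \<in> S \<Longrightarrow> ((\<lambda>y. u y t) has_vector_derivative dx u x t) (at x within {0..})"
    and "(x, t) \<in> S \<Longrightarrow> ((\<lambda>s. u x s) has_vector_derivative dt u x t) (at t within {0..})"
  using assms by (auto simp: dx_def dt_def vector_derivative_works)

lemma Ck_on_continuous: "Ck_on k S u \<Longrightarrow> continuous_on S (\<lambda>(x, t). u x t)"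
  by (cases k) auto

lemma continuous_on_fst_slice:
  assumes "continuous_on S (\<lambda>(x, t). u x t)" "\<And>x. x \<in> T \<Longrightarrow> (x, t) \<in> S"
  shows "continuous_on T (\<lambda>x. u x t :: complex)"
proof -
  have "continuous_on T ((\<lambda>(x, t). u x t) \<circ> (\<lambda>x. (x, t)))"
    by (intro continuous_on_compose continuous_intros continuous_on_subset[OF assms(1)]) (use assms(2) in auto)
  then show ?thesis by (simp add: o_def)
qed

lemma continuous_on_swapped:
  assumes "continuous_on S (\<lambda>(x, t). u x t)" "\<And>x t. x \<in> X \<Longrightarrow> t \<in> T \<Longrightarrow> (x, t) \<in> S"
  shows "continuous_on (T \<times> X) (\<lambda>(t, x). u x t :: complex)"
proof -
  have "continuous_on (T \<times> X) ((\<lambda>(x, t). u x t) \<circ> prod.swap)"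
    by (intro continuous_on_compose continuous_on_swap continuous_on_subset[OF assms(1)]) (use assms(2) in auto)
  then show ?thesis by (simp add: o_def case_prod_beta)
qed

lemma trunc_hat_add:
  assumes "continuous_on {0..R} u" "continuous_on {0..R} v"
  shows "trunc_hat R (\<lambda>y. u y + v y) l = trunc_hat R u l + trunc_hat R v l"
  unfolding trunc_hat_def distrib_left
  by (rule integral_add; intro integrable_continuous_interval continuous_intros assms)

lemma trunc_hat_cmult: "trunc_hat R (\<lambda>y. c * u y) l = c * trunc_hat R u l"
  unfolding trunc_hat_def integral_mult_right[symmetric] by (simp add: mult.left_commute)

text \<open>The differential equations hold only for \<open>x > 0\<close>; the endpoint does not influence the transform.\<close>

lemma trunc_hat_cong_pos:
  assumes "\<And>y. 0 < y \<Longrightarrow> y \<le> R \<Longrightarrow> u y = v y"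
  shows "trunc_hat R u l = trunc_hat R v l"
  unfolding trunc_hat_def
  by (rule integral_spike[of "{0}"]) (use assms in auto)

lemma continuous_on_trunc_hat_param:
  assumes "continuous_on (T \<times> {0..R}) (\<lambda>(t, y). u y t)"
  shows "continuous_on T (\<lambda>t. trunc_hat R (\<lambda>y. u y t) l)"
proof -
  have "continuous_on (T \<times> cbox 0 R) (\<lambda>(t, y). exp (- \<i> * of_real l * of_real y) * u y t)"
    using assms unfolding case_prod_beta cbox_interval by (intro continuous_intros)
  from integral_continuous_on_param[OF this] show ?thesis
    by (simp add: trunc_hat_def cbox_interval)
qed

lemma trunc_hat_derivative:
  assumes R: "0 \<le> R" and v: "\<And>y. y \<in> {0..R} \<Longrightarrow> (v has_vector_derivative v' y) (at y within {0..})"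
    and v': "continuous_on {0..R} v'"
  shows "trunc_hat R v' l = exp (- \<i> * of_real l * of_real R) * v R - v 0 + \<i> * of_real l * trunc_hat R v l"
proof -
  let ?e = "\<lambda>y. exp (- \<i> * of_real l * of_real y)"
  have de: "(?e has_vector_derivative (- \<i> * of_real l) * ?e y) (at y within S)" for y S
    by (rule has_vector_derivative_at_within, rule has_vector_derivative_real_field[of "\<lambda>y. exp (- \<i> * of_real l * y)"])
      (auto intro!: derivative_eq_intros)
  have vw: "(v has_vector_derivative v' y) (at y within {0..R})" if "y \<in> {0..R}" for y
    by (rule has_vector_derivative_within_subset[OF v]) (use that in auto)
  have cv: "continuous_on {0..R} v"
    unfolding continuous_on_eq_continuous_within
    using has_vector_derivative_continuous[OF vw] by blast
  have "((\<lambda>y. ?e y * v' y + (- \<i> * of_real l) * ?e y * v y) has_integral (?e R * v R - ?e 0 * v 0)) {0..R}"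
    by (rule fundamental_theorem_of_calculus[OF R]) (intro has_vector_derivative_mult de vw)
  moreover have "((\<lambda>y. ?e y * v' y + (- \<i> * of_real l) * (?e y * v y)) has_integral
      (trunc_hat R v' l + (- \<i> * of_real l) * trunc_hat R v l)) {0..R}"
    unfolding trunc_hat_def
    by (intro has_integral_add has_integral_mult_right integrable_integral
        integrable_continuous_interval continuous_intros v' cv)
  ultimately have "?e R * v R - ?e 0 * v 0 = trunc_hat R v' l + (- \<i> * of_real l) * trunc_hat R v l"
    by (auto intro: has_integral_unique simp: mult.assoc)
  then show ?thesis by (simp add: algebra_simps)
qed

lemma trunc_hat_time_derivative:
  assumes Y: "Ck_on 1 S Y" and S: "\<And>y s. 0 \<le> y \<Longrightarrow> s \<in> {a..t} \<Longrightarrow> (y, s) \<in> S"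
    and a: "0 \<le> a" and s: "s \<in> {a..t}"
  shows "((\<lambda>s. trunc_hat R (\<lambda>y. Y y s) l) has_vector_derivative trunc_hat R (\<lambda>y. dt Y y s) l) (at s within {a..t})"
proof -
  note Y' = Ck_on_SucD[OF Y[unfolded One_nat_def]]
  let ?e = "\<lambda>y. exp (- \<i> * of_real l * of_real y)"
  have "((\<lambda>s. integral (cbox 0 R) (\<lambda>y. ?e y * Y y s)) has_vector_derivative
      integral (cbox 0 R) (\<lambda>y. ?e y * dt Y y s)) (at s within {a..t})"
  proof (rule leibniz_rule_vector_derivative)
    show "((\<lambda>s. ?e y * Y y s) has_vector_derivative ?e y * dt Y y s) (at s within {a..t})"
      if "s \<in> {a..t}" "y \<in> cbox 0 R" for s y
      by (rule has_vector_derivative_mult_right, rule has_vector_derivative_within_subset[OF Y'(5)[OF S]])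
        (use that a in auto)
    show "(\<lambda>y. ?e y * Y y s) integrable_on cbox 0 R" if "s \<in> {a..t}" for s
      unfolding cbox_interval
      by (intro integrable_continuous_interval continuous_intros continuous_on_fst_slice[OF Y'(1) S])
        (use that in auto)
    have "continuous_on ({a..t} \<times> cbox 0 R) (\<lambda>(s, y). dt Y y s)"
      by (rule continuous_on_swapped[OF Ck_on_continuous[OF Y'(3)] S]) auto
    then show "continuous_on ({a..t} \<times> cbox 0 R) (\<lambda>(s, y). ?e y * dt Y y s)"
      unfolding case_prod_beta by (intro continuous_intros)
  qed (use s in auto)
  then show ?thesis by (simp add: trunc_hat_def cbox_interval)
qed

text \<open>The solution may be singular at the corner, so its convergence to the initial values is not
  uniform near \<open>y = 0\<close>.  The dominating function \<open>(1 + B) / 2\<close> is integrable on bounded intervals and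
  takes the place of uniformity.\<close>

lemma trunc_hat_tendsto_initial:
  fixes Y :: "real \<Rightarrow> real \<Rightarrow> complex"
  assumes Y: "\<And>n. continuous_on {0..R} (\<lambda>y. Y y (\<epsilon> n))" and R: "R > 0"
    and B: "set_integrable lebesgue {0<..} B"
    and dom: "\<And>y n. 0 < y \<Longrightarrow> (norm (Y y (\<epsilon> n)))\<^sup>2 \<le> B y"
    and lim: "\<And>y. 0 < y \<Longrightarrow> (\<lambda>n. Y y (\<epsilon> n)) \<longlonglongrightarrow> g y"
  shows "(\<lambda>n. trunc_hat R (\<lambda>y. Y y (\<epsilon> n)) l) \<longlonglongrightarrow> trunc_hat R g l"
proof -
  let ?e = "\<lambda>y. exp (- \<i> * of_real l * of_real y)"
  have half_open: "integral {0..R} F = integral {0<..R} F" for F :: "real \<Rightarrow> complex"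
    by (rule integral_spike_set; rule negligible_subset[OF negligible_sing[of 0]]) auto
  have BI: "(\<lambda>y. (1 + B y) / 2) integrable_on {0<..R}"
  proof -
    have "set_integrable lebesgue {0<..R} B" by (rule set_integrable_subset[OF B]) auto
    moreover have "set_integrable lebesgue {0<..R} (\<lambda>y. 1 :: real)"
      by (rule set_integrable_subset[OF absolutely_integrable_on_const[of "{0..R}"]]) auto
    ultimately show ?thesis
      by (intro set_lebesgue_integral_eq_integral(1) set_integrable_divide set_integral_add(1)) auto
  qed
  have "(\<lambda>n. integral {0<..R} (\<lambda>y. ?e y * Y y (\<epsilon> n))) \<longlonglongrightarrow> integral {0<..R} (\<lambda>y. ?e y * g y)"
  proof (rule dominated_convergence(2)[OF _ BI])
    show "(\<lambda>y. ?e y * Y y (\<epsilon> n)) integrable_on {0<..R}" for n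
    proof (rule integrable_spike_set[of _ "{0..R}"])
      show "(\<lambda>y. ?e y * Y y (\<epsilon> n)) integrable_on {0..R}"
        by (intro integrable_continuous_interval continuous_intros Y)
    qed (rule negligible_subset[OF negligible_sing[of 0]]; auto)+
    show "norm (?e y * Y y (\<epsilon> n)) \<le> (1 + B y) / 2" if "y \<in> {0<..R}" for n y
    proof -
      have "norm (Y y (\<epsilon> n)) \<le> (1 + (norm (Y y (\<epsilon> n)))\<^sup>2) / 2"
        using sum_squares_bound[of 1 "norm (Y y (\<epsilon> n))"] by simp
      then show ?thesis using dom[of y n] that by (simp add: norm_mult)
    qed
    show "(\<lambda>n. ?e y * Y y (\<epsilon> n)) \<longlonglongrightarrow> ?e y * g y" if "y \<in> {0<..R}" for y
      using that by (intro tendsto_intros lim) auto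
  qed
  then show ?thesis by (simp add: trunc_hat_def half_open)
qed

section \<open>Evolution of the truncated transforms of a solution\<close>

text \<open>A solution of the initial-boundary value problem.  Its behaviour at infinity enters the individual
  statements through a dominating function \<open>B\<close>.\<close>

locale dirac_half_line =
  fixes m :: real and g1 g2 h1 :: "real \<Rightarrow> complex" and f1 f2 Y1 Y2 :: "real \<Rightarrow> real \<Rightarrow> complex"
  assumes Y_C1: "Ck_on 1 punctured_quad Y1" "Ck_on 1 punctured_quad Y2"
    and pde1: "(x, t) \<in> Quad \<Longrightarrow> dt Y1 x t = - dx Y2 x t - \<i> * of_real m * Y1 x t + f1 x t"
    and pde2: "(x, t) \<in> Quad \<Longrightarrow> dt Y2 x t = - dx Y1 x t + \<i> * of_real m * Y2 x t + f2 x t"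
    and init1: "x > 0 \<Longrightarrow> ((\<lambda>t. Y1 x t) \<longlongrightarrow> g1 x) (at_right 0)"
    and init2: "x > 0 \<Longrightarrow> ((\<lambda>t. Y2 x t) \<longlongrightarrow> g2 x) (at_right 0)"
    and bdry: "t > 0 \<Longrightarrow> ((\<lambda>x. Y1 x t) \<longlongrightarrow> h1 t) (at_right 0)"
    and f_cont: "continuous_on Quad_closed (\<lambda>(x, t). f1 x t)" "continuous_on Quad_closed (\<lambda>(x, t). f2 x t)"
    and h_cont: "continuous_on {0..} h1"
begin

lemmas Y1D = Ck_on_SucD[OF Y_C1(1)[unfolded One_nat_def]]
lemmas Y2D = Ck_on_SucD[OF Y_C1(2)[unfolded One_nat_def]]

lemma in_punctured: "0 \<le> y \<Longrightarrow> 0 < s \<Longrightarrow> (y, s) \<in> punctured_quad"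
  by (auto simp: Quad_closed_def)

lemma boundary_value:
  assumes "t > 0" shows "Y1 0 t = h1 t"
proof -
  have "continuous_on {0..} (\<lambda>x. Y1 x t)"
    by (rule continuous_on_fst_slice[OF Y1D(1)]) (use assms in_punctured in auto)
  then have "((\<lambda>x. Y1 x t) \<longlongrightarrow> Y1 0 t) (at 0 within {0..})"
    by (auto simp: continuous_on_def)
  then have "((\<lambda>x. Y1 x t) \<longlongrightarrow> Y1 0 t) (at_right 0)"
    by (rule tendsto_within_subset) auto
  then show ?thesis using bdry[OF assms] by (intro tendsto_unique) auto
qed

abbreviation trunc_Y1 where "trunc_Y1 R l s \<equiv> trunc_hat R (\<lambda>y. Y1 y s) l"
abbreviation trunc_Y2 where "trunc_Y2 R l s \<equiv> trunc_hat R (\<lambda>y. Y2 y s) l"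
abbreviation trunc_f1 where "trunc_f1 R l s \<equiv> trunc_hat R (\<lambda>y. f1 y s) l"
abbreviation trunc_f2 where "trunc_f2 R l s \<equiv> trunc_hat R (\<lambda>y. f2 y s) l"

text \<open>The system satisfied by the truncated transforms.  Integration by parts leaves the boundary values
  at \<open>0\<close> and at \<open>R\<close>.\<close>

lemma trunc_hat_evolution:
  assumes s: "s > 0" and R: "R \<ge> 0"
  shows "trunc_hat R (\<lambda>y. dt Y1 y s) l
        = - (exp (- \<i> * of_real l * of_real R) * Y2 R s - Y2 0 s) - \<i> * of_real l * trunc_Y2 R l s
          - \<i> * of_real m * trunc_Y1 R l s + trunc_f1 R l s" (is ?A)
    and "trunc_hat R (\<lambda>y. dt Y2 y s) l
        = - (exp (- \<i> * of_real l * of_real R) * Y1 R s - h1 s) - \<i> * of_real l * trunc_Y1 R l s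
          + \<i> * of_real m * trunc_Y2 R l s + trunc_f2 R l s" (is ?B)
proof -
  have c: "continuous_on {0..R} (\<lambda>y. u y s)" if "continuous_on punctured_quad (\<lambda>(x, t). u x t)" for u :: "real \<Rightarrow> real \<Rightarrow> complex"
    by (rule continuous_on_fst_slice[OF that in_punctured]) (use s in auto)
  have cf: "continuous_on {0..R} (\<lambda>y. f1 y s)" "continuous_on {0..R} (\<lambda>y. f2 y s)"
    using s by (auto intro!: continuous_on_fst_slice[OF f_cont(1)] continuous_on_fst_slice[OF f_cont(2)] simp: Quad_closed_def)
  note cY = c[OF Y1D(1)] c[OF Y2D(1)] c[OF Ck_on_continuous[OF Y1D(2)]] c[OF Ck_on_continuous[OF Y2D(2)]]
  have "trunc_hat R (\<lambda>y. dt Y1 y s) l = trunc_hat R (\<lambda>y. (- 1) * dx Y2 y s + ((- \<i> * of_real m) * Y1 y s + f1 y s)) l"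
    by (rule trunc_hat_cong_pos) (use s in \<open>simp add: pde1 Quad_def\<close>)
  also have "\<dots> = (- 1) * trunc_hat R (\<lambda>y. dx Y2 y s) l + ((- \<i> * of_real m) * trunc_Y1 R l s + trunc_f1 R l s)"
    by (subst trunc_hat_add trunc_hat_cmult; (intro continuous_intros cY cf)?)+ simp
  also have "trunc_hat R (\<lambda>y. dx Y2 y s) l =
      exp (- \<i> * of_real l * of_real R) * Y2 R s - Y2 0 s + \<i> * of_real l * trunc_Y2 R l s"
    by (rule trunc_hat_derivative[OF R _ cY(4)], rule Y2D(4), rule in_punctured) (use s in auto)
  finally show ?A by (simp add: algebra_simps)
  have "trunc_hat R (\<lambda>y. dt Y2 y s) l = trunc_hat R (\<lambda>y. (- 1) * dx Y1 y s + ((\<i> * of_real m) * Y2 y s + f2 y s)) l"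
    by (rule trunc_hat_cong_pos) (use s in \<open>simp add: pde2 Quad_def\<close>)
  also have "\<dots> = (- 1) * trunc_hat R (\<lambda>y. dx Y1 y s) l + ((\<i> * of_real m) * trunc_Y2 R l s + trunc_f2 R l s)"
    by (subst trunc_hat_add trunc_hat_cmult; (intro continuous_intros cY cf)?)+ simp
  also have "trunc_hat R (\<lambda>y. dx Y1 y s) l =
      exp (- \<i> * of_real l * of_real R) * Y1 R s - Y1 0 s + \<i> * of_real l * trunc_Y1 R l s"
    by (rule trunc_hat_derivative[OF R _ cY(3)], rule Y1D(4), rule in_punctured) (use s in auto)
  finally show ?B by (simp add: algebra_simps boundary_value[OF s])
qed

text \<open>In the difference of the transforms of \<open>Y1\<close> at \<open>\<plusminus>l\<close> (a sine transform) and the sum of those of \<open>Y2\<close>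
  (a cosine transform) the unknown boundary value \<open>Y2 0 t\<close> cancels.  The weights \<open>(a, b)\<close> will be a
  left eigenvector of the system of these two transforms, for an eigenvalue \<open>- w\<close>.\<close>

definition mode where
  "mode a b R l s = a * (trunc_Y1 R l s - trunc_Y1 R (- l) s) + b * (trunc_Y2 R l s + trunc_Y2 R (- l) s)"

definition mode_source where
  "mode_source a b w R l s = exp (w * of_real s) *
     (a * (trunc_f1 R l s - trunc_f1 R (- l) s) + b * (trunc_f2 R l s + trunc_f2 R (- l) s) + 2 * b * h1 s)"

definition mode_flux where
  "mode_flux a b w R l s = exp (w * of_real s) *
     (a * (exp (- \<i> * of_real l * of_real R) - exp (\<i> * of_real l * of_real R)) * Y2 R s
      + b * (exp (- \<i> * of_real l * of_real R) + exp (\<i> * of_real l * of_real R)) * Y1 R s)"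

text \<open>The two relations between \<open>a\<close>, \<open>b\<close> and \<open>w\<close> say that \<open>(a, b)\<close> is a left eigenvector with eigenvalue
  \<open>- w\<close>, so the factor \<open>exp (w s)\<close> removes the homogeneous part of the equation.\<close>

lemma mode_has_vector_derivative:
  assumes "0 < \<epsilon>" "s \<in> {\<epsilon>..t}" "R \<ge> 0"
    and ab: "(w - \<i> * of_real m) * a = \<i> * of_real l * b" "(w + \<i> * of_real m) * b = \<i> * of_real l * a"
  shows "((\<lambda>s. exp (w * of_real s) * mode a b R l s) has_vector_derivative
           (mode_source a b w R l s - mode_flux a b w R l s)) (at s within {\<epsilon>..t})"
proof -
  have s: "s > 0" using assms by auto
  have inQ: "0 \<le> y \<Longrightarrow> s \<in> {\<epsilon>..t} \<Longrightarrow> (y, s) \<in> punctured_quad" for y s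
    using in_punctured assms(1) by auto
  note tdY = trunc_hat_time_derivative[OF Y_C1(1) inQ less_imp_le[OF assms(1)] assms(2)]
    trunc_hat_time_derivative[OF Y_C1(2) inQ less_imp_le[OF assms(1)] assms(2)]
  have dV: "(mode a b R l has_vector_derivative
     (a * (trunc_hat R (\<lambda>y. dt Y1 y s) l - trunc_hat R (\<lambda>y. dt Y1 y s) (- l))
      + b * (trunc_hat R (\<lambda>y. dt Y2 y s) l + trunc_hat R (\<lambda>y. dt Y2 y s) (- l)))) (at s within {\<epsilon>..t})"
    unfolding mode_def[abs_def]
    by (intro has_vector_derivative_add has_vector_derivative_diff has_vector_derivative_mult_right tdY)
  have de: "((\<lambda>s. exp (w * of_real s)) has_vector_derivative w * exp (w * of_real s)) (at s within {\<epsilon>..t})"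
    by (rule has_vector_derivative_at_within, rule has_vector_derivative_real_field[of "\<lambda>s. exp (w * s)"])
      (auto intro!: derivative_eq_intros)
  let ?E = "exp (- \<i> * of_real l * of_real R)" and ?E' = "exp (\<i> * of_real l * of_real R)"
  let ?D1 = "trunc_Y1 R l s - trunc_Y1 R (- l) s" and ?S2 = "trunc_Y2 R l s + trunc_Y2 R (- l) s"
  have "a * (trunc_hat R (\<lambda>y. dt Y1 y s) l - trunc_hat R (\<lambda>y. dt Y1 y s) (- l))
      + b * (trunc_hat R (\<lambda>y. dt Y2 y s) l + trunc_hat R (\<lambda>y. dt Y2 y s) (- l))
     = a * (- (?E - ?E') * Y2 R s - \<i> * of_real l * ?S2 - \<i> * of_real m * ?D1 + (trunc_f1 R l s - trunc_f1 R (- l) s))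
       + b * (- (?E + ?E') * Y1 R s + 2 * h1 s - \<i> * of_real l * ?D1 + \<i> * of_real m * ?S2 + (trunc_f2 R l s + trunc_f2 R (- l) s))"
    unfolding trunc_hat_evolution[OF s assms(3)] by (simp add: algebra_simps)
  also have "\<dots> = (a * (trunc_f1 R l s - trunc_f1 R (- l) s) + b * (trunc_f2 R l s + trunc_f2 R (- l) s) + 2 * b * h1 s)
      - (a * (?E - ?E') * Y2 R s + b * (?E + ?E') * Y1 R s)
      - ((\<i> * of_real m * a + \<i> * of_real l * b) * ?D1 + (\<i> * of_real l * a - \<i> * of_real m * b) * ?S2)"
    by (simp add: algebra_simps)
  also have "\<i> * of_real m * a + \<i> * of_real l * b = w * a"
    unfolding ab(1)[symmetric] by (simp add: algebra_simps)
  also have "\<i> * of_real l * a - \<i> * of_real m * b = w * b"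
    unfolding ab(2)[symmetric] by (simp add: algebra_simps)
  finally have eq: "exp (w * of_real s) * (a * (trunc_hat R (\<lambda>y. dt Y1 y s) l - trunc_hat R (\<lambda>y. dt Y1 y s) (- l))
      + b * (trunc_hat R (\<lambda>y. dt Y2 y s) l + trunc_hat R (\<lambda>y. dt Y2 y s) (- l)))
      + w * exp (w * of_real s) * mode a b R l s = mode_source a b w R l s - mode_flux a b w R l s"
    by (simp only: mode_source_def mode_flux_def mode_def) (simp only: algebra_simps)
  show ?thesis
    using has_vector_derivative_mult[OF de dV] unfolding eq .
qed

lemma mode_source_continuous:
  assumes "R \<ge> 0" shows "continuous_on {0..t} (mode_source a b w R l)"
proof -
  have "continuous_on ({0..t} \<times> {0..R}) (\<lambda>(s, y). f1 y s)" "continuous_on ({0..t} \<times> {0..R}) (\<lambda>(s, y). f2 y s)"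
    by (rule continuous_on_swapped[OF f_cont(1)] continuous_on_swapped[OF f_cont(2)]; simp add: Quad_closed_def)+
  note c = continuous_on_trunc_hat_param[OF this(1)] continuous_on_trunc_hat_param[OF this(2)]
  show ?thesis unfolding mode_source_def[abs_def]
    by (intro continuous_intros c continuous_on_subset[OF h_cont]) auto
qed

text \<open>Integrating from a positive time keeps away from the corner, where the solution need not
  be differentiable.  The flux through \<open>x = R\<close> is estimated with \<open>\<bar>exp (w s)\<bar> = 1\<close>, which makes the error
  independent of the frequency except through \<open>a\<close> and \<open>b\<close>.\<close>

lemma evolution_from_positive_time:
  assumes eps: "0 < \<epsilon>" "\<epsilon> \<le> t" and R: "R > 0" and w: "Re w = 0"
    and ab: "(w - \<i> * of_real m) * a = \<i> * of_real l * b" "(w + \<i> * of_real m) * b = \<i> * of_real l * a"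
    and \<beta>: "\<And>s. 0 < s \<Longrightarrow> s \<le> t \<Longrightarrow> norm (Y1 R s) \<le> \<beta> \<and> norm (Y2 R s) \<le> \<beta>"
  shows "norm (exp (w * of_real t) * mode a b R l t - exp (w * of_real \<epsilon>) * mode a b R l \<epsilon> - integral {\<epsilon>..t} (mode_source a b w R l))
     \<le> 2 * t * (norm a + norm b) * \<beta>"
proof -
  have "((\<lambda>s. mode_source a b w R l s - mode_flux a b w R l s) has_integral
     (exp (w * of_real t) * mode a b R l t - exp (w * of_real \<epsilon>) * mode a b R l \<epsilon>)) {\<epsilon>..t}"
    by (rule fundamental_theorem_of_calculus[OF eps(2)], rule mode_has_vector_derivative) (use eps R ab in auto)
  moreover have "(mode_source a b w R l has_integral integral {\<epsilon>..t} (mode_source a b w R l)) {\<epsilon>..t}"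
    using eps R by (intro integrable_integral integrable_continuous_interval continuous_on_subset[OF mode_source_continuous[of R t]]) auto
  ultimately have "((\<lambda>s. mode_source a b w R l s - (mode_source a b w R l s - mode_flux a b w R l s)) has_integral
     (integral {\<epsilon>..t} (mode_source a b w R l) - (exp (w * of_real t) * mode a b R l t - exp (w * of_real \<epsilon>) * mode a b R l \<epsilon>))) {\<epsilon>..t}"
    by (rule has_integral_diff[rotated])
  then have hb: "(mode_flux a b w R l has_integral
     (integral {\<epsilon>..t} (mode_source a b w R l) - (exp (w * of_real t) * mode a b R l t - exp (w * of_real \<epsilon>) * mode a b R l \<epsilon>))) (cbox \<epsilon> t)"
    by (simp add: cbox_interval)
  have bb: "norm (mode_flux a b w R l s) \<le> 2 * (norm a + norm b) * \<beta>" if "s \<in> cbox \<epsilon> t" for s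
  proof -
    have s: "0 < s" "s \<le> t" using that eps by auto
    have e1: "norm (exp (- \<i> * of_real l * of_real R) - exp (\<i> * of_real l * of_real R)) \<le> 2"
      "norm (exp (- \<i> * of_real l * of_real R) + exp (\<i> * of_real l * of_real R)) \<le> 2"
      by (rule norm_triangle_ineq4[THEN order_trans] norm_triangle_ineq[THEN order_trans]; simp)+
    have "norm (mode_flux a b w R l s) \<le>
        norm (a * (exp (- \<i> * of_real l * of_real R) - exp (\<i> * of_real l * of_real R)) * Y2 R s)
      + norm (b * (exp (- \<i> * of_real l * of_real R) + exp (\<i> * of_real l * of_real R)) * Y1 R s)"
      unfolding mode_flux_def norm_mult[of "exp _"] using w by (simp add: norm_triangle_ineq)
    also have "\<dots> \<le> norm a * 2 * \<beta> + norm b * 2 * \<beta>"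
      unfolding norm_mult using \<beta>[OF s] by (intro add_mono mult_mono e1) (auto intro: order_trans[OF norm_ge_zero])
    finally show ?thesis by (simp add: algebra_simps)
  qed
  have \<beta>0: "\<beta> \<ge> 0" using \<beta>[of t] eps by (auto intro: order_trans[OF norm_ge_zero])
  have "norm (integral {\<epsilon>..t} (mode_source a b w R l) - (exp (w * of_real t) * mode a b R l t - exp (w * of_real \<epsilon>) * mode a b R l \<epsilon>))
     \<le> 2 * (norm a + norm b) * \<beta> * measure lborel (cbox \<epsilon> t)"
    by (rule has_integral_bound[OF _ hb bb]) (use \<beta>0 in auto)
  also have "\<dots> \<le> 2 * (norm a + norm b) * \<beta> * t"
    using eps \<beta>0 by (intro mult_left_mono) auto
  finally show ?thesis by (subst norm_minus_commute) (simp add: algebra_simps)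
qed

text \<open>Duhamel's formula for one mode up to the flux through \<open>x = R\<close>, obtained from the preceding
  estimate as the initial time tends to \<open>0\<close>.\<close>

theorem evolution:
  assumes t: "t > 0" and R: "R > 0" and w: "Re w = 0"
    and ab: "(w - \<i> * of_real m) * a = \<i> * of_real l * b" "(w + \<i> * of_real m) * b = \<i> * of_real l * a"
    and B: "set_integrable lebesgue {0<..} B"
    and dom: "\<And>y s. 0 < y \<Longrightarrow> 0 < s \<Longrightarrow> s \<le> t \<Longrightarrow> (norm (Y1 y s))\<^sup>2 \<le> B y \<and> (norm (Y2 y s))\<^sup>2 \<le> B y"
  shows "norm (exp (w * of_real t) * mode a b R l t
      - (a * (trunc_hat R g1 l - trunc_hat R g1 (- l)) + b * (trunc_hat R g2 l + trunc_hat R g2 (- l)))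
      - integral {0..t} (mode_source a b w R l)) \<le> 2 * t * (norm a + norm b) * sqrt (B R)"
proof -
  \<comment> \<open>A sequence of starting times in \<open>(0, t]\<close> tending to \<open>0\<close>.\<close>
  define \<epsilon> where "\<epsilon> = (\<lambda>n. t / real (Suc n))"
  have \<epsilon>: "0 < \<epsilon> n" "\<epsilon> n \<le> t" for n using t by (auto simp: \<epsilon>_def field_simps)
  have "(\<lambda>n. t * inverse (real (Suc n))) \<longlonglongrightarrow> t * 0"
    by (intro tendsto_intros LIMSEQ_inverse_real_of_nat)
  then have \<epsilon>0: "\<epsilon> \<longlonglongrightarrow> 0" by (simp add: \<epsilon>_def divide_inverse)
  then have \<epsilon>r: "filterlim \<epsilon> (at_right 0) sequentially"
    by (rule tendsto_imp_filterlim_at_right) (simp add: \<epsilon>)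
  have c: "continuous_on {0..R} (\<lambda>y. u y (\<epsilon> n))" if "continuous_on punctured_quad (\<lambda>(x, t). u x t)" for u :: "real \<Rightarrow> real \<Rightarrow> complex" and n
    by (rule continuous_on_fst_slice[OF that in_punctured]) (use \<epsilon> in auto)
  have h1: "(\<lambda>n. trunc_Y1 R l (\<epsilon> n)) \<longlonglongrightarrow> trunc_hat R g1 l" for l
    by (rule trunc_hat_tendsto_initial[where Y = Y1 and \<epsilon> = \<epsilon>, OF c[OF Y1D(1)] R B]) (use dom \<epsilon> filterlim_compose[OF init1 \<epsilon>r] in auto)
  have h2: "(\<lambda>n. trunc_Y2 R l (\<epsilon> n)) \<longlonglongrightarrow> trunc_hat R g2 l" for l
    by (rule trunc_hat_tendsto_initial[where Y = Y2 and \<epsilon> = \<epsilon>, OF c[OF Y2D(1)] R B]) (use dom \<epsilon> filterlim_compose[OF init2 \<epsilon>r] in auto)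
  have sc: "continuous_on {0..t} (mode_source a b w R l)" using R by (intro mode_source_continuous) auto
  have "continuous_on {0..t} (\<lambda>s. integral {0..s} (mode_source a b w R l))"
    by (rule indefinite_integral_continuous_1[OF integrable_continuous_interval[OF sc]])
  then have "((\<lambda>s. integral {0..s} (mode_source a b w R l)) \<longlongrightarrow> integral {0..0} (mode_source a b w R l)) (at 0 within {0..t})"
    unfolding continuous_on_def using t by (meson atLeastAtMost_iff less_imp_le order_refl)
  moreover have "filterlim \<epsilon> (at 0 within {0..t}) sequentially"
    unfolding filterlim_at using \<epsilon>0 \<epsilon> by (auto intro!: always_eventually less_imp_le simp: less_imp_neq[symmetric])
  ultimately have "(\<lambda>n. integral {0..\<epsilon> n} (mode_source a b w R l)) \<longlonglongrightarrow> 0"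
    by (auto dest: filterlim_compose)
  then have "(\<lambda>n. integral {0..t} (mode_source a b w R l) - integral {0..\<epsilon> n} (mode_source a b w R l)) \<longlonglongrightarrow> integral {0..t} (mode_source a b w R l) - 0"
    by (intro tendsto_intros)
  moreover have "integral {0..t} (mode_source a b w R l) - integral {0..\<epsilon> n} (mode_source a b w R l) = integral {\<epsilon> n..t} (mode_source a b w R l)" for n
    using Henstock_Kurzweil_Integration.integral_combine[of 0 "\<epsilon> n" t "mode_source a b w R l"] \<epsilon>[of n]
      integrable_continuous_interval[OF sc] by (simp add: algebra_simps)
  ultimately have srcl: "(\<lambda>n. integral {\<epsilon> n..t} (mode_source a b w R l)) \<longlonglongrightarrow> integral {0..t} (mode_source a b w R l)"
    by simp
  have ew: "(\<lambda>n. exp (w * of_real (\<epsilon> n))) \<longlonglongrightarrow> exp (w * of_real 0)"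
    by (intro tendsto_intros \<epsilon>0)
  have "(\<lambda>n. norm (exp (w * of_real t) * mode a b R l t - exp (w * of_real (\<epsilon> n)) * mode a b R l (\<epsilon> n)
        - integral {\<epsilon> n..t} (mode_source a b w R l)))
     \<longlonglongrightarrow> norm (exp (w * of_real t) * mode a b R l t
        - exp (w * of_real 0) * (a * (trunc_hat R g1 l - trunc_hat R g1 (- l)) + b * (trunc_hat R g2 l + trunc_hat R g2 (- l)))
        - integral {0..t} (mode_source a b w R l))"
    unfolding mode_def[of a b R l "\<epsilon> _"] by (intro tendsto_intros ew srcl h1 h2)
  then have "norm (exp (w * of_real t) * mode a b R l t
        - exp (w * of_real 0) * (a * (trunc_hat R g1 l - trunc_hat R g1 (- l)) + b * (trunc_hat R g2 l + trunc_hat R g2 (- l)))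
        - integral {0..t} (mode_source a b w R l)) \<le> 2 * t * (norm a + norm b) * sqrt (B R)"
  proof (rule tendsto_upperbound)
    have "norm (Y1 R s) \<le> sqrt (B R) \<and> norm (Y2 R s) \<le> sqrt (B R)" if "0 < s" "s \<le> t" for s
      using dom[OF R that] by (auto intro: real_le_rsqrt)
    then show "\<forall>\<^sub>F n in sequentially. norm (exp (w * of_real t) * mode a b R l t - exp (w * of_real (\<epsilon> n)) * mode a b R l (\<epsilon> n)
        - integral {\<epsilon> n..t} (mode_source a b w R l)) \<le> 2 * t * (norm a + norm b) * sqrt (B R)"
      by (intro always_eventually allI evolution_from_positive_time \<epsilon> R w ab) auto
  qed simp
  then show ?thesis by simp
qed

end

section \<open>Transforms of quadratically decaying functions\<close>

lemma integrable_inverse_quadratic: "integrable lborel (\<lambda>y::real. 1 / (1 + y\<^sup>2))"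
  and integral_inverse_quadratic: "(LINT y|lborel. 1 / (1 + y\<^sup>2)) = pi"
proof -
  have U: "einterval (-\<infinity>) \<infinity> = UNIV" by (auto simp: einterval_def)
  show "integrable lborel (\<lambda>y::real. 1 / (1 + y\<^sup>2))"
    using integrable_inverse_1_plus_square by (simp add: U set_integrable_def inverse_eq_divide)
  show "(LINT y|lborel. 1 / (1 + y\<^sup>2)) = pi"
    using LBINT_inverse_1_plus_square
    by (simp add: interval_lebesgue_integral_def U set_lebesgue_integral_def inverse_eq_divide)
qed

lemma set_integrable_inverse_quadratic: "S \<in> sets lborel \<Longrightarrow> set_integrable lborel S (\<lambda>y::real. 1 / (1 + y\<^sup>2))"
  using integrable_inverse_quadratic unfolding set_integrable_def by (rule integrable_mult_indicator[rotated])

definition quadratic_decay :: "real \<Rightarrow> (real \<Rightarrow> complex) \<Rightarrow> bool" where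
  "quadratic_decay C u \<longleftrightarrow> continuous_on {0..} u \<and> (\<forall>y>0. norm (u y) \<le> C / (1 + y\<^sup>2))"

lemma quadratic_decay_continuous: "quadratic_decay C u \<Longrightarrow> S \<subseteq> {0..} \<Longrightarrow> continuous_on S u"
  by (auto simp: quadratic_decay_def intro: continuous_on_subset)

lemma quadratic_decay_bound: "quadratic_decay C u \<Longrightarrow> 0 < y \<Longrightarrow> norm (u y) \<le> C / (1 + y\<^sup>2)"
  by (simp add: quadratic_decay_def)

text \<open>The error, up to a constant, of truncating the transform of a quadratically decaying function.  It
  does not depend on the frequency.\<close>

definition quadratic_tail :: "real \<Rightarrow> real" where
  "quadratic_tail R = (LINT y:{R<..}|lborel. 1 / (1 + y\<^sup>2))"

lemma quadratic_tail_tendsto: "(quadratic_tail \<longlongrightarrow> 0) at_top"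
proof -
  have "((\<lambda>R. LINT y|lborel. indicator {R<..} y *\<^sub>R (1 / (1 + y\<^sup>2))) \<longlongrightarrow> (LINT y::real|lborel. 0)) (at_top :: real filter)"
  proof (rule integral_dominated_convergence_at_top[OF _ _ integrable_inverse_quadratic])
    show "\<forall>\<^sub>F R in at_top. AE y in lborel. norm (indicator {R<..} y *\<^sub>R (1 / (1 + y\<^sup>2))) \<le> 1 / (1 + y\<^sup>2)"
      by (auto split: split_indicator)
    show "AE y in lborel. ((\<lambda>R. indicator {R<..} y *\<^sub>R (1 / (1 + y\<^sup>2))) \<longlongrightarrow> 0) (at_top :: real filter)"
    proof (rule AE_I2)
      fix y :: real
      show "((\<lambda>R. indicator {R<..} y *\<^sub>R (1 / (1 + y\<^sup>2))) \<longlongrightarrow> 0) (at_top :: real filter)"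
        by (rule tendsto_eventually, rule eventually_mono[OF eventually_ge_at_top[of y]]) auto
    qed
  qed auto
  then show ?thesis by (simp add: quadratic_tail_def[abs_def] set_lebesgue_integral_def)
qed

lemma quadratic_decay_integrable:
  assumes u: "quadratic_decay C u" and S: "S \<in> sets lborel" "S \<subseteq> {0<..}"
  shows "set_integrable lborel S (\<lambda>y. exp (- \<i> * of_real l * of_real y) * u y)"
proof (rule set_integrable_bound)
  show "set_integrable lborel S (\<lambda>y. C * (1 / (1 + y\<^sup>2)))"
    by (intro set_integrable_mult_right set_integrable_inverse_quadratic S)
  have "continuous_on S u"
    by (rule quadratic_decay_continuous[OF u]) (use S in auto)
  then show "set_borel_measurable lborel S (\<lambda>y. exp (- \<i> * of_real l * of_real y) * u y)"
    using S unfolding set_borel_measurable_def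
    by (auto intro!: borel_measurable_continuous_on_indicator continuous_intros)
  show "AE y\<in>S in lborel. norm (exp (- \<i> * of_real l * of_real y) * u y) \<le> norm (C * (1 / (1 + y\<^sup>2)))"
  proof (intro AE_I2 impI)
    fix y assume "y \<in> S"
    then have "norm (u y) \<le> C / (1 + y\<^sup>2)" using quadratic_decay_bound[OF u] S by auto
    then have "norm (u y) \<le> \<bar>C / (1 + y\<^sup>2)\<bar>" by linarith
    then show "norm (exp (- \<i> * of_real l * of_real y) * u y) \<le> norm (C * (1 / (1 + y\<^sup>2)))"
      by (simp add: norm_mult)
  qed
qed

lemma quadratic_decay_integral_bound:
  assumes u: "quadratic_decay C u" and S: "S \<in> sets lborel" "S \<subseteq> {0<..}"
  shows "norm (LINT y:S|lborel. exp (- \<i> * of_real l * of_real y) * u y)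
      \<le> C * (LINT y:S|lborel. 1 / (1 + y\<^sup>2))"
proof -
  have "norm (LINT y:S|lborel. exp (- \<i> * of_real l * of_real y) * u y)
      \<le> (LINT y:S|lborel. C * (1 / (1 + y\<^sup>2)))"
    unfolding set_lebesgue_integral_def
  proof (rule order_trans[OF integral_norm_bound Bochner_Integration.integral_mono[OF integrable_norm]])
    show "integrable lborel (\<lambda>y. indicator S y *\<^sub>R (exp (- \<i> * of_real l * of_real y) * u y))"
      using quadratic_decay_integrable[OF u S] by (simp add: set_integrable_def)
    show "integrable lborel (\<lambda>y. indicator S y *\<^sub>R (C * (1 / (1 + y\<^sup>2))))"
      using set_integrable_mult_right[OF set_integrable_inverse_quadratic[OF S(1)], of C] by (simp add: set_integrable_def)
    show "norm (indicator S y *\<^sub>R (exp (- \<i> * of_real l * of_real y) * u y)) \<le> indicator S y *\<^sub>R (C * (1 / (1 + y\<^sup>2)))" for y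
      using quadratic_decay_bound[OF u, of y] S by (cases "y \<in> S") (auto simp: norm_mult)
  qed
  then show ?thesis by (simp only: set_integral_mult_right)
qed

lemma quadratic_decay_nonneg: "quadratic_decay C u \<Longrightarrow> 0 \<le> C"
  using order_trans[OF norm_ge_zero quadratic_decay_bound[of C u 1]] by simp

lemma norm_hat_le:
  assumes u: "quadratic_decay C u"
  shows "norm (hat u l) \<le> C * pi"
proof -
  have "norm (hat u l) \<le> C * (LINT y:{0<..}|lborel. 1 / (1 + y\<^sup>2))"
    unfolding hat_def by (rule quadratic_decay_integral_bound[OF u]) auto
  also have "\<dots> \<le> C * pi"
  proof (rule mult_left_mono[OF _ quadratic_decay_nonneg[OF u]])
    have "integrable lborel (\<lambda>y::real. indicator {0<..} y *\<^sub>R (1 / (1 + y\<^sup>2)))"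
      using set_integrable_inverse_quadratic[of "{0<..}"] by (simp add: set_integrable_def)
    from Bochner_Integration.integral_mono[OF this integrable_inverse_quadratic]
    show "(LINT y:{0<..}|lborel. 1 / (1 + y\<^sup>2)) \<le> pi"
      unfolding set_lebesgue_integral_def integral_inverse_quadratic by (auto split: split_indicator)
  qed
  finally show ?thesis .
qed

lemma trunc_hat_approximates_hat:
  assumes u: "quadratic_decay C u" and R: "R > 0"
  shows "norm (trunc_hat R u l - hat u l) \<le> C * quadratic_tail R"
proof -
  let ?k = "\<lambda>y. exp (- \<i> * of_real l * of_real y) * u y"
  have S: "{0<..} = {0<..R} \<union> {R<..}" "{0<..R} \<inter> {R<..} = {}" using R by auto
  have "hat u l = (LINT y:{0<..R}|lborel. ?k y) + (LINT y:{R<..}|lborel. ?k y)"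
    unfolding hat_def S(1)
    by (rule set_integral_Un[OF S(2)]; rule quadratic_decay_integrable[OF u]) (use R in auto)
  moreover have "(LINT y:{0<..R}|lborel. ?k y) = trunc_hat R u l"
  proof -
    have "(LINT y:{0<..R}|lborel. ?k y) = integral {0<..R} ?k"
      by (rule set_borel_integral_eq_integral(2), rule quadratic_decay_integrable[OF u]) auto
    also have "\<dots> = integral {0..R} ?k"
      by (rule integral_spike_set; rule negligible_subset[OF negligible_sing[of 0]]) auto
    finally show ?thesis by (simp add: trunc_hat_def)
  qed
  moreover have "norm (LINT y:{R<..}|lborel. ?k y) \<le> C * quadratic_tail R"
    unfolding quadratic_tail_def by (rule quadratic_decay_integral_bound[OF u]) (use R in auto)
  ultimately show ?thesis by (simp add: norm_minus_commute)
qed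

lemma trunc_hat_tendsto_hat:
  assumes u: "quadratic_decay C u"
  shows "((\<lambda>R. trunc_hat R u l) \<longlongrightarrow> hat u l) at_top"
proof -
  have "((\<lambda>R. C * quadratic_tail R) \<longlongrightarrow> 0) at_top"
    using tendsto_mult_left[OF quadratic_tail_tendsto, of C] by simp
  then have "((\<lambda>R. trunc_hat R u l - hat u l) \<longlongrightarrow> 0) at_top"
    by (rule Lim_null_comparison[rotated])
      (rule eventually_mono[OF eventually_gt_at_top[of 0]], rule trunc_hat_approximates_hat[OF u])
  then show ?thesis by (simp add: LIM_zero_iff)
qed

text \<open>The truncations of a transform depend continuously on a parameter and approximate it uniformly, so
  continuity passes to integrals over the half-line.\<close>

lemma continuous_on_quadratic_tail_limit:
  fixes G :: "'a::topological_space \<Rightarrow> complex"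
  assumes F: "\<And>R. R > 0 \<Longrightarrow> continuous_on S (F R)"
    and FG: "\<And>R x. R > 0 \<Longrightarrow> x \<in> S \<Longrightarrow> norm (F R x - G x) \<le> C * quadratic_tail R"
  shows "continuous_on S G"
proof (rule uniform_limit_theorem[of _ _ at_top])
  show "\<forall>\<^sub>F R in at_top. continuous_on S (F R)"
    by (rule eventually_mono[OF eventually_gt_at_top[of 0]], rule F)
  have lim: "((\<lambda>R. C * quadratic_tail R) \<longlongrightarrow> 0) at_top"
    using tendsto_mult_left[OF quadratic_tail_tendsto, of C] by simp
  show "uniform_limit S F G at_top"
  proof (rule uniform_limitI)
    fix e :: real assume "e > 0"
    with lim have "\<forall>\<^sub>F R in at_top. C * quadratic_tail R < e" by (rule order_tendstoD(2))
    then show "\<forall>\<^sub>F R in at_top. \<forall>x\<in>S. dist (F R x) (G x) < e"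
      using eventually_gt_at_top[of 0]
      by eventually_elim (use FG in \<open>auto simp: dist_norm intro: le_less_trans\<close>)
  qed
qed simp

lemma continuous_on_hat:
  assumes u: "quadratic_decay C u"
  shows "continuous_on S (hat u)"
proof (rule continuous_on_quadratic_tail_limit)
  show "continuous_on S (\<lambda>l. trunc_hat R u l)" for R
    using continuous_on_trunc_hat[of R u S 1]
    by (simp add: quadratic_decay_continuous[OF u])
qed (rule trunc_hat_approximates_hat[OF u])

lemma quadratic_decay_at_0:
  assumes u: "quadratic_decay C u" shows "norm (u 0) \<le> C"
proof (rule tendsto_upperbound)
  have "continuous_on {0..} u" using u by (simp add: quadratic_decay_def)
  then have "(u \<longlongrightarrow> u 0) (at 0 within {0..})"
    unfolding continuous_on_def by (meson atLeast_iff order_refl)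
  then have "(u \<longlongrightarrow> u 0) (at_right 0)"
    by (rule tendsto_within_subset) auto
  then show "((\<lambda>y. norm (u y)) \<longlongrightarrow> norm (u 0)) (at_right 0)" by (rule tendsto_norm)
  have "norm (u y) \<le> C" if "y > 0" for y
  proof -
    have "C / (1 + y\<^sup>2) \<le> C / 1" using quadratic_decay_nonneg[OF u] by (intro divide_left_mono) (auto intro: add_pos_nonneg)
    then show ?thesis using quadratic_decay_bound[OF u that] by simp
  qed
  then show "\<forall>\<^sub>F y in at_right 0. norm (u y) \<le> C"
    by (auto simp: eventually_at_filter)
qed simp

lemma quadratic_decay_tendsto_0:
  assumes u: "quadratic_decay C u" shows "(u \<longlongrightarrow> 0) at_top"
proof (rule Lim_null_comparison)
  show "\<forall>\<^sub>F y in at_top. norm (u y) \<le> C / (1 + y\<^sup>2)"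
    by (rule eventually_mono[OF eventually_gt_at_top[of 0]]) (use u in \<open>auto simp: quadratic_decay_def\<close>)
  show "((\<lambda>y. C / (1 + y\<^sup>2)) \<longlongrightarrow> 0) at_top"
    by (intro tendsto_divide_0[OF tendsto_const] filterlim_at_top_imp_at_infinity
        filterlim_tendsto_add_at_top[OF tendsto_const] filterlim_pow_at_top filterlim_ident) auto
qed

text \<open>Integration by parts.  It yields both the decay of a transform and, applied twice, its asymptotic
  expansion with leading term \<open>u 0 / (\<i> l)\<close>.\<close>

lemma hat_derivative:
  assumes u: "quadratic_decay C u" and u': "quadratic_decay C' u'"
    and d: "\<And>y. y \<ge> 0 \<Longrightarrow> (u has_vector_derivative u' y) (at y within {0..})"
  shows "hat u' l = \<i> * of_real l * hat u l - u 0"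
proof -
  have e0: "((\<lambda>R. exp (- \<i> * of_real l * of_real R) * u R) \<longlongrightarrow> 0) at_top"
    by (rule Lim_null_comparison[OF _ tendsto_norm_zero[OF quadratic_decay_tendsto_0[OF u]]])
      (simp add: norm_mult)
  have "((\<lambda>R. exp (- \<i> * of_real l * of_real R) * u R - u 0 + \<i> * of_real l * trunc_hat R u l)
     \<longlongrightarrow> 0 - u 0 + \<i> * of_real l * hat u l) at_top"
    by (intro tendsto_intros e0 trunc_hat_tendsto_hat[OF u])
  moreover have "\<forall>\<^sub>F R in at_top. exp (- \<i> * of_real l * of_real R) * u R - u 0 + \<i> * of_real l * trunc_hat R u l
      = trunc_hat R u' l"
    by (rule eventually_mono[OF eventually_ge_at_top[of 0]], rule trunc_hat_derivative[symmetric])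
      (use d quadratic_decay_continuous[OF u'] in auto)
  ultimately have "((\<lambda>R. trunc_hat R u' l) \<longlongrightarrow> 0 - u 0 + \<i> * of_real l * hat u l) at_top"
    by (rule Lim_transform_eventually)
  from tendsto_unique[OF _ trunc_hat_tendsto_hat[OF u'] this] show ?thesis by simp
qed

lemma norm_hat_derivative_le:
  assumes u: "quadratic_decay C u" and u': "quadratic_decay C' u'"
    and d: "\<And>y. y \<ge> 0 \<Longrightarrow> (u has_vector_derivative u' y) (at y within {0..})"
  shows "\<bar>l\<bar> * norm (hat u l) \<le> C + C' * pi"
proof -
  have "\<i> * of_real l * hat u l = u 0 + hat u' l" using hat_derivative[OF u u' d] by simp
  then have "\<bar>l\<bar> * norm (hat u l) = norm (u 0 + hat u' l)" by (metis norm_mult norm_ii mult_1 norm_of_real)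
  also have "\<dots> \<le> norm (u 0) + norm (hat u' l)" by (rule norm_triangle_ineq)
  also have "\<dots> \<le> C + C' * pi" by (intro add_mono quadratic_decay_at_0[OF u] norm_hat_le[OF u'])
  finally show ?thesis .
qed

section \<open>Transforms of the initial, boundary and source data\<close>

lemma half_line_smooth_derivative:
  assumes "half_line_smooth g" "x \<ge> 0"
  shows "((hderiv ^^ n) g has_vector_derivative (hderiv ^^ Suc n) g x) (at x within {0..})"
  using assms by (simp add: half_line_smooth_def hderiv_def vector_derivative_works[symmetric])

lemma half_line_smooth_continuous:
  assumes "half_line_smooth g"
  shows "continuous_on {0..} ((hderiv ^^ n) g)"
  unfolding continuous_on_eq_continuous_within
  using has_vector_derivative_continuous[OF half_line_smooth_derivative[OF assms]] by auto

text \<open>Reduces the decay to bounds for \<open>u\<close> and \<open>x\<^sup>2 u\<close>, which the spaces of data provide.\<close>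

lemma quadratic_decay_of_moments:
  assumes c: "continuous_on {0..} u"
    and b: "\<And>x. x > 0 \<Longrightarrow> norm (u x) \<le> K0" "\<And>x. x > 0 \<Longrightarrow> x\<^sup>2 * norm (u x) \<le> K2"
  shows "quadratic_decay (K0 + K2) u"
  unfolding quadratic_decay_def
proof (intro conjI allI impI c)
  fix y :: real assume "y > 0"
  have "norm (u y) * (1 + y\<^sup>2) \<le> K0 + K2"
    using b[OF \<open>y > 0\<close>] by (simp add: algebra_simps)
  then show "norm (u y) \<le> (K0 + K2) / (1 + y\<^sup>2)"
    by (subst pos_le_divide_eq) (auto intro: add_pos_nonneg)
qed

lemma half_line_schwartz_quadratic_decay:
  assumes "half_line_schwartz g"
  shows "\<exists>C. quadratic_decay C ((hderiv ^^ n) g)"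
proof -
  have bd: "bdd_above ((\<lambda>x. x ^ a * cmod ((hderiv ^^ n) g x)) ` {0..})" for a
    using assms by (auto simp: half_line_schwartz_def)
  obtain K0 where "\<And>x. x \<ge> 0 \<Longrightarrow> cmod ((hderiv ^^ n) g x) \<le> K0"
    using bd[of 0] by (auto simp: bdd_above_def)
  moreover obtain K2 where "\<And>x. x \<ge> 0 \<Longrightarrow> x\<^sup>2 * cmod ((hderiv ^^ n) g x) \<le> K2"
    using bd[of 2] by (auto simp: bdd_above_def)
  moreover have "continuous_on {0..} ((hderiv ^^ n) g)"
    using assms by (auto simp: half_line_schwartz_def intro: half_line_smooth_continuous)
  ultimately show ?thesis
    by (intro exI[of _ "K0 + K2"] quadratic_decay_of_moments) auto
qed

lemma quad_smooth_dx: "quad_smooth f \<Longrightarrow> quad_smooth (dx f)"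
  unfolding quad_smooth_def by (metis Ck_on.simps(2))

lemma quad_smooth_dt: "quad_smooth f \<Longrightarrow> quad_smooth (dt f)"
  unfolding quad_smooth_def by (metis Ck_on.simps(2))

lemma quad_smooth_C1: "quad_smooth f \<Longrightarrow> Ck_on 1 Quad_closed f"
  unfolding quad_smooth_def by blast

lemma quad_smooth_continuous: "quad_smooth f \<Longrightarrow> continuous_on Quad_closed (\<lambda>(x, t). f x t)"
  using Ck_on_continuous quad_smooth_C1 by blast

lemma quad_smooth_iterate: "quad_smooth f \<Longrightarrow> quad_smooth ((dx ^^ n) ((dt ^^ l) f))"
proof -
  assume f: "quad_smooth f"
  have "quad_smooth ((dt ^^ l) f)" by (induction l) (auto simp: f quad_smooth_dt)
  then show ?thesis by (induction n) (auto simp: quad_smooth_dx)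
qed

lemma rapidly_decreasing_quadratic_decay:
  assumes f: "quad_smooth f" "rapidly_decreasing_in_x f" and T: "T > 0"
  shows "\<exists>C. \<forall>\<tau>\<in>{0..T}. quadratic_decay C (\<lambda>y. (dx ^^ n) ((dt ^^ l) f) y \<tau>)"
proof -
  let ?u = "(dx ^^ n) ((dt ^^ l) f)"
  have bd: "bdd_above ((\<lambda>(x, t). x ^ E * cmod (?u x t)) ` ({0<..} \<times> {0..T}))" for E
    using f(2) T by (auto simp: rapidly_decreasing_in_x_def)
  obtain K0 where K0: "\<And>x t. x > 0 \<Longrightarrow> t \<in> {0..T} \<Longrightarrow> cmod (?u x t) \<le> K0"
    using bd[of 0] by (force simp: bdd_above_def)
  obtain K2 where K2: "\<And>x t. x > 0 \<Longrightarrow> t \<in> {0..T} \<Longrightarrow> x\<^sup>2 * cmod (?u x t) \<le> K2"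
    using bd[of 2] by (force simp: bdd_above_def)
  have "quadratic_decay (K0 + K2) (\<lambda>y. ?u y \<tau>)" if "\<tau> \<in> {0..T}" for \<tau>
    by (intro quadratic_decay_of_moments K0 K2 that
        continuous_on_fst_slice[OF quad_smooth_continuous[OF quad_smooth_iterate[OF f(1)]]])
      (use that in \<open>auto simp: Quad_closed_def\<close>)
  then show ?thesis by blast
qed

lemma time_transform_eq_integral:
  assumes h: "continuous_on {0..} h"
  shows "time_transform h w t = integral {0..t} (\<lambda>\<tau>. h \<tau> * exp (w * of_real \<tau>))"
  unfolding time_transform_def
  by (intro set_borel_integral_eq_integral(2) borel_integrable_atLeastAtMost' continuous_intros
      continuous_on_subset[OF h]) auto

lemma norm_time_transform_le:
  assumes h: "continuous_on {0..} h" and w: "Re w = 0" and t: "t \<ge> 0"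
    and M: "\<And>\<tau>. \<tau> \<in> {0..t} \<Longrightarrow> norm (h \<tau>) \<le> M"
  shows "norm (time_transform h w t) \<le> M * t"
proof -
  have "norm (integral {0..t} (\<lambda>\<tau>. h \<tau> * exp (w * of_real \<tau>))) \<le> M * (t - 0)"
    by (rule integral_bound[OF t]) (use M w in \<open>auto simp: norm_mult intro!: continuous_intros continuous_on_subset[OF h]\<close>)
  then show ?thesis by (simp add: time_transform_eq_integral[OF h])
qed

text \<open>Integration by parts in time; like \<open>hat_derivative\<close> it serves to expand in inverse powers of the
  frequency.\<close>

lemma time_transform_derivative:
  assumes h: "continuous_on {0..} h" and h': "continuous_on {0..} h'" and t: "t \<ge> 0"
    and d: "\<And>\<tau>. \<tau> \<ge> 0 \<Longrightarrow> (h has_vector_derivative h' \<tau>) (at \<tau> within {0..})"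
  shows "w * time_transform h w t = h t * exp (w * of_real t) - h 0 - time_transform h' w t"
proof -
  have de: "((\<lambda>s. exp (w * of_real s)) has_vector_derivative w * exp (w * of_real s)) (at s within S)" for s S
    by (rule has_vector_derivative_at_within, rule has_vector_derivative_real_field[of "\<lambda>s. exp (w * s)"])
      (auto intro!: derivative_eq_intros)
  have c: "continuous_on {0..t} h" "continuous_on {0..t} h'"
    by (rule continuous_on_subset[OF h] continuous_on_subset[OF h']; force)+
  have "((\<lambda>\<tau>. h \<tau> * (w * exp (w * of_real \<tau>)) + h' \<tau> * exp (w * of_real \<tau>)) has_integral
      (h t * exp (w * of_real t) - h 0 * exp (w * of_real 0))) {0..t}"
    by (rule fundamental_theorem_of_calculus[OF t], rule has_vector_derivative_mult[OF _ de],
        rule has_vector_derivative_within_subset[OF d]) auto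
  moreover have "((\<lambda>\<tau>. w * (h \<tau> * exp (w * of_real \<tau>)) + h' \<tau> * exp (w * of_real \<tau>)) has_integral
      (w * time_transform h w t + time_transform h' w t)) {0..t}"
    unfolding time_transform_eq_integral[OF h] time_transform_eq_integral[OF h']
    by (intro has_integral_add has_integral_mult_right integrable_integral
        integrable_continuous_interval continuous_intros c)
  ultimately have "w * time_transform h w t + time_transform h' w t = h t * exp (w * of_real t) - h 0"
    by (auto intro: has_integral_unique simp: mult.left_commute)
  then show ?thesis by (simp add: algebra_simps)
qed

lemma continuous_on_time_transform:
  assumes h: "continuous_on {0..} h" and \<omega>: "continuous_on S \<omega>"
  shows "continuous_on S (\<lambda>l. time_transform h (\<omega> l) t)"
proof -
  have "continuous_on (S \<times> cbox 0 t) (\<lambda>(l, \<tau>). h \<tau> * exp (\<omega> l * of_real \<tau>))"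
    unfolding case_prod_beta
    by (intro continuous_intros continuous_on_compose2[OF h] continuous_on_compose2[OF \<omega>]) auto
  from integral_continuous_on_param[OF this] show ?thesis
    by (simp add: time_transform_eq_integral[OF h] cbox_interval)
qed

text \<open>A source whose decay in \<open>x\<close> is uniform up to the time \<open>t\<close>.\<close>

locale decaying_source =
  fixes f :: "real \<Rightarrow> real \<Rightarrow> complex" and C t :: real
  assumes cont: "continuous_on Quad_closed (\<lambda>(x, \<tau>). f x \<tau>)"
    and decay: "\<tau> \<in> {0..t} \<Longrightarrow> quadratic_decay C (\<lambda>y. f y \<tau>)"
    and t: "t \<ge> 0"
begin

lemma cont_swapped: "continuous_on ({0..t} \<times> {0..R}) (\<lambda>(\<tau>, y). f y \<tau>)"
  by (rule continuous_on_swapped[OF cont]) (auto simp: Quad_closed_def)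

lemma hat_continuous_time: "continuous_on {0..t} (\<lambda>\<tau>. hat (\<lambda>y. f y \<tau>) l)"
  by (rule continuous_on_quadratic_tail_limit[of _ "\<lambda>R \<tau>. trunc_hat R (\<lambda>y. f y \<tau>) l" _ C])
    (auto intro!: continuous_on_trunc_hat_param cont_swapped trunc_hat_approximates_hat decay)

lemma tilde_hat_eq_integral:
  "tilde_hat f l w t = integral {0..t} (\<lambda>\<tau>. exp (w * of_real \<tau>) * hat (\<lambda>y. f y \<tau>) l)"
  unfolding tilde_hat_def
  by (intro set_borel_integral_eq_integral(2) borel_integrable_atLeastAtMost' continuous_intros hat_continuous_time)

lemma norm_tilde_hat_le:
  assumes w: "Re w = 0" and K: "\<And>\<tau>. \<tau> \<in> {0..t} \<Longrightarrow> norm (hat (\<lambda>y. f y \<tau>) l) \<le> K"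
  shows "norm (tilde_hat f l w t) \<le> K * t"
proof -
  have "norm (integral {0..t} (\<lambda>\<tau>. exp (w * of_real \<tau>) * hat (\<lambda>y. f y \<tau>) l)) \<le> K * (t - 0)"
    by (rule integral_bound[OF t]) (use K w in \<open>auto simp: norm_mult intro!: continuous_intros hat_continuous_time\<close>)
  then show ?thesis by (simp add: tilde_hat_eq_integral)
qed

lemma truncated_source_continuous: "continuous_on {0..t} (\<lambda>\<tau>. exp (w * of_real \<tau>) * trunc_hat R (\<lambda>y. f y \<tau>) l)"
  by (intro continuous_intros continuous_on_trunc_hat_param cont_swapped)

lemma truncated_source_approximates:
  assumes w: "Re w = 0" and R: "R > 0"
  shows "norm (integral {0..t} (\<lambda>\<tau>. exp (w * of_real \<tau>) * trunc_hat R (\<lambda>y. f y \<tau>) l) - tilde_hat f l w t)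
     \<le> t * C * quadratic_tail R"
proof -
  have "integral {0..t} (\<lambda>\<tau>. exp (w * of_real \<tau>) * trunc_hat R (\<lambda>y. f y \<tau>) l) - tilde_hat f l w t
    = integral {0..t} (\<lambda>\<tau>. exp (w * of_real \<tau>) * trunc_hat R (\<lambda>y. f y \<tau>) l - exp (w * of_real \<tau>) * hat (\<lambda>y. f y \<tau>) l)"
    unfolding tilde_hat_eq_integral
    by (rule integral_diff[symmetric]; intro integrable_continuous_interval truncated_source_continuous
        continuous_intros hat_continuous_time)
  also have "norm \<dots> \<le> C * quadratic_tail R * (t - 0)"
  proof (rule integral_bound[OF t])
    show "continuous_on {0..t} (\<lambda>\<tau>. exp (w * of_real \<tau>) * trunc_hat R (\<lambda>y. f y \<tau>) l - exp (w * of_real \<tau>) * hat (\<lambda>y. f y \<tau>) l)"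
      by (intro truncated_source_continuous continuous_intros hat_continuous_time)
    fix \<tau> assume "\<tau> \<in> {0..t}"
    then show "norm (exp (w * of_real \<tau>) * trunc_hat R (\<lambda>y. f y \<tau>) l - exp (w * of_real \<tau>) * hat (\<lambda>y. f y \<tau>) l) \<le> C * quadratic_tail R"
      using trunc_hat_approximates_hat[OF decay R, of \<tau> l] w
      by (simp add: norm_mult flip: right_diff_distrib)
  qed
  finally show ?thesis by (simp add: mult_ac)
qed

lemma continuous_on_tilde_hat:
  assumes \<omega>: "continuous_on UNIV \<omega>" "\<And>l. Re (\<omega> l) = 0"
  shows "continuous_on UNIV (\<lambda>l. tilde_hat f (s * l) (\<omega> l) t)"
proof (rule continuous_on_quadratic_tail_limit)
  fix R :: real
  have "continuous_on ((UNIV \<times> {0..t}) \<times> cbox 0 R)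
      (\<lambda>q. case (snd (fst q), snd q) of (\<tau>, y) \<Rightarrow> f y \<tau>)"
    by (rule continuous_on_compose2[OF cont_swapped[of R]]) (auto intro!: continuous_intros)
  then have fc: "continuous_on ((UNIV \<times> {0..t}) \<times> cbox 0 R) (\<lambda>q. f (snd q) (snd (fst q)))"
    by simp
  have "continuous_on ((UNIV \<times> {0..t}) \<times> cbox 0 R) (\<lambda>(p, y). exp (- \<i> * of_real (s * fst p) * of_real y) * f y (snd p))"
    unfolding case_prod_beta
    by (intro continuous_intros fc)
  from integral_continuous_on_param[OF this]
  have "continuous_on (UNIV \<times> {0..t}) (\<lambda>(l, \<tau>). trunc_hat R (\<lambda>y. f y \<tau>) (s * l))"
    by (simp add: trunc_hat_def cbox_interval case_prod_beta)
  then have "continuous_on (UNIV \<times> cbox 0 t) (\<lambda>(l, \<tau>). exp (\<omega> l * of_real \<tau>) * trunc_hat R (\<lambda>y. f y \<tau>) (s * l))"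
    unfolding case_prod_beta cbox_interval
    by (intro continuous_intros continuous_on_compose2[OF \<omega>(1)]) auto
  from integral_continuous_on_param[OF this]
  show "continuous_on UNIV (\<lambda>l. integral {0..t} (\<lambda>\<tau>. exp (\<omega> l * of_real \<tau>) * trunc_hat R (\<lambda>y. f y \<tau>) (s * l)))"
    by (simp add: cbox_interval)
qed (rule truncated_source_approximates[OF \<omega>(2)])

end

text \<open>Integration by parts in time, carried out for the truncated transforms, where differentiation
  under the integral sign takes place over a compact rectangle, and then passed to the limit.\<close>

lemma tilde_hat_derivative:
  assumes f: "Ck_on 1 Quad_closed f" and df: "decaying_source f C t" and dtf: "decaying_source (dt f) C' t"
    and w: "Re w = 0"
  shows "w * tilde_hat f l w t = exp (w * of_real t) * hat (\<lambda>y. f y t) l - hat (\<lambda>y. f y 0) l - tilde_hat (dt f) l w t"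
proof -
  interpret f: decaying_source f C t by fact
  interpret f': decaying_source "dt f" C' t by fact
  have t: "0 \<le> t" by (rule f.t)
  have de: "((\<lambda>s. exp (w * of_real s)) has_vector_derivative w * exp (w * of_real s)) (at s within S)" for s S
    by (rule has_vector_derivative_at_within, rule has_vector_derivative_real_field[of "\<lambda>s. exp (w * s)"])
      (auto intro!: derivative_eq_intros)
  let ?I = "\<lambda>u R. integral {0..t} (\<lambda>\<tau>. exp (w * of_real \<tau>) * trunc_hat R (\<lambda>y. u y \<tau>) l)"
  have fin: "w * ?I f R + ?I (dt f) R = exp (w * of_real t) * trunc_hat R (\<lambda>y. f y t) l - trunc_hat R (\<lambda>y. f y 0) l" for R
  proof -
    have "((\<lambda>\<tau>. exp (w * of_real \<tau>) * trunc_hat R (\<lambda>y. dt f y \<tau>) l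
          + w * exp (w * of_real \<tau>) * trunc_hat R (\<lambda>y. f y \<tau>) l) has_integral
        (exp (w * of_real t) * trunc_hat R (\<lambda>y. f y t) l - exp (w * of_real 0) * trunc_hat R (\<lambda>y. f y 0) l)) {0..t}"
      by (rule fundamental_theorem_of_calculus[OF t], rule has_vector_derivative_mult[OF de],
          rule trunc_hat_time_derivative[OF f]) (auto simp: Quad_closed_def)
    moreover have "((\<lambda>\<tau>. exp (w * of_real \<tau>) * trunc_hat R (\<lambda>y. dt f y \<tau>) l
          + w * (exp (w * of_real \<tau>) * trunc_hat R (\<lambda>y. f y \<tau>) l)) has_integral (?I (dt f) R + w * ?I f R)) {0..t}"
      by (intro has_integral_add has_integral_mult_right integrable_integral integrable_continuous_interval
          f.truncated_source_continuous f'.truncated_source_continuous)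
    ultimately show ?thesis by (auto dest: has_integral_unique simp: mult.assoc add.commute)
  qed
  have lim: "((\<lambda>R. ?I u R) \<longlongrightarrow> tilde_hat u l w t) at_top" if "decaying_source u K t" for u K
  proof -
    have "((\<lambda>R. t * K * quadratic_tail R) \<longlongrightarrow> 0) at_top"
      using tendsto_mult_left[OF quadratic_tail_tendsto, of "t * K"] by simp
    then have "((\<lambda>R. ?I u R - tilde_hat u l w t) \<longlongrightarrow> 0) at_top"
      by (rule Lim_null_comparison[rotated])
        (rule eventually_mono[OF eventually_gt_at_top[of 0]],
          rule decaying_source.truncated_source_approximates[OF that w])
    then show ?thesis by (simp add: LIM_zero_iff)
  qed
  have "((\<lambda>R. w * ?I f R + ?I (dt f) R) \<longlongrightarrow> w * tilde_hat f l w t + tilde_hat (dt f) l w t) at_top"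
    by (intro tendsto_intros lim[OF df] lim[OF dtf])
  moreover have "((\<lambda>R. exp (w * of_real t) * trunc_hat R (\<lambda>y. f y t) l - trunc_hat R (\<lambda>y. f y 0) l)
      \<longlongrightarrow> exp (w * of_real t) * hat (\<lambda>y. f y t) l - hat (\<lambda>y. f y 0) l) at_top"
    by (intro tendsto_intros trunc_hat_tendsto_hat[OF f.decay]) (use t in auto)
  ultimately have "w * tilde_hat f l w t + tilde_hat (dt f) l w t
      = exp (w * of_real t) * hat (\<lambda>y. f y t) l - hat (\<lambda>y. f y 0) l"
    unfolding fin by (intro tendsto_unique) auto
  then show ?thesis by (simp add: algebra_simps)
qed

text \<open>One integration by parts in time gains the factor \<open>1 / w\<close>, one in space the factor \<open>1 / l\<close>.  Together
  they make the source integrals absolutely convergent.\<close>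

lemma tilde_hat_decay:
  assumes f: "quad_smooth f" "rapidly_decreasing_in_x f" and t: "t > 0"
  shows "\<exists>C K. decaying_source f C t \<and>
    (\<forall>l w. Re w = 0 \<longrightarrow> norm (tilde_hat f l w t) \<le> K \<and> norm w * \<bar>l\<bar> * norm (tilde_hat f l w t) \<le> K)"
proof -
  have "\<exists>C. \<forall>\<tau>\<in>{0..t}. quadratic_decay C (\<lambda>y. (dx ^^ n) ((dt ^^ k) f) y \<tau>)" for n k
    by (rule rapidly_decreasing_quadratic_decay[OF f t])
  from this[of 0 0] this[of 1 0] this[of 0 1] this[of 1 1] obtain C0 C1 C2 C3 where
    "\<forall>\<tau>\<in>{0..t}. quadratic_decay C0 (\<lambda>y. f y \<tau>)" "\<forall>\<tau>\<in>{0..t}. quadratic_decay C1 (\<lambda>y. dx f y \<tau>)"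
    "\<forall>\<tau>\<in>{0..t}. quadratic_decay C2 (\<lambda>y. dt f y \<tau>)" "\<forall>\<tau>\<in>{0..t}. quadratic_decay C3 (\<lambda>y. dx (dt f) y \<tau>)"
    unfolding One_nat_def funpow.simps o_id id_apply comp_apply by blast
  note C = this[rule_format]
  have ft: "quad_smooth (dt f)" by (rule quad_smooth_dt[OF f(1)])
  have ds: "decaying_source f C0 t" "decaying_source (dt f) C2 t"
    by (unfold_locales; use t C quad_smooth_continuous[OF f(1)] quad_smooth_continuous[OF ft] in auto)+
  have hb: "\<bar>l\<bar> * norm (hat (\<lambda>y. f y \<tau>) l) \<le> C0 + C1 * pi" if \<tau>: "\<tau> \<in> {0..t}" for \<tau> l
    by (rule norm_hat_derivative_le[OF C(1)[OF \<tau>] C(2)[OF \<tau>]],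
        rule Ck_on_SucD(4)[OF quad_smooth_C1[OF f(1), unfolded One_nat_def]]) (use \<tau> in \<open>auto simp: Quad_closed_def\<close>)
  have hb': "\<bar>l\<bar> * norm (hat (\<lambda>y. dt f y \<tau>) l) \<le> C2 + C3 * pi" if \<tau>: "\<tau> \<in> {0..t}" for \<tau> l
    by (rule norm_hat_derivative_le[OF C(3)[OF \<tau>] C(4)[OF \<tau>]],
        rule Ck_on_SucD(4)[OF quad_smooth_C1[OF ft, unfolded One_nat_def]]) (use \<tau> in \<open>auto simp: Quad_closed_def\<close>)
  define K where "K = max (C0 * pi * t) (2 * (C0 + C1 * pi) + (C2 + C3 * pi) * t)"
  have "norm (tilde_hat f l w t) \<le> K \<and> norm w * \<bar>l\<bar> * norm (tilde_hat f l w t) \<le> K" if w: "Re w = 0" for l w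
  proof
    have "norm (tilde_hat f l w t) \<le> C0 * pi * t"
      by (rule decaying_source.norm_tilde_hat_le[OF ds(1) w]) (rule norm_hat_le[OF C(1)])
    then show "norm (tilde_hat f l w t) \<le> K" by (simp add: K_def)
    have pos: "0 \<le> 2 * (C0 + C1 * pi) + (C2 + C3 * pi) * t"
    proof -
      have "0 \<le> C0 + C1 * pi" "0 \<le> C2 + C3 * pi"
        using quadratic_decay_nonneg[OF C(1)[of 0]] quadratic_decay_nonneg[OF C(2)[of 0]] quadratic_decay_nonneg[OF C(3)[of 0]]
          quadratic_decay_nonneg[OF C(4)[of 0]] t by (auto intro!: add_nonneg_nonneg mult_nonneg_nonneg)
      then show ?thesis using t by simp
    qed
    have "norm w * \<bar>l\<bar> * norm (tilde_hat f l w t) \<le> 2 * (C0 + C1 * pi) + (C2 + C3 * pi) * t"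
    proof (cases "l = 0")
      case True then show ?thesis using pos by simp
    next
      case l: False
      have t2: "norm (tilde_hat (dt f) l w t) \<le> (C2 + C3 * pi) / \<bar>l\<bar> * t"
        by (rule decaying_source.norm_tilde_hat_le[OF ds(2) w])
          (use hb' l in \<open>simp add: pos_le_divide_eq mult.commute\<close>)
      have "norm w * norm (tilde_hat f l w t) = norm (w * tilde_hat f l w t)" by (simp add: norm_mult)
      also have "\<dots> = norm (exp (w * of_real t) * hat (\<lambda>y. f y t) l - hat (\<lambda>y. f y 0) l - tilde_hat (dt f) l w t)"
        by (subst tilde_hat_derivative[OF quad_smooth_C1[OF f(1)] ds w]) simp
      also have "\<dots> \<le> norm (exp (w * of_real t) * hat (\<lambda>y. f y t) l) + norm (hat (\<lambda>y. f y 0) l) + norm (tilde_hat (dt f) l w t)"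
        by (intro order_trans[OF norm_triangle_ineq4] add_mono norm_triangle_ineq4 order_refl)
      also have "norm (exp (w * of_real t) * hat (\<lambda>y. f y t) l) = norm (hat (\<lambda>y. f y t) l)"
        using w by (simp add: norm_mult)
      finally have "\<bar>l\<bar> * (norm w * norm (tilde_hat f l w t))
        \<le> \<bar>l\<bar> * (norm (hat (\<lambda>y. f y t) l) + norm (hat (\<lambda>y. f y 0) l) + norm (tilde_hat (dt f) l w t))"
        by (rule mult_left_mono) simp
      also have "\<dots> = \<bar>l\<bar> * norm (hat (\<lambda>y. f y t) l) + \<bar>l\<bar> * norm (hat (\<lambda>y. f y 0) l) + \<bar>l\<bar> * norm (tilde_hat (dt f) l w t)"
        by (simp only: distrib_left)
      also have "\<dots> \<le> (C0 + C1 * pi) + (C0 + C1 * pi) + (C2 + C3 * pi) * t"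
      proof (intro add_mono hb)
        show "\<bar>l\<bar> * norm (tilde_hat (dt f) l w t) \<le> (C2 + C3 * pi) * t"
          using mult_left_mono[OF t2, of "\<bar>l\<bar>"] l by simp
      qed (use t in auto)
      finally show ?thesis by (simp add: mult_ac)
    qed
    then show "norm w * \<bar>l\<bar> * norm (tilde_hat f l w t) \<le> K" by (simp add: K_def)
  qed
  with ds(1) show ?thesis by blast
qed

section \<open>Generalized integrals over the line\<close>

text \<open>A generalized integral is the sum of two limits, which may exist only conditionally.  The
  relational form, with integrability on bounded intervals included, makes it additive.\<close>

definition half_lim :: "(real \<Rightarrow> complex) \<Rightarrow> complex \<Rightarrow> bool" where
  "half_lim F L \<longleftrightarrow> (\<forall>A. set_integrable lborel {0..A} F) \<and> ((\<lambda>A. LINT l:{0..A}|lborel. F l) \<longlongrightarrow> L) at_top"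

definition has_gen_integral :: "(real \<Rightarrow> complex) \<Rightarrow> complex \<Rightarrow> bool" where
  "has_gen_integral F L \<longleftrightarrow> (\<exists>L1 L2. half_lim F L1 \<and> half_lim (\<lambda>l. F (- l)) L2 \<and> L = L1 + L2)"

lemma half_lim_add: "half_lim F L \<Longrightarrow> half_lim G M \<Longrightarrow> half_lim (\<lambda>l. F l + G l) (L + M)"
  unfolding half_lim_def by (auto intro!: set_integral_add(1) tendsto_add simp: set_integral_add(2))

lemma half_lim_cmult: "half_lim F L \<Longrightarrow> half_lim (\<lambda>l. c * F l) (c * L)"
  unfolding half_lim_def by (auto intro!: tendsto_mult)

lemma has_gen_integral_add:
  assumes "has_gen_integral F L" "has_gen_integral G M"
  shows "has_gen_integral (\<lambda>l. F l + G l) (L + M)"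
proof -
  from assms obtain L1 L2 M1 M2 where "half_lim F L1" "half_lim (\<lambda>l. F (- l)) L2" "L = L1 + L2"
    "half_lim G M1" "half_lim (\<lambda>l. G (- l)) M2" "M = M1 + M2"
    by (auto simp: has_gen_integral_def)
  then show ?thesis unfolding has_gen_integral_def
    by (intro exI[of _ "L1 + M1"] exI[of _ "L2 + M2"]) (simp add: half_lim_add)
qed

lemma has_gen_integral_cmult:
  assumes "has_gen_integral F L" shows "has_gen_integral (\<lambda>l. c * F l) (c * L)"
proof -
  from assms obtain L1 L2 where "half_lim F L1" "half_lim (\<lambda>l. F (- l)) L2" "L = L1 + L2"
    by (auto simp: has_gen_integral_def)
  then show ?thesis unfolding has_gen_integral_def
    by (intro exI[of _ "c * L1"] exI[of _ "c * L2"]) (simp add: half_lim_cmult distrib_left)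
qed

lemma has_gen_integral_diff:
  "has_gen_integral F L \<Longrightarrow> has_gen_integral G M \<Longrightarrow> has_gen_integral (\<lambda>l. F l - G l) (L - M)"
  using has_gen_integral_add[OF _ has_gen_integral_cmult[of G M "- 1"], of F L] by simp

lemma LINT_negative_half: "(LINT l:{-A..0}|lborel. F l) = (LINT l:{0..A}|lborel. F (- l))" for F :: "real \<Rightarrow> complex"
proof -
  have "{x. - x \<in> {-A..0}} = {0..A}" by auto
  then show ?thesis using set_integral_reflect[of "{-A..0}" F] by simp
qed

lemma has_gen_integral_eq: "has_gen_integral F L \<Longrightarrow> gen_integral F = L"
  unfolding has_gen_integral_def half_lim_def gen_integral_def LINT_negative_half
  by (auto simp: tendsto_Lim)

lemma set_integrable_negative_half:
  fixes F :: "real \<Rightarrow> complex"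
  assumes "set_integrable lborel {0..A} (\<lambda>l. F (- l))"
  shows "set_integrable lborel {-A..0} F"
proof -
  have "integrable lborel (\<lambda>l::real. indicator {0..A} (0 + (-1) * l) *\<^sub>R F (- (0 + (-1) * l)))"
    by (rule lborel_integrable_real_affine) (use assms in \<open>auto simp: set_integrable_def\<close>)
  moreover have "(\<lambda>l::real. indicator {0..A} (0 + (-1) * l) *\<^sub>R F (- (0 + (-1) * l))) = (\<lambda>l. indicator {-A..0} l *\<^sub>R F l)"
    by (auto simp: fun_eq_iff split: split_indicator)
  ultimately show ?thesis by (simp add: set_integrable_def)
qed

text \<open>Separate convergence of the two halves implies convergence of the symmetric integrals, to which the
  inversion theorem refers.\<close>

lemma has_gen_integral_symmetric:
  assumes "has_gen_integral F L"
  shows "set_integrable lborel {-A..A} F" "((\<lambda>A. LINT l:{-A..A}|lborel. F l) \<longlongrightarrow> L) at_top"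
proof -
  obtain L1 L2 where L: "half_lim F L1" "half_lim (\<lambda>l. F (- l)) L2" "L = L1 + L2"
    using assms by (auto simp: has_gen_integral_def)
  have i: "set_integrable lborel {0..A} F" "set_integrable lborel {-A..0} F" for A
    using L by (auto simp: half_lim_def intro: set_integrable_negative_half)
  have un: "set_integrable lborel {-A..A} F" for A
    by (rule set_integrable_subset[OF set_integrable_Un[OF i(2)[of A] i(1)[of A]]]) auto
  then show "set_integrable lborel {-A..A} F" .
  have "(LINT l:{-A..A}|lborel. F l) = (LINT l:{0..A}|lborel. F l) + (LINT l:{0..A}|lborel. F (- l))"
    if "A \<ge> 0" for A
  proof -
    have "integral {-A..0} F + integral {0..A} F = integral {-A..A} F"
      by (rule Henstock_Kurzweil_Integration.integral_combine)
        (use that set_borel_integral_eq_integral(1)[OF un] in auto)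
    then show ?thesis
      unfolding LINT_negative_half[symmetric]
      using set_borel_integral_eq_integral(2)[OF un[of A]] set_borel_integral_eq_integral(2)[OF i(1)[of A]]
        set_borel_integral_eq_integral(2)[OF i(2)[of A]] by (simp add: add.commute[of "integral {0..A} F"])
  qed
  then have ev: "\<forall>\<^sub>F A in at_top. (LINT l:{0..A}|lborel. F l) + (LINT l:{0..A}|lborel. F (- l)) = (LINT l:{-A..A}|lborel. F l)"
    by (intro eventually_mono[OF eventually_ge_at_top[of 0]]) simp
  have "((\<lambda>A. (LINT l:{0..A}|lborel. F l) + (LINT l:{0..A}|lborel. F (- l))) \<longlongrightarrow> L) at_top"
    unfolding L(3) using L by (intro tendsto_add) (auto simp: half_lim_def)
  then show "((\<lambda>A. LINT l:{-A..A}|lborel. F l) \<longlongrightarrow> L) at_top"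
    by (rule Lim_transform_eventually[OF _ ev])
qed

lemma half_lim_integrable:
  assumes "integrable lborel F"
  shows "\<exists>L. half_lim F L"
proof -
  have S: "set_integrable lborel S F" if "S \<in> sets lborel" for S
    using assms that unfolding set_integrable_def by (rule integrable_mult_indicator[rotated])
  have "((\<lambda>A. LINT l:{0..A}|lborel. F l) \<longlongrightarrow> (LINT l:{0..}|lborel. F l)) at_top"
    by (rule tendsto_set_lebesgue_integral_at_top) (auto intro: S)
  then show ?thesis unfolding half_lim_def using S by auto
qed

lemma has_gen_integral_integrable:
  assumes F: "integrable lborel F"
  shows "has_gen_integral F (LINT l|lborel. F l)"
proof -
  have "integrable lborel (\<lambda>l. F (- l))"
    using lborel_integrable_real_affine[OF F, of "-1" 0] by simp
  from half_lim_integrable[OF this] half_lim_integrable[OF F]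
  obtain L where L: "has_gen_integral F L" by (auto simp: has_gen_integral_def)
  have "((\<lambda>A::real. LINT l|lborel. indicator {-A..A} l *\<^sub>R F l) \<longlongrightarrow> (LINT l|lborel. F l)) at_top"
  proof (rule integral_dominated_convergence_at_top[OF _ _ integrable_norm[OF F]])
    show "AE l in lborel. ((\<lambda>A. indicator {-A..A} l *\<^sub>R F l) \<longlongrightarrow> F l) (at_top :: real filter)"
    proof (rule AE_I2, rule tendsto_eventually)
      fix l :: real
      show "\<forall>\<^sub>F A in at_top. indicator {-A..A} l *\<^sub>R F l = F l"
        by (rule eventually_mono[OF eventually_ge_at_top[of "\<bar>l\<bar>"]]) (auto simp: abs_le_iff split: split_indicator)
    qed
  qed (use F in \<open>auto split: split_indicator\<close>)
  then have "((\<lambda>A. LINT l:{-A..A}|lborel. F l) \<longlongrightarrow> (LINT l|lborel. F l)) at_top"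
    by (simp add: set_lebesgue_integral_def)
  from tendsto_unique[OF _ this has_gen_integral_symmetric(2)[OF L]] L show ?thesis by simp
qed

section \<open>Oscillatory integrands\<close>

text \<open>Convergence \<open>u l \<longlongrightarrow> c\<close> as \<open>l \<longlongrightarrow> \<infinity>\<close> with the rate \<open>O(1 / l)\<close>.  This class of functions is closed under
  products, which suits integrands built from many factors.\<close>

definition rate :: "(real \<Rightarrow> complex) \<Rightarrow> complex \<Rightarrow> bool" where
  "rate u c \<longleftrightarrow> (\<exists>K. \<forall>l\<ge>1. norm (u l - c) \<le> K / l)"

lemma rateI: "(\<And>l. l \<ge> 1 \<Longrightarrow> norm (u l - c) \<le> K / l) \<Longrightarrow> rate u c"
  unfolding rate_def by blast

lemma rate_const: "rate (\<lambda>_. c) c"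
  by (rule rateI[of _ _ 0]) simp

lemma rate_add:
  assumes "rate u c" "rate v d" shows "rate (\<lambda>l. u l + v l) (c + d)"
proof -
  obtain K M where K: "\<And>l. l \<ge> 1 \<Longrightarrow> norm (u l - c) \<le> K / l" and M: "\<And>l. l \<ge> 1 \<Longrightarrow> norm (v l - d) \<le> M / l"
    using assms by (auto simp: rate_def)
  show ?thesis
  proof (rule rateI[of _ _ "K + M"])
    fix l :: real assume l: "l \<ge> 1"
    have "norm (u l + v l - (c + d)) = norm ((u l - c) + (v l - d))" by (simp add: algebra_simps)
    also have "\<dots> \<le> K / l + M / l" by (rule norm_triangle_le) (intro add_mono K M l)
    finally show "norm (u l + v l - (c + d)) \<le> (K + M) / l" by (simp add: add_divide_distrib)
  qed
qed

lemma rate_mult: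
  assumes "rate u c" "rate v d" shows "rate (\<lambda>l. u l * v l) (c * d)"
proof -
  obtain K M where K: "\<And>l. l \<ge> 1 \<Longrightarrow> norm (u l - c) \<le> K / l" and M: "\<And>l. l \<ge> 1 \<Longrightarrow> norm (v l - d) \<le> M / l"
    using assms by (auto simp: rate_def)
  have M0: "M \<ge> 0" using order_trans[OF norm_ge_zero M[of 1]] by simp
  have K0: "K \<ge> 0" using order_trans[OF norm_ge_zero K[of 1]] by simp
  show ?thesis
  proof (rule rateI[of _ _ "K * (norm d + M) + norm c * M"])
    fix l :: real assume l: "l \<ge> 1"
    have "norm (v l) \<le> norm d + norm (v l - d)" using norm_triangle_ineq[of d "v l - d"] by simp
    also have "\<dots> \<le> norm d + M"
    proof -
      have "M / l \<le> M / 1" using l M0 by (intro divide_left_mono) auto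
      then show ?thesis using M[OF l] by simp
    qed
    finally have v: "norm (v l) \<le> norm d + M" .
    have "u l * v l - c * d = (u l - c) * v l + c * (v l - d)" by (simp add: algebra_simps)
    then have "norm (u l * v l - c * d) \<le> norm (u l - c) * norm (v l) + norm c * norm (v l - d)"
      by (simp only: norm_mult[symmetric] norm_triangle_ineq)
    also have "\<dots> \<le> K / l * (norm d + M) + norm c * (M / l)"
      using l K0 by (intro add_mono mult_mono K M v l mult_left_mono) auto
    finally show "norm (u l * v l - c * d) \<le> (K * (norm d + M) + norm c * M) / l"
      by (simp add: algebra_simps add_divide_distrib)
  qed
qed

lemma rate_zero: "(\<And>l. l \<ge> 1 \<Longrightarrow> l * norm (u l) \<le> K) \<Longrightarrow> rate u 0"
  by (rule rateI[of _ _ K]) (simp add: pos_le_divide_eq mult.commute)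

lemma set_integrable_bounded_measurable:
  fixes F :: "real \<Rightarrow> complex"
  assumes [measurable]: "F \<in> borel_measurable borel" and M: "\<And>l. norm (F l) \<le> M"
  shows "set_integrable lborel {a..b} F"
proof (rule set_integrable_bound)
  show "set_integrable lborel {a..b} (\<lambda>_. M)" by (intro borel_integrable_atLeastAtMost' continuous_intros)
  show "set_borel_measurable lborel {a..b} F" unfolding set_borel_measurable_def by measurable
  show "AE l in lborel. l \<in> {a..b} \<longrightarrow> norm (F l) \<le> norm M"
    using M by (auto intro: order_trans[OF _ abs_ge_self])
qed

lemma set_integrable_inverse_square_bound:
  fixes D :: "real \<Rightarrow> complex"
  assumes D: "set_borel_measurable lborel {1..} D" and K: "\<And>l. l \<ge> 1 \<Longrightarrow> norm (D l) \<le> K / l\<^sup>2"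
  shows "set_integrable lborel {1..} D"
proof (rule set_integrable_bound[OF _ D])
  show "set_integrable lborel {1..} (\<lambda>l. 2 * K * (1 / (1 + l\<^sup>2)))"
    by (intro set_integrable_mult_right set_integrable_inverse_quadratic) auto
  have K0: "K \<ge> 0" using order_trans[OF norm_ge_zero K[of 1]] by simp
  show "AE l in lborel. l \<in> {1..} \<longrightarrow> norm (D l) \<le> norm (2 * K * (1 / (1 + l\<^sup>2)))"
  proof (intro AE_I2 impI)
    fix l :: real assume "l \<in> {1..}"
    then have l: "l \<ge> 1" by simp
    then have "1 \<le> l\<^sup>2" by simp
    then have "K * (1 + l\<^sup>2) \<le> K * (2 * l\<^sup>2)" using K0 by (intro mult_left_mono) auto
    then have "K / l\<^sup>2 \<le> 2 * K / (1 + l\<^sup>2)"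
      using l by (simp add: divide_le_eq le_divide_eq add_pos_nonneg field_simps)
    also have "\<dots> = norm (2 * K * (1 / (1 + l\<^sup>2)))" using K0 by simp
    finally show "norm (D l) \<le> norm (2 * K * (1 / (1 + l\<^sup>2)))" using K[OF l] by linarith
  qed
qed

text \<open>Near infinity \<open>F\<close> is the derivative \<open>q\<close> of a function vanishing at infinity, up to an absolutely
  integrable error.  In this form the property is additive and implies convergence of the integral.\<close>

definition osc_tail :: "(real \<Rightarrow> complex) \<Rightarrow> bool" where
  "osc_tail F \<longleftrightarrow> (\<exists>Q q K. (\<forall>l\<ge>1. (Q has_vector_derivative q l) (at l)) \<and> continuous_on {1..} q
     \<and> (Q \<longlongrightarrow> 0) at_top \<and> (\<forall>l\<ge>1. norm (F l - q l) \<le> K / l\<^sup>2))"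

lemma osc_tail_cong: "(\<And>l. l \<ge> 1 \<Longrightarrow> F l = G l) \<Longrightarrow> osc_tail G \<Longrightarrow> osc_tail F"
  unfolding osc_tail_def by simp

lemma osc_tail_add:
  assumes "osc_tail F" "osc_tail G" shows "osc_tail (\<lambda>l. F l + G l)"
proof -
  obtain Q q K where Q: "\<And>l. l \<ge> 1 \<Longrightarrow> (Q has_vector_derivative q l) (at l)" "continuous_on {1..} q" "(Q \<longlongrightarrow> 0) at_top"
    "\<And>l. l \<ge> 1 \<Longrightarrow> norm (F l - q l) \<le> K / l\<^sup>2" using assms(1) by (auto simp: osc_tail_def)
  obtain P p M where P: "\<And>l. l \<ge> 1 \<Longrightarrow> (P has_vector_derivative p l) (at l)" "continuous_on {1..} p" "(P \<longlongrightarrow> 0) at_top"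
    "\<And>l. l \<ge> 1 \<Longrightarrow> norm (G l - p l) \<le> M / l\<^sup>2" using assms(2) by (auto simp: osc_tail_def)
  have "norm (F l + G l - (q l + p l)) \<le> (K + M) / l\<^sup>2" if "l \<ge> 1" for l
  proof -
    have "norm ((F l - q l) + (G l - p l)) \<le> K / l\<^sup>2 + M / l\<^sup>2"
      by (rule norm_triangle_le) (intro add_mono Q(4) P(4) that)
    then show ?thesis by (simp add: algebra_simps add_divide_distrib)
  qed
  moreover have "((\<lambda>l. Q l + P l) \<longlongrightarrow> 0) at_top" using tendsto_add[OF Q(3) P(3)] by simp
  ultimately show ?thesis unfolding osc_tail_def
    by (intro exI[of _ "\<lambda>l. Q l + P l"] exI[of _ "\<lambda>l. q l + p l"] exI[of _ "K + M"])
      (auto intro!: has_vector_derivative_add Q(1) P(1) continuous_on_add Q(2) P(2))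
qed

text \<open>The derivative of \<open>c e^{\<i> s l} / (\<i> s l)\<close> is \<open>c e^{\<i> s l} / l + O(l^{-2})\<close>.\<close>

lemma osc_tail_exp:
  assumes u: "rate u c" and s: "s \<noteq> 0"
  shows "osc_tail (\<lambda>l. exp (\<i> * of_real (s * l)) * u l / of_real l)"
proof -
  obtain K where K: "\<And>l. l \<ge> 1 \<Longrightarrow> norm (u l - c) \<le> K / l" using u by (auto simp: rate_def)
  let ?e = "\<lambda>l. exp (\<i> * of_real (s * l))"
  define Q where "Q = (\<lambda>l. c * ?e l / (\<i> * of_real s * of_real l))"
  define q where "q = (\<lambda>l. c * ?e l / of_real l - c * ?e l / (\<i> * of_real s * (of_real l)\<^sup>2))"
  have dQ: "(Q has_vector_derivative q l) (at l)" if "l \<ge> 1" for l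
  proof -
    have "((\<lambda>z. c * exp (\<i> * (of_real s * z)) / (\<i> * of_real s * z)) has_field_derivative q l) (at (of_real l))"
      using s that unfolding q_def
      by (auto intro!: derivative_eq_intros simp: field_simps power2_eq_square)
    from has_vector_derivative_real_field[OF this] show ?thesis by (simp add: Q_def)
  qed
  moreover have "continuous_on {1..} q"
    unfolding q_def by (intro continuous_intros) (use s in auto)
  moreover have "(Q \<longlongrightarrow> 0) at_top"
  proof (rule Lim_null_comparison)
    show "\<forall>\<^sub>F l in at_top. norm (Q l) \<le> norm c / \<bar>s\<bar> * inverse l"
      by (rule eventually_mono[OF eventually_gt_at_top[of 0]])
        (simp add: Q_def norm_mult norm_divide divide_inverse norm_inverse del: of_real_inverse)
    show "((\<lambda>l. norm c / \<bar>s\<bar> * inverse l) \<longlongrightarrow> 0) at_top"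
      by (intro tendsto_mult_right_zero tendsto_inverse_0_at_top filterlim_ident)
  qed
  moreover have "norm (?e l * u l / of_real l - q l) \<le> (K + norm c / \<bar>s\<bar>) / l\<^sup>2" if l: "l \<ge> 1" for l
  proof -
    have "?e l * u l / of_real l - q l = ?e l * (u l - c) / of_real l + c * ?e l / (\<i> * of_real s * (of_real l)\<^sup>2)"
      by (simp add: q_def diff_divide_distrib algebra_simps)
    also have "norm \<dots> \<le> norm (u l - c) / l + norm c / \<bar>s\<bar> / l\<^sup>2"
      using l by (intro order_trans[OF norm_triangle_ineq] add_mono) (auto simp: norm_mult norm_divide norm_power)
    also have "\<dots> \<le> K / l / l + norm c / \<bar>s\<bar> / l\<^sup>2"
      using l by (intro add_mono divide_right_mono K) auto
    finally show ?thesis by (simp add: power2_eq_square add_divide_distrib)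
  qed
  ultimately show ?thesis unfolding osc_tail_def by blast
qed

lemma half_lim_osc_tail:
  assumes F: "F \<in> borel_measurable borel" and M: "\<And>l. norm (F l) \<le> M" and tail: "osc_tail F"
  shows "\<exists>L. half_lim F L"
proof -
  note si = set_integrable_bounded_measurable[OF F M]
  obtain Q q K where Q: "\<And>l. l \<ge> 1 \<Longrightarrow> (Q has_vector_derivative q l) (at l)" "continuous_on {1..} q" "(Q \<longlongrightarrow> 0) at_top"
    "\<And>l. l \<ge> 1 \<Longrightarrow> norm (F l - q l) \<le> K / l\<^sup>2" using tail by (auto simp: osc_tail_def)
  have "set_borel_measurable lborel {1..} (\<lambda>l. F l - q l)"
  proof -
    have "(\<lambda>l. indicator {1..} l *\<^sub>R q l) \<in> borel_measurable borel"
      by (rule borel_measurable_continuous_on_indicator[OF _ Q(2)]) auto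
    then show ?thesis using F unfolding set_borel_measurable_def
      by (simp add: scaleR_diff_right)
  qed
  then have D: "set_integrable lborel {1..} (\<lambda>l. F l - q l)"
    by (rule set_integrable_inverse_square_bound[OF _ Q(4)])
  then have limD: "((\<lambda>A. LINT l:{1..A}|lborel. F l - q l) \<longlongrightarrow> (LINT l:{1..}|lborel. F l - q l)) at_top"
    by (intro tendsto_set_lebesgue_integral_at_top) auto
  have eq: "(LINT l:{0..A}|lborel. F l) = (LINT l:{0..1}|lborel. F l) + (LINT l:{1..A}|lborel. F l - q l) + (Q A - Q 1)"
    if A: "A \<ge> 1" for A
  proof -
    have cq: "continuous_on {1..A} q" by (rule continuous_on_subset[OF Q(2)]) auto
    have iq: "(q has_integral (Q A - Q 1)) {1..A}"
      by (rule fundamental_theorem_of_calculus[OF A]) (auto intro: has_vector_derivative_at_within Q(1))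
    have "integral {1..A} (\<lambda>l. F l - q l) = integral {1..A} F - integral {1..A} q"
      by (rule integral_diff) (use set_borel_integral_eq_integral(1)[OF si] iq in auto)
    then have "integral {1..A} F = (LINT l:{1..A}|lborel. F l - q l) + (Q A - Q 1)"
      using set_borel_integral_eq_integral(2)[OF set_integrable_subset[OF D], of "{1..A}"]
        integral_unique[OF iq] by simp
    moreover have "integral {0..1} F + integral {1..A} F = integral {0..A} F"
      by (rule Henstock_Kurzweil_Integration.integral_combine) (use A set_borel_integral_eq_integral(1)[OF si] in auto)
    ultimately show ?thesis
      using set_borel_integral_eq_integral(2)[OF si, of 0 1] set_borel_integral_eq_integral(2)[OF si, of 0 A]
      by (simp add: add.assoc)
  qed
  have "((\<lambda>A. (LINT l:{0..1}|lborel. F l) + (LINT l:{1..A}|lborel. F l - q l) + (Q A - Q 1))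
     \<longlongrightarrow> (LINT l:{0..1}|lborel. F l) + (LINT l:{1..}|lborel. F l - q l) + (0 - Q 1)) at_top"
    by (intro tendsto_intros limD Q(3))
  moreover have "\<forall>\<^sub>F A in at_top. (LINT l:{0..1}|lborel. F l) + (LINT l:{1..A}|lborel. F l - q l) + (Q A - Q 1)
      = (LINT l:{0..A}|lborel. F l)"
    by (rule eventually_mono[OF eventually_ge_at_top[of 1]]) (rule eq[symmetric])
  ultimately have "((\<lambda>A. LINT l:{0..A}|lborel. F l) \<longlongrightarrow> (LINT l:{0..1}|lborel. F l) + (LINT l:{1..}|lborel. F l - q l) + (0 - Q 1)) at_top"
    by (rule Lim_transform_eventually)
  then show ?thesis using si by (auto simp: half_lim_def)
qed

abbreviation is_sign :: "real \<Rightarrow> bool" where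
  "is_sign s \<equiv> s = 1 \<or> s = - 1"

lemma has_gen_integral_osc_tail:
  assumes F: "F \<in> borel_measurable borel" and M: "\<And>l. norm (F l) \<le> M"
    and tail: "\<And>\<xi>. is_sign \<xi> \<Longrightarrow> osc_tail (\<lambda>l. F (\<xi> * l))"
  shows "has_gen_integral F (gen_integral F)"
proof -
  have m: "(\<lambda>l. F (- l)) \<in> borel_measurable borel"
    using F by measurable
  obtain L1 where "half_lim F L1" using half_lim_osc_tail[OF F M] tail[of 1] by auto
  moreover obtain L2 where "half_lim (\<lambda>l. F (- l)) L2" using half_lim_osc_tail[OF m M] tail[of "-1"] by auto
  ultimately have "has_gen_integral F (L1 + L2)" by (auto simp: has_gen_integral_def)
  with has_gen_integral_eq[OF this] show ?thesis by simp
qed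

section \<open>Convergence of the integrals in the solution formula\<close>

text \<open>Both exponents at once: \<open>\<sigma> = 1\<close> is \<open>omega1\<close> and \<open>\<sigma> = - 1\<close> is \<open>omega2\<close>.\<close>

definition signed_omega :: "real \<Rightarrow> real \<Rightarrow> real \<Rightarrow> complex" where
  "signed_omega \<sigma> m l = \<i> * of_real (\<sigma> * rho m l)"

lemma omega_eq_signed: "omega1 m l = signed_omega 1 m l" "omega2 m l = signed_omega (- 1) m l"
  by (simp_all add: omega1_def omega2_def signed_omega_def)

lemma rho_ge: "\<bar>l\<bar> \<le> rho m l" and rho_ge_mass: "m \<ge> 0 \<Longrightarrow> m \<le> rho m l"
  unfolding rho_def by (auto intro: real_le_rsqrt)

lemma rho_nonneg: "0 \<le> rho m l"
  by (simp add: rho_def)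

lemma rho_pos: "l \<noteq> 0 \<Longrightarrow> 0 < rho m l"
  using rho_ge[of l m] by linarith

lemma rho_minus: "rho m (- l) = rho m l"
  by (simp add: rho_def)

lemma rho_sign: "is_sign \<xi> \<Longrightarrow> rho m (\<xi> * l) = rho m l"
  by (auto simp: rho_minus)

lemma rho_squared: "(rho m l)\<^sup>2 = l\<^sup>2 + m\<^sup>2"
  by (simp add: rho_def)

lemma rho_excess:
  assumes "l > 0" shows "0 \<le> rho m l - l" "rho m l - l \<le> m\<^sup>2 / l"
proof -
  show 0: "0 \<le> rho m l - l" using rho_ge[of l m] assms by simp
  have "(rho m l - l) * l \<le> (rho m l - l) * (rho m l + l)"
    using 0 rho_nonneg[of m l] by (intro mult_left_mono) auto
  also have "\<dots> = m\<^sup>2" using rho_squared[of m l] by (simp add: power2_eq_square algebra_simps)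
  finally show "rho m l - l \<le> m\<^sup>2 / l" using assms by (simp add: pos_le_divide_eq)
qed

lemma continuous_on_rho [continuous_intros]: "continuous_on S f \<Longrightarrow> continuous_on S (\<lambda>x. rho m (f x))"
  unfolding rho_def by (intro continuous_intros)

lemma borel_measurable_rho [measurable]: "rho m \<in> borel_measurable borel"
  by (intro borel_measurable_continuous_onI continuous_intros)

lemma continuous_on_signed_omega [continuous_intros]: "continuous_on S (signed_omega \<sigma> m)"
  unfolding signed_omega_def by (intro continuous_intros)

lemma Re_signed_omega [simp]: "Re (signed_omega \<sigma> m l) = 0"
  by (simp add: signed_omega_def)

lemma norm_signed_omega: "is_sign \<sigma> \<Longrightarrow> norm (signed_omega \<sigma> m l) = rho m l"
  using rho_nonneg[of m l] by (auto simp: signed_omega_def norm_mult)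

lemma norm_kern [simp]: "norm (kern (signed_omega \<sigma> m l) l x t) = 1"
  by (simp add: kern_def)

lemma kern_measurable: "(\<lambda>l. kern (signed_omega \<sigma> m l) l x t) \<in> borel_measurable borel"
  unfolding kern_def by (intro borel_measurable_continuous_onI continuous_intros)

text \<open>The common form of the quotients \<open>l / rho\<close> and \<open>(\<i> w + m) / rho\<close>, \<open>w = \<plusminus>\<i> rho\<close>, of the solution
  formula; its value is \<open>0\<close> where \<open>rho\<close> vanishes.\<close>

definition symbol :: "real \<Rightarrow> real \<Rightarrow> real \<Rightarrow> real \<Rightarrow> real \<Rightarrow> real" where
  "symbol p q r m l = (p * l + q * rho m l + r * m) / rho m l"

lemma symbol_measurable [measurable]: "symbol p q r m \<in> borel_measurable borel"
  unfolding symbol_def by measurable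

lemma symbol_bound:
  assumes m: "m \<ge> 0" shows "\<bar>symbol p q r m l\<bar> \<le> \<bar>p\<bar> + \<bar>q\<bar> + \<bar>r\<bar>"
proof (cases "rho m l = 0")
  case False
  then have pos: "rho m l > 0" using rho_nonneg[of m l] by simp
  have "\<bar>p * l + q * rho m l + r * m\<bar> \<le> \<bar>p\<bar> * \<bar>l\<bar> + \<bar>q\<bar> * rho m l + \<bar>r\<bar> * m"
    using m pos by (auto simp: abs_mult intro!: order_trans[OF abs_triangle_ineq] add_mono)
  also have "\<dots> \<le> \<bar>p\<bar> * rho m l + \<bar>q\<bar> * rho m l + \<bar>r\<bar> * rho m l"
    by (intro add_mono mult_left_mono rho_ge rho_ge_mass m) auto
  finally show ?thesis using pos by (simp add: symbol_def abs_divide pos_divide_le_eq algebra_simps)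
qed (simp add: symbol_def)

lemma rate_symbol:
  assumes \<xi>: "is_sign \<xi>" and m: "m \<ge> 0"
  shows "rate (\<lambda>l. of_real (symbol p q r m (\<xi> * l))) (of_real (p * \<xi> + q))"
proof (rule rateI)
  fix l :: real assume l: "l \<ge> 1"
  have pos: "rho m l > 0" and ge: "l \<le> rho m l" using rho_pos[of l m] rho_ge[of l m] l by auto
  have "symbol p q r m (\<xi> * l) - (p * \<xi> + q) = (p * \<xi> * (l - rho m l) + r * m) / rho m l"
    using pos unfolding symbol_def rho_sign[OF \<xi>] by (simp add: field_simps)
  then have "\<bar>symbol p q r m (\<xi> * l) - (p * \<xi> + q)\<bar> = \<bar>p * \<xi> * (l - rho m l) + r * m\<bar> / rho m l"
    using pos by simp
  also have "\<dots> \<le> (\<bar>p\<bar> * m\<^sup>2 + \<bar>r\<bar> * m) / l"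
  proof (rule frac_le)
    have "\<bar>p * \<xi> * (l - rho m l) + r * m\<bar> \<le> \<bar>p * \<xi> * (l - rho m l)\<bar> + \<bar>r * m\<bar>" by (rule abs_triangle_ineq)
    also have "\<dots> = \<bar>p\<bar> * (rho m l - l) + \<bar>r\<bar> * m" using \<xi> m ge by (auto simp: abs_mult)
    also have "rho m l - l \<le> m\<^sup>2"
    proof -
      have "m\<^sup>2 / l \<le> m\<^sup>2 / 1" using l by (intro divide_left_mono) auto
      then show ?thesis using rho_excess(2)[of l m] l by simp
    qed
    finally show "\<bar>p * \<xi> * (l - rho m l) + r * m\<bar> \<le> \<bar>p\<bar> * m\<^sup>2 + \<bar>r\<bar> * m"
      by (simp add: mult_left_mono)
  qed (use l ge m in auto)
  finally show "norm (complex_of_real (symbol p q r m (\<xi> * l)) - of_real (p * \<xi> + q)) \<le> (\<bar>p\<bar> * m\<^sup>2 + \<bar>r\<bar> * m) / l"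
    by (simp only: of_real_diff[symmetric] norm_of_real)
qed

text \<open>The kernel has the frequency \<open>rho\<close> in \<open>t\<close>, not \<open>l\<close>.  The discrepancy is of the order \<open>1 / l\<close>, so
  that it only contributes a factor tending to \<open>1\<close>.\<close>

definition phase :: "real \<Rightarrow> real \<Rightarrow> real \<Rightarrow> real \<Rightarrow> complex" where
  "phase \<sigma> m t l = exp (\<i> * of_real (- \<sigma> * (rho m l - l) * t))"

lemma norm_exp_i_minus_1: "norm (exp (\<i> * of_real \<theta>) - 1) \<le> \<bar>\<theta>\<bar>"
  using abs_sin_x_le_abs_x[of "\<theta> / 2"] by (simp add: dist_exp_i_1)

lemma rate_phase:
  assumes \<sigma>: "is_sign \<sigma>" shows "rate (phase \<sigma> m t) 1"
proof (rule rateI)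
  fix l :: real assume l: "l \<ge> 1"
  have "norm (phase \<sigma> m t l - 1) \<le> \<bar>- \<sigma> * (rho m l - l) * t\<bar>"
    unfolding phase_def by (rule norm_exp_i_minus_1)
  also have "\<dots> = (rho m l - l) * \<bar>t\<bar>"
    using \<sigma> rho_excess(1)[of l m] l by (auto simp: abs_mult)
  also have "\<dots> \<le> m\<^sup>2 / l * \<bar>t\<bar>"
    using rho_excess(2)[of l m] l by (intro mult_right_mono) auto
  finally show "norm (phase \<sigma> m t l - 1) \<le> (m\<^sup>2 * \<bar>t\<bar>) / l" by simp
qed

lemma kern_phase:
  assumes \<xi>: "is_sign \<xi>"
  shows "kern (signed_omega \<sigma> m (\<xi> * l)) (\<xi> * l) x t = exp (\<i> * of_real ((\<xi> * x - \<sigma> * t) * l)) * phase \<sigma> m t l"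
  unfolding kern_def signed_omega_def phase_def exp_add[symmetric] rho_sign[OF \<xi>]
  by (simp add: algebra_simps)

text \<open>Two integrations by parts: the remainder after the leading term is the transform of \<open>u'\<close>, which is
  itself \<open>O(1 / l)\<close>.\<close>

lemma hat_rate:
  assumes u: "quadratic_decay C u" and u': "quadratic_decay C' u'" and u'': "quadratic_decay C'' u''"
    and d: "\<And>y. y \<ge> 0 \<Longrightarrow> (u has_vector_derivative u' y) (at y within {0..})"
    and d': "\<And>y. y \<ge> 0 \<Longrightarrow> (u' has_vector_derivative u'' y) (at y within {0..})"
    and \<xi>: "is_sign \<xi>"
  shows "rate (\<lambda>l. of_real l * hat u (\<xi> * l)) (- \<i> * of_real \<xi> * u 0)"
proof -
  have "rate (\<lambda>l. hat u' (\<xi> * l)) 0"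
  proof (rule rate_zero)
    fix l :: real assume "l \<ge> 1"
    then show "l * norm (hat u' (\<xi> * l)) \<le> C' + C'' * pi"
      using norm_hat_derivative_le[OF u' u'' d', of "\<xi> * l"] \<xi> by (auto simp: abs_mult)
  qed
  then have "rate (\<lambda>l. - \<i> * of_real \<xi> * (u 0 + hat u' (\<xi> * l))) (- \<i> * of_real \<xi> * (u 0 + 0))"
    by (intro rate_mult rate_add rate_const)
  moreover have "of_real l * hat u (\<xi> * l) = - \<i> * of_real \<xi> * (u 0 + hat u' (\<xi> * l))" for l
  proof -
    have "hat u' (\<xi> * l) = \<i> * of_real (\<xi> * l) * hat u (\<xi> * l) - u 0"
      by (rule hat_derivative[OF u u' d])
    then have "u 0 + hat u' (\<xi> * l) = \<i> * of_real \<xi> * (of_real l * hat u (\<xi> * l))" by simp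
    moreover have "- \<i> * of_real \<xi> * (\<i> * of_real \<xi> * z) = z" for z
      using \<xi> by auto
    ultimately show ?thesis by presburger
  qed
  ultimately show ?thesis by simp
qed

text \<open>At \<open>\<xi> l\<close> with \<open>l > 0\<close>, \<open>\<xi> = \<plusminus>1\<close>, the integrand oscillates in \<open>l\<close> with the frequency \<open>\<xi> x - \<sigma> t\<close>, which is
  nonzero off the diagonal.\<close>

lemma initial_term_converges:
  fixes p q r :: real
  assumes g: "half_line_schwartz g" and m: "m \<ge> 0" and xt: "x > 0" "t > 0" "x \<noteq> t"
    and \<sigma>: "is_sign \<sigma>" and \<epsilon>: "is_sign \<epsilon>"
  defines "F \<equiv> \<lambda>l. kern (signed_omega \<sigma> m l) l x t * of_real (symbol p q r m l) * hat g (\<epsilon> * l)"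
  shows "has_gen_integral F (gen_integral F)"
proof -
  from half_line_schwartz_quadratic_decay[OF g, of 0] half_line_schwartz_quadratic_decay[OF g, of 1]
    half_line_schwartz_quadratic_decay[OF g, of 2]
  obtain C0 C1 C2 where C: "quadratic_decay C0 ((hderiv ^^ 0) g)" "quadratic_decay C1 ((hderiv ^^ Suc 0) g)"
    "quadratic_decay C2 ((hderiv ^^ Suc (Suc 0)) g)"
    unfolding One_nat_def numeral_2_eq_2 by blast
  have sm: "half_line_smooth g" using g by (simp add: half_line_schwartz_def)
  have g0: "(hderiv ^^ 0) g = g" by simp
  show ?thesis
  proof (rule has_gen_integral_osc_tail)
    have "(\<lambda>l. hat g (\<epsilon> * l)) \<in> borel_measurable borel"
      by (intro borel_measurable_continuous_onI continuous_on_compose2[OF continuous_on_hat[OF C(1)[unfolded g0], of UNIV]] continuous_intros) auto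
    then show "F \<in> borel_measurable borel"
      unfolding F_def using kern_measurable[of \<sigma> m x t] by measurable
    show "norm (F l) \<le> (\<bar>p\<bar> + \<bar>q\<bar> + \<bar>r\<bar>) * (C0 * pi)" for l
      unfolding F_def norm_mult norm_kern norm_of_real mult_1
      by (intro mult_mono symbol_bound[OF m] norm_hat_le[OF C(1)[unfolded g0]]) auto
    fix \<xi> :: real assume \<xi>: "is_sign \<xi>"
    have s: "\<xi> * x - \<sigma> * t \<noteq> 0" using \<xi> \<sigma> xt by auto
    have e\<xi>: "is_sign (\<epsilon> * \<xi>)" using \<xi> \<epsilon> by auto
    note hr = hat_rate[OF C half_line_smooth_derivative[OF sm] half_line_smooth_derivative[OF sm] e\<xi>, unfolded g0]
    show "osc_tail (\<lambda>l. F (\<xi> * l))"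
    proof (rule osc_tail_cong)
      show "osc_tail (\<lambda>l. exp (\<i> * of_real ((\<xi> * x - \<sigma> * t) * l)) *
          (phase \<sigma> m t l * of_real (symbol p q r m (\<xi> * l)) * (of_real l * hat g (\<epsilon> * \<xi> * l))) / of_real l)"
        by (rule osc_tail_exp[OF _ s]) (rule rate_mult[OF rate_mult[OF rate_phase[OF \<sigma>] rate_symbol[OF \<xi> m]] hr])
      show "F (\<xi> * l) = exp (\<i> * of_real ((\<xi> * x - \<sigma> * t) * l)) *
          (phase \<sigma> m t l * of_real (symbol p q r m (\<xi> * l)) * (of_real l * hat g (\<epsilon> * \<xi> * l))) / of_real l"
        if "l \<ge> 1" for l
        unfolding F_def kern_phase[OF \<xi>] using that by (simp add: mult.assoc)
    qed
  qed
qed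

text \<open>Integration by parts in time contributes the values of \<open>h\<close> at both ends of \<open>[0, t]\<close>.  The value at
  \<open>t\<close> cancels the time dependence of the kernel and oscillates with the frequency \<open>\<plusminus>x\<close>; the value at
  \<open>0\<close> keeps it and oscillates with the frequency \<open>\<plusminus>x - \<sigma> t\<close>.\<close>

lemma boundary_term_converges:
  fixes p q r :: real
  assumes h: "half_line_smooth h" and m: "m \<ge> 0" and xt: "x > 0" "t > 0" "x \<noteq> t"
    and \<sigma>: "is_sign \<sigma>"
  defines "F \<equiv> \<lambda>l. kern (signed_omega \<sigma> m l) l x t * of_real (symbol p q r m l) * time_transform h (signed_omega \<sigma> m l) t"
  shows "has_gen_integral F (gen_integral F)"
proof -
  define h' where "h' = hderiv h"
  have c: "continuous_on {0..} h" "continuous_on {0..} h'" "continuous_on {0..} (hderiv h')"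
    using half_line_smooth_continuous[OF h, of 0] half_line_smooth_continuous[OF h, of 1]
      half_line_smooth_continuous[OF h, of "Suc 1"] by (simp_all add: h'_def)
  have d: "(h has_vector_derivative h' y) (at y within {0..})" "(h' has_vector_derivative hderiv h' y) (at y within {0..})"
    if "y \<ge> 0" for y
    using half_line_smooth_derivative[OF h that, of 0] half_line_smooth_derivative[OF h that, of 1]
    by (simp_all add: h'_def)
  have bd: "\<exists>M. \<forall>\<tau>\<in>{0..t}. norm (u \<tau>) \<le> M" if "continuous_on {0..} u" for u :: "real \<Rightarrow> complex"
  proof -
    have "compact (u ` {0..t})"
      by (rule compact_continuous_image[OF continuous_on_subset[OF that] compact_Icc]) auto
    from compact_imp_bounded[OF this] show ?thesis unfolding bounded_iff by auto
  qed
  obtain M0 where M0: "\<And>\<tau>. \<tau> \<in> {0..t} \<Longrightarrow> norm (h \<tau>) \<le> M0" using bd[OF c(1)] by blast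
  obtain M2 where M2: "\<And>\<tau>. \<tau> \<in> {0..t} \<Longrightarrow> norm (hderiv h' \<tau>) \<le> M2" using bd[OF c(3)] by blast
  have t0: "0 \<le> t" using xt by simp
  show ?thesis
  proof (rule has_gen_integral_osc_tail)
    have "(\<lambda>l. time_transform h (signed_omega \<sigma> m l) t) \<in> borel_measurable borel"
      by (intro borel_measurable_continuous_onI continuous_on_time_transform c continuous_intros)
    then show "F \<in> borel_measurable borel"
      unfolding F_def using kern_measurable[of \<sigma> m x t] by measurable
    show "norm (F l) \<le> (\<bar>p\<bar> + \<bar>q\<bar> + \<bar>r\<bar>) * (M0 * t)" for l
      unfolding F_def norm_mult norm_kern norm_of_real mult_1
      by (intro mult_mono symbol_bound[OF m] norm_time_transform_le[OF c(1) _ t0 M0]) auto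
    fix \<xi> :: real assume \<xi>: "is_sign \<xi>"
    have s: "\<xi> * x - \<sigma> * t \<noteq> 0" "\<xi> * x \<noteq> 0" using \<xi> \<sigma> xt by auto
    let ?w = "\<lambda>l. signed_omega \<sigma> m (\<xi> * l)"
    \<comment> \<open>\<open>\<iota> l\<close> is \<open>l / w\<close>, written with a symbol so that its rate of convergence is known.\<close>
    define \<iota> where "\<iota> = (\<lambda>l. - \<i> * of_real \<sigma> * complex_of_real (symbol 1 0 0 m l))"
    have \<iota>: "\<iota> l * ?w l = of_real l" if "l \<ge> 1" for l
      using \<sigma> that rho_pos[of l m] by (auto simp: \<iota>_def signed_omega_def symbol_def rho_sign[OF \<xi>] complex_eq_iff)
    have r\<iota>: "rate \<iota> (- \<i> * of_real \<sigma> * of_real (1 * 1 + 0))"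
      unfolding \<iota>_def using rate_symbol[of 1 m 1 0 0] m by (intro rate_mult rate_const) auto
    have rR: "rate (\<lambda>l. time_transform h' (?w l) t) 0"
    proof (rule rate_zero)
      fix l :: real assume l: "l \<ge> 1"
      have "l * norm (time_transform h' (?w l) t) \<le> norm (?w l) * norm (time_transform h' (?w l) t)"
        using rho_ge[of l m] l unfolding norm_signed_omega[OF \<sigma>] rho_sign[OF \<xi>] by (intro mult_right_mono) auto
      also have "\<dots> = norm (h' t * exp (?w l * of_real t) - h' 0 - time_transform (hderiv h') (?w l) t)"
        unfolding norm_mult[symmetric] by (subst time_transform_derivative[OF c(2,3) t0 d(2)]) auto
      also have "\<dots> \<le> norm (h' t * exp (?w l * of_real t)) + norm (h' 0) + norm (time_transform (hderiv h') (?w l) t)"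
        by (intro order_trans[OF norm_triangle_ineq4] add_mono norm_triangle_ineq4 order_refl)
      also have "\<dots> \<le> norm (h' t) + norm (h' 0) + M2 * t"
        using norm_time_transform_le[OF c(3) _ t0 M2, of "?w l"] by (simp add: norm_mult)
      finally show "l * norm (time_transform h' (?w l) t) \<le> norm (h' t) + norm (h' 0) + M2 * t" .
    qed
    note r\<iota>s = rate_mult[OF r\<iota> rate_symbol[OF \<xi> m, of p q r]]
    note r1 = rate_mult[OF r\<iota>s rate_const[of "h t"]]
    note r2 = rate_mult[OF rate_mult[OF rate_mult[OF rate_phase[OF \<sigma>, of m t] r\<iota>] rate_symbol[OF \<xi> m, of p q r]]
        rate_add[OF rate_const[of "- h 0"] rate_mult[OF rate_const[of "- 1"] rR]]]
    let ?rhs = "\<lambda>l. exp (\<i> * of_real ((\<xi> * x) * l)) * (\<iota> l * of_real (symbol p q r m (\<xi> * l)) * h t) / of_real l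
         + exp (\<i> * of_real ((\<xi> * x - \<sigma> * t) * l)) *
          (phase \<sigma> m t l * \<iota> l * of_real (symbol p q r m (\<xi> * l)) * (- h 0 + - 1 * time_transform h' (?w l) t)) / of_real l"
    show "osc_tail (\<lambda>l. F (\<xi> * l))"
    proof (rule osc_tail_cong)
      show "osc_tail ?rhs"
        by (rule osc_tail_add[OF osc_tail_exp[OF r1 s(2)] osc_tail_exp[OF r2 s(1)]])
      fix l :: real assume l: "l \<ge> 1"
      let ?k = "kern (?w l) (\<xi> * l) x t"
      have \<iota>0: "time_transform h (?w l) t = \<iota> l * (?w l * time_transform h (?w l) t) / of_real l"
        using \<iota>[OF l] l by (simp flip: mult.assoc)
      have kx: "?k * exp (?w l * of_real t) = exp (\<i> * of_real ((\<xi> * x) * l))"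
        unfolding kern_def exp_add[symmetric] by (simp add: mult_ac)
      have "F (\<xi> * l) = ?k * of_real (symbol p q r m (\<xi> * l)) *
          (\<iota> l * (h t * exp (?w l * of_real t) - h 0 - time_transform h' (?w l) t) / of_real l)"
        unfolding F_def by (subst \<iota>0) (simp only: time_transform_derivative[OF c(1,2) t0 d(1)])
      also have "\<dots> = (?k * exp (?w l * of_real t)) * (\<iota> l * of_real (symbol p q r m (\<xi> * l)) * h t) / of_real l
         + ?k * (\<iota> l * of_real (symbol p q r m (\<xi> * l)) * (- h 0 + - 1 * time_transform h' (?w l) t)) / of_real l"
        by (simp add: algebra_simps add_divide_distrib diff_divide_distrib)
      also have "\<dots> = ?rhs l"
        unfolding kx unfolding kern_phase[OF \<xi>] by (simp only: mult.assoc)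
      finally show "F (\<xi> * l) = ?rhs l" .
    qed
  qed
qed

lemma source_term_integrable:
  assumes f: "quad_smooth f" "rapidly_decreasing_in_x f" and m: "m \<ge> 0" and t: "t > 0"
    and \<sigma>: "is_sign \<sigma>" and \<epsilon>: "is_sign \<epsilon>"
  shows "integrable lborel (\<lambda>l. kern (signed_omega \<sigma> m l) l x t * of_real (symbol p q r m l) * tilde_hat f (\<epsilon> * l) (signed_omega \<sigma> m l) t)"
proof -
  from tilde_hat_decay[OF f t] obtain C K where ds: "decaying_source f C t"
    and K: "\<And>l w. Re w = 0 \<Longrightarrow> norm (tilde_hat f l w t) \<le> K"
      "\<And>l w. Re w = 0 \<Longrightarrow> norm w * \<bar>l\<bar> * norm (tilde_hat f l w t) \<le> K"
    by blast
  let ?th = "\<lambda>l. tilde_hat f (\<epsilon> * l) (signed_omega \<sigma> m l) t"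
  let ?F = "\<lambda>l. kern (signed_omega \<sigma> m l) l x t * of_real (symbol p q r m l) * ?th l"
  show ?thesis
  proof (rule Bochner_Integration.integrable_bound)
    show "integrable lborel (\<lambda>l. (\<bar>p\<bar> + \<bar>q\<bar> + \<bar>r\<bar>) * (2 * K * (1 / (1 + l\<^sup>2))))"
      by (intro integrable_mult_right integrable_inverse_quadratic)
    have "?th \<in> borel_measurable borel"
      by (intro borel_measurable_continuous_onI decaying_source.continuous_on_tilde_hat[OF ds] continuous_intros) simp
    then show "?F \<in> borel_measurable lborel"
      using kern_measurable[of \<sigma> m x t] by measurable
    show "AE l in lborel. norm (?F l) \<le> norm ((\<bar>p\<bar> + \<bar>q\<bar> + \<bar>r\<bar>) * (2 * K * (1 / (1 + l\<^sup>2))))"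
    proof (rule AE_I2)
      fix l :: real
      have "l\<^sup>2 * norm (?th l) \<le> rho m l * \<bar>l\<bar> * norm (?th l)"
      proof (rule mult_right_mono)
        have "\<bar>l\<bar> * \<bar>l\<bar> \<le> rho m l * \<bar>l\<bar>" by (intro mult_right_mono rho_ge) auto
        then show "l\<^sup>2 \<le> rho m l * \<bar>l\<bar>" by (simp add: power2_eq_square)
      qed simp
      also have "\<dots> \<le> K" using K(2)[of "signed_omega \<sigma> m l" "\<epsilon> * l"] \<epsilon> by (auto simp: norm_signed_omega[OF \<sigma>])
      finally have "norm (?th l) * (1 + l\<^sup>2) \<le> 2 * K"
        using K(1)[of "signed_omega \<sigma> m l" "\<epsilon> * l"] by (simp add: algebra_simps)
      then have th: "norm (?th l) \<le> 2 * K * (1 / (1 + l\<^sup>2))"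
        by (simp add: pos_le_divide_eq add_pos_nonneg)
      have "norm (?F l) \<le> (\<bar>p\<bar> + \<bar>q\<bar> + \<bar>r\<bar>) * (2 * K * (1 / (1 + l\<^sup>2)))"
        unfolding norm_mult norm_kern norm_of_real mult_1
        by (intro mult_mono symbol_bound[OF m] th) auto
      then show "norm (?F l) \<le> norm ((\<bar>p\<bar> + \<bar>q\<bar> + \<bar>r\<bar>) * (2 * K * (1 / (1 + l\<^sup>2))))"
        unfolding real_norm_def by (rule order_trans[OF _ abs_ge_self])
    qed
  qed
qed

section \<open>Recovery of a solution from the transforms of its data\<close>

text \<open>The right-hand side of Duhamel's formula for one mode without truncation: the contributions of
  the initial values, of the boundary value and of the sources.\<close>

definition fourier_data where
  "fourier_data g1 g2 h1 f1 f2 t a b w l =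
     a * (hat g1 l - hat g1 (- l)) + b * (hat g2 l + hat g2 (- l))
     + 2 * b * time_transform h1 w t
     + a * (tilde_hat f1 l w t - tilde_hat f1 (- l) w t)
     + b * (tilde_hat f2 l w t + tilde_hat f2 (- l) w t)"

context dirac_half_line
begin

lemma integral_mode_source:
  assumes t: "t \<ge> 0" and R: "R \<ge> 0"
  shows "integral {0..t} (mode_source a b w R l) =
     a * (integral {0..t} (\<lambda>\<tau>. exp (w * of_real \<tau>) * trunc_f1 R l \<tau>) - integral {0..t} (\<lambda>\<tau>. exp (w * of_real \<tau>) * trunc_f1 R (- l) \<tau>))
   + b * (integral {0..t} (\<lambda>\<tau>. exp (w * of_real \<tau>) * trunc_f2 R l \<tau>) + integral {0..t} (\<lambda>\<tau>. exp (w * of_real \<tau>) * trunc_f2 R (- l) \<tau>))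
   + 2 * b * time_transform h1 w t" (is "_ = ?I")
proof -
  have sw: "continuous_on ({0..t} \<times> {0..R}) (\<lambda>(s, y). f1 y s)" "continuous_on ({0..t} \<times> {0..R}) (\<lambda>(s, y). f2 y s)"
    by (rule continuous_on_swapped[OF f_cont(1)] continuous_on_swapped[OF f_cont(2)]; simp add: Quad_closed_def)+
  note c = continuous_on_trunc_hat_param[OF sw(1)] continuous_on_trunc_hat_param[OF sw(2)]
  have hc: "continuous_on {0..t} h1" by (rule continuous_on_subset[OF h_cont]) auto
  have "((\<lambda>\<tau>. a * (exp (w * of_real \<tau>) * trunc_f1 R l \<tau> - exp (w * of_real \<tau>) * trunc_f1 R (- l) \<tau>)
     + b * (exp (w * of_real \<tau>) * trunc_f2 R l \<tau> + exp (w * of_real \<tau>) * trunc_f2 R (- l) \<tau>)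
     + 2 * b * (h1 \<tau> * exp (w * of_real \<tau>))) has_integral
     ?I) {0..t}"
    unfolding time_transform_eq_integral[OF h_cont]
    by (intro has_integral_add has_integral_diff has_integral_mult_right integrable_integral
        integrable_continuous_interval continuous_intros c hc)
  moreover have "(\<lambda>\<tau>. a * (exp (w * of_real \<tau>) * trunc_f1 R l \<tau> - exp (w * of_real \<tau>) * trunc_f1 R (- l) \<tau>)
     + b * (exp (w * of_real \<tau>) * trunc_f2 R l \<tau> + exp (w * of_real \<tau>) * trunc_f2 R (- l) \<tau>)
     + 2 * b * (h1 \<tau> * exp (w * of_real \<tau>))) = mode_source a b w R l"
    by (rule ext) (simp add: mode_source_def algebra_simps)
  ultimately show ?thesis by (simp add: integral_unique)
qed

text \<open>Replacing the truncated transforms of the data in \<open>evolution\<close> by the full ones costs a multiple of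
  \<open>quadratic_tail R\<close>.\<close>

lemma transform_of_solution:
  assumes t: "t > 0" and w: "Re w = 0"
    and ab: "(w - \<i> * of_real m) * a = \<i> * of_real l * b" "(w + \<i> * of_real m) * b = \<i> * of_real l * a"
    and B: "set_integrable lebesgue {0<..} B"
    and dom: "\<And>y s. 0 < y \<Longrightarrow> 0 < s \<Longrightarrow> s \<le> t \<Longrightarrow> (norm (Y1 y s))\<^sup>2 \<le> B y \<and> (norm (Y2 y s))\<^sup>2 \<le> B y"
    and g: "quadratic_decay C g1" "quadratic_decay C g2"
    and f: "decaying_source f1 C t" "decaying_source f2 C t"
    and R: "R > 0"
  shows "norm (exp (w * of_real t) * mode a b R l t - fourier_data g1 g2 h1 f1 f2 t a b w l)
     \<le> (norm a + norm b) * (2 * t * sqrt (B R) + (2 * C + 2 * t * C) * quadratic_tail R)"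
proof -
  let ?I = "\<lambda>u l. integral {0..t} (\<lambda>\<tau>. exp (w * of_real \<tau>) * trunc_hat R (\<lambda>y. u y \<tau>) l)"
  let ?X = "exp (w * of_real t) * mode a b R l t - (a * (trunc_hat R g1 l - trunc_hat R g1 (- l)) + b * (trunc_hat R g2 l + trunc_hat R g2 (- l)))
      - integral {0..t} (mode_source a b w R l)"
  define q where "q = quadratic_tail R"
  have eg: "norm (trunc_hat R g1 k - hat g1 k) \<le> C * q" "norm (trunc_hat R g2 k - hat g2 k) \<le> C * q" for k
    unfolding q_def by (rule trunc_hat_approximates_hat[OF g(1) R] trunc_hat_approximates_hat[OF g(2) R])+
  have ef: "norm (?I f1 k - tilde_hat f1 k w t) \<le> t * C * q" "norm (?I f2 k - tilde_hat f2 k w t) \<le> t * C * q" for k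
    unfolding q_def
    by (rule decaying_source.truncated_source_approximates[OF f(1) w R]
        decaying_source.truncated_source_approximates[OF f(2) w R])+
  have tri: "norm (c * ((u - u') - (v - v'))) \<le> norm c * (2 * e)" "norm (c * ((u - u') + (v - v'))) \<le> norm c * (2 * e)"
    if "norm (u - u') \<le> e" "norm (v - v') \<le> e" for c u u' v v' :: complex and e :: real
  proof -
    have "norm ((u - u') - (v - v')) \<le> e + e" "norm ((u - u') + (v - v')) \<le> e + e"
      using that by (auto intro: order_trans[OF norm_triangle_ineq4] norm_triangle_le)
    then show "norm (c * ((u - u') - (v - v'))) \<le> norm c * (2 * e)" "norm (c * ((u - u') + (v - v'))) \<le> norm c * (2 * e)"
      unfolding norm_mult by (auto intro!: mult_left_mono)
  qed
  have "exp (w * of_real t) * mode a b R l t - fourier_data g1 g2 h1 f1 f2 t a b w l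
    = ?X + (a * ((trunc_hat R g1 l - hat g1 l) - (trunc_hat R g1 (- l) - hat g1 (- l)))
        + (b * ((trunc_hat R g2 l - hat g2 l) + (trunc_hat R g2 (- l) - hat g2 (- l)))
        + (a * ((?I f1 l - tilde_hat f1 l w t) - (?I f1 (- l) - tilde_hat f1 (- l) w t))
        + b * ((?I f2 l - tilde_hat f2 l w t) + (?I f2 (- l) - tilde_hat f2 (- l) w t)))))"
    unfolding integral_mode_source[OF less_imp_le[OF t] less_imp_le[OF R]] fourier_data_def
    by (simp add: algebra_simps)
  also have "norm \<dots> \<le> 2 * t * (norm a + norm b) * sqrt (B R) + (norm a * (2 * (C * q))
       + (norm b * (2 * (C * q)) + (norm a * (2 * (t * C * q)) + norm b * (2 * (t * C * q)))))"
    by (intro order_trans[OF norm_triangle_ineq] add_mono tri eg ef evolution[OF t R w ab B dom])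
  also have "\<dots> = (norm a + norm b) * (2 * t * sqrt (B R) + (2 * C + 2 * t * C) * q)"
    by (simp add: algebra_simps)
  finally show ?thesis unfolding q_def .
qed

lemma mode_difference:
  "mode a b R l s - mode a' b' R l s = (a - a') * (trunc_Y1 R l s - trunc_Y1 R (- l) s) + (b - b') * (trunc_Y2 R l s + trunc_Y2 R (- l) s)"
  by (simp add: mode_def algebra_simps)

text \<open>Half the difference of the two modes, divided by \<open>rho\<close>, with the truncation error neglected.\<close>

definition half_sum where
  "half_sum t a1 b1 a2 b2 l =
     (exp (- signed_omega 1 m l * of_real t) * fourier_data g1 g2 h1 f1 f2 t a1 b1 (signed_omega 1 m l) l
      - exp (- signed_omega (- 1) m l * of_real t) * fourier_data g1 g2 h1 f1 f2 t a2 b2 (signed_omega (- 1) m l) l) / of_real (2 * rho m l)"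

text \<open>The factors \<open>1\<close> and \<open>- 1\<close> are the signs \<open>\<sigma>\<close>; they are kept so that statements about a general sign
  specialise literally.\<close>

abbreviation first_transform where
  "first_transform t l \<equiv> half_sum t (of_real (1 * rho m l + m)) (of_real l) (of_real (- 1 * rho m l + m)) (of_real l) l"

abbreviation second_transform where
  "second_transform t l \<equiv> half_sum t (of_real l) (of_real (1 * rho m l - m)) (of_real l) (of_real (- 1 * rho m l - m)) l"

text \<open>Both normalisations of the left eigenvector, \<open>(\<sigma> rho + m, l)\<close> and \<open>(l, \<sigma> rho - m)\<close>.  The relations
  amount to \<open>rho\<^sup>2 = l\<^sup>2 + m\<^sup>2\<close>.\<close>

lemma symbol_relations:
  assumes \<sigma>: "is_sign \<sigma>"
  shows "(signed_omega \<sigma> m l - \<i> * of_real m) * of_real (\<sigma> * rho m l + m) = \<i> * of_real l * of_real l"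
    and "(signed_omega \<sigma> m l + \<i> * of_real m) * of_real l = \<i> * of_real l * of_real (\<sigma> * rho m l + m)"
    and "(signed_omega \<sigma> m l - \<i> * of_real m) * of_real l = \<i> * of_real l * of_real (\<sigma> * rho m l - m)"
    and "(signed_omega \<sigma> m l + \<i> * of_real m) * of_real (\<sigma> * rho m l - m) = \<i> * of_real l * of_real l"
proof -
  have "(\<sigma> * rho m l - m) * (\<sigma> * rho m l + m) = l * l"
    using \<sigma> rho_squared[of m l] by (auto simp: power2_eq_square algebra_simps)
  then have sq: "complex_of_real (\<sigma> * rho m l - m) * of_real (\<sigma> * rho m l + m) = of_real l * of_real l"
    by (simp only: of_real_mult[symmetric])
  have signed_omega: "signed_omega \<sigma> m l - \<i> * of_real m = \<i> * of_real (\<sigma> * rho m l - m)"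
    "signed_omega \<sigma> m l + \<i> * of_real m = \<i> * of_real (\<sigma> * rho m l + m)"
    by (simp_all add: signed_omega_def algebra_simps)
  show "(signed_omega \<sigma> m l - \<i> * of_real m) * of_real (\<sigma> * rho m l + m) = \<i> * of_real l * of_real l"
    "(signed_omega \<sigma> m l + \<i> * of_real m) * of_real l = \<i> * of_real l * of_real (\<sigma> * rho m l + m)"
    "(signed_omega \<sigma> m l - \<i> * of_real m) * of_real l = \<i> * of_real l * of_real (\<sigma> * rho m l - m)"
    "(signed_omega \<sigma> m l + \<i> * of_real m) * of_real (\<sigma> * rho m l - m) = \<i> * of_real l * of_real l"
    unfolding signed_omega using sq by (simp_all only: mult.assoc) (simp_all only: mult.commute)
qed

text \<open>Division by \<open>rho\<close> compensates the size of the weights, so the error is uniform in \<open>l\<close> even where \<open>rho\<close>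
  is small.\<close>

lemma half_sum_approximation:
  assumes t: "t > 0" and m: "m \<ge> 0" and l: "l \<noteq> 0"
    and ab1: "(signed_omega 1 m l - \<i> * of_real m) * a1 = \<i> * of_real l * b1" "(signed_omega 1 m l + \<i> * of_real m) * b1 = \<i> * of_real l * a1"
    and ab2: "(signed_omega (- 1) m l - \<i> * of_real m) * a2 = \<i> * of_real l * b2" "(signed_omega (- 1) m l + \<i> * of_real m) * b2 = \<i> * of_real l * a2"
    and bd: "norm a1 + norm b1 \<le> 3 * rho m l" "norm a2 + norm b2 \<le> 3 * rho m l"
    and B: "set_integrable lebesgue {0<..} B"
    and dom: "\<And>y s. 0 < y \<Longrightarrow> 0 < s \<Longrightarrow> s \<le> t \<Longrightarrow> (norm (Y1 y s))\<^sup>2 \<le> B y \<and> (norm (Y2 y s))\<^sup>2 \<le> B y"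
    and g: "quadratic_decay C g1" "quadratic_decay C g2"
    and f: "decaying_source f1 C t" "decaying_source f2 C t"
    and R: "R > 0"
  shows "norm ((mode a1 b1 R l t - mode a2 b2 R l t) / of_real (2 * rho m l) - half_sum t a1 b1 a2 b2 l)
     \<le> 3 * (2 * t * sqrt (B R) + (2 * C + 2 * t * C) * quadratic_tail R)"
proof -
  define e where "e = 2 * t * sqrt (B R) + (2 * C + 2 * t * C) * quadratic_tail R"
  have e0: "0 \<le> e"
  proof -
    have "B R \<ge> 0" using dom[OF R t] by (auto intro: order_trans[OF zero_le_power2])
    moreover have "quadratic_tail R \<ge> 0" unfolding quadratic_tail_def set_lebesgue_integral_def
      by (rule integral_nonneg_AE) (auto simp: add_nonneg_nonneg)
    ultimately show ?thesis unfolding e_def using quadratic_decay_nonneg[OF g(1)] t by simp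
  qed
  have pos: "rho m l > 0" by (rule rho_pos[OF l])
  have one: "norm (mode a b R l t - exp (- w * of_real t) * fourier_data g1 g2 h1 f1 f2 t a b w l) \<le> 3 * rho m l * e"
    if w: "Re w = 0" and ab: "(w - \<i> * of_real m) * a = \<i> * of_real l * b" "(w + \<i> * of_real m) * b = \<i> * of_real l * a"
      and n: "norm a + norm b \<le> 3 * rho m l" for a b w
  proof -
    have "mode a b R l t - exp (- w * of_real t) * fourier_data g1 g2 h1 f1 f2 t a b w l
       = exp (- w * of_real t) * (exp (w * of_real t) * mode a b R l t - fourier_data g1 g2 h1 f1 f2 t a b w l)"
    proof -
      have "exp (- w * of_real t) * exp (w * of_real t) = 1" by (simp flip: exp_add)
      then show ?thesis by (simp only: right_diff_distrib mult.assoc[symmetric] mult_1)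
    qed
    also have "norm \<dots> = norm (exp (w * of_real t) * mode a b R l t - fourier_data g1 g2 h1 f1 f2 t a b w l)"
      using w by (simp add: norm_mult)
    also have "\<dots> \<le> (norm a + norm b) * e"
      unfolding e_def by (rule transform_of_solution[OF t w ab B dom g f R])
    also have "\<dots> \<le> 3 * rho m l * e" by (rule mult_right_mono[OF n e0])
    finally show ?thesis .
  qed
  let ?T = "\<lambda>\<sigma> a b. mode a b R l t - exp (- signed_omega \<sigma> m l * of_real t) * fourier_data g1 g2 h1 f1 f2 t a b (signed_omega \<sigma> m l) l"
  have split: "(v - v') / d - (e - e') / d = ((v - e) - (v' - e')) / d" for v v' e e' d :: complex
    by (simp add: diff_divide_distrib)
  have eq: "(mode a1 b1 R l t - mode a2 b2 R l t) / of_real (2 * rho m l) - half_sum t a1 b1 a2 b2 l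
     = (?T 1 a1 b1 - ?T (- 1) a2 b2) / of_real (2 * rho m l)"
    unfolding half_sum_def by (rule split)
  have "norm ((mode a1 b1 R l t - mode a2 b2 R l t) / of_real (2 * rho m l) - half_sum t a1 b1 a2 b2 l)
     = norm (?T 1 a1 b1 - ?T (- 1) a2 b2) / (2 * rho m l)"
    unfolding eq norm_divide norm_of_real using pos by simp
  also have "\<dots> \<le> (3 * rho m l * e + 3 * rho m l * e) / (2 * rho m l)"
  proof (rule divide_right_mono)
    have "norm (?T 1 a1 b1) \<le> 3 * rho m l * e" by (rule one[OF Re_signed_omega ab1 bd(1)])
    moreover have "norm (?T (- 1) a2 b2) \<le> 3 * rho m l * e" by (rule one[OF Re_signed_omega ab2 bd(2)])
    ultimately show "norm (?T 1 a1 b1 - ?T (- 1) a2 b2) \<le> 3 * rho m l * e + 3 * rho m l * e"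
      by (rule order_trans[OF norm_triangle_ineq4 add_mono])
  qed (use pos in simp)
  also have "\<dots> = 3 * e" using pos by (simp add: field_simps)
  finally show ?thesis unfolding e_def .
qed

text \<open>In the difference of the modes for \<open>\<sigma> = 1\<close> and \<open>\<sigma> = - 1\<close> one of the two transforms cancels: with the
  weights \<open>(\<sigma> rho + m, l)\<close> it is that of \<open>Y2\<close>, with \<open>(l, \<sigma> rho - m)\<close> that of \<open>Y1\<close>.  What remains is the
  transform of an odd or even extension, to which the inversion theorem applies.\<close>

theorem solution_from_transform:
  assumes t: "t > 0" and m: "m \<ge> 0" and x: "x > 0"
    and B: "set_integrable lebesgue {0<..} B"
    and dom: "\<And>y s. 0 < y \<Longrightarrow> 0 < s \<Longrightarrow> s \<le> t \<Longrightarrow> (norm (Y1 y s))\<^sup>2 \<le> B y \<and> (norm (Y2 y s))\<^sup>2 \<le> B y"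
    and g: "quadratic_decay C g1" "quadratic_decay C g2"
    and f: "decaying_source f1 C t" "decaying_source f2 C t"
  shows "has_gen_integral (\<lambda>l. exp (\<i> * of_real l * of_real x) *
        first_transform t l) L
      \<Longrightarrow> L = 2 * of_real pi * Y1 x t"
    and "has_gen_integral (\<lambda>l. exp (\<i> * of_real l * of_real x) *
        second_transform t l) L
      \<Longrightarrow> L = 2 * of_real pi * Y2 x t"
proof -
  \<comment> \<open>Radii at which the flux is negligible.\<close>
  have "\<exists>R>real n. B R < 1 / real (Suc n)" for n
    by (rule integrable_small_points[OF B]) simp
  then obtain R where R: "\<And>n. R n > real n" "\<And>n. B (R n) < 1 / real (Suc n)" by metis
  have Rpos: "R n > 0" for n using R(1)[of n] by linarith
  have Rlim: "filterlim R at_top sequentially"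
    by (rule filterlim_at_top_mono[OF filterlim_real_sequentially]) (intro always_eventually allI less_imp_le R(1))
  define \<delta> where "\<delta> = (\<lambda>n. 3 * (2 * t * sqrt (B (R n)) + (2 * C + 2 * t * C) * quadratic_tail (R n)))"
  have Blim: "(\<lambda>n. sqrt (B (R n))) \<longlonglongrightarrow> 0"
  proof -
    have "(\<lambda>n. B (R n)) \<longlonglongrightarrow> 0"
    proof (rule tendsto_sandwich[OF _ _ tendsto_const LIMSEQ_inverse_real_of_nat])
      show "\<forall>\<^sub>F n in sequentially. 0 \<le> B (R n)"
        by (intro always_eventually allI order_trans[OF zero_le_power2 conjunct1[OF dom[OF Rpos t order_refl]]])
      show "\<forall>\<^sub>F n in sequentially. B (R n) \<le> inverse (real (Suc n))"
        using R(2) by (auto intro!: always_eventually less_imp_le simp: inverse_eq_divide)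
    qed
    from tendsto_real_sqrt[OF this] show ?thesis by simp
  qed
  have "\<delta> \<longlonglongrightarrow> 3 * (2 * t * 0 + (2 * C + 2 * t * C) * 0)"
    unfolding \<delta>_def by (intro tendsto_intros Blim filterlim_compose[OF quadratic_tail_tendsto Rlim])
  then have \<delta>: "\<delta> \<longlonglongrightarrow> 0" by simp
  have inQ: "0 \<le> y \<Longrightarrow> (y, t) \<in> punctured_quad" for y by (rule in_punctured[OF _ t])
  have c: "continuous_on {0..} (\<lambda>y. Y1 y t)" "continuous_on {0..} (\<lambda>y. Y2 y t)"
    by (rule continuous_on_fst_slice[OF Y1D(1) inQ] continuous_on_fst_slice[OF Y2D(1) inQ]; simp)+
  have at_x: "at x within {0..} = at x"
    by (rule at_within_interior) (use x in \<open>simp add: interior_Ici\<close>)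
  have d: "((\<lambda>y. Y1 y t) has_vector_derivative dx Y1 x t) (at x)" "((\<lambda>y. Y2 y t) has_vector_derivative dx Y2 x t) (at x)"
    using Y1D(4)[OF inQ, of x] Y2D(4)[OF inQ, of x] x by (simp_all add: at_x)
  have B1: "(norm (Y1 y t))\<^sup>2 \<le> B y" and B2: "(norm (Y2 y t))\<^sup>2 \<le> B y" if "y > 0" for y
    using dom[OF that t] by auto
  have nb: "norm (complex_of_real (\<sigma> * rho m l + m)) + norm (complex_of_real l) \<le> 3 * rho m l"
    "norm (complex_of_real l) + norm (complex_of_real (\<sigma> * rho m l - m)) \<le> 3 * rho m l"
    if "is_sign \<sigma>" for \<sigma> l :: real
  proof -
    have "\<bar>\<sigma> * rho m l + m\<bar> \<le> rho m l + m" "\<bar>\<sigma> * rho m l - m\<bar> \<le> rho m l + m"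
      using that m rho_nonneg[of m l] by auto
    then show "norm (complex_of_real (\<sigma> * rho m l + m)) + norm (complex_of_real l) \<le> 3 * rho m l"
      "norm (complex_of_real l) + norm (complex_of_real (\<sigma> * rho m l - m)) \<le> 3 * rho m l"
      using rho_ge[of l m] rho_ge_mass[OF m, of l] unfolding norm_of_real by linarith+
  qed
  show "L = 2 * of_real pi * Y1 x t"
    if G: "has_gen_integral (\<lambda>l. exp (\<i> * of_real l * of_real x) *
        first_transform t l) L"
  proof (rule half_line_fourier_inversion[OF B B1 c(1) x d(1) Rlim \<delta> has_gen_integral_symmetric(1)[OF G] _ has_gen_integral_symmetric(2)[OF G]])
    fix n and l :: real assume l: "l \<noteq> 0"
    have pos: "rho m l > 0" by (rule rho_pos[OF l])
    have "(mode (of_real (1 * rho m l + m)) (of_real l) (R n) l t - mode (of_real (- 1 * rho m l + m)) (of_real l) (R n) l t) / of_real (2 * rho m l)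
       = trunc_Y1 (R n) l t + - 1 * trunc_Y1 (R n) (- l) t"
      unfolding mode_difference using pos by (simp add: field_simps)
    moreover have "norm ((mode (of_real (1 * rho m l + m)) (of_real l) (R n) l t - mode (of_real (- 1 * rho m l + m)) (of_real l) (R n) l t) / of_real (2 * rho m l)
      - first_transform t l) \<le> \<delta> n"
      unfolding \<delta>_def
      by (rule half_sum_approximation[OF t m l symbol_relations(1,2) symbol_relations(1,2) nb(1) nb(1) B dom g f Rpos]) auto
    ultimately show "norm (trunc_Y1 (R n) l t + - 1 * trunc_Y1 (R n) (- l) t
      - first_transform t l) \<le> \<delta> n"
      by simp
  qed auto
  show "L = 2 * of_real pi * Y2 x t"
    if G: "has_gen_integral (\<lambda>l. exp (\<i> * of_real l * of_real x) *
        second_transform t l) L"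
  proof (rule half_line_fourier_inversion[OF B B2 c(2) x d(2) Rlim \<delta> has_gen_integral_symmetric(1)[OF G] _ has_gen_integral_symmetric(2)[OF G]])
    fix n and l :: real assume l: "l \<noteq> 0"
    have pos: "rho m l > 0" by (rule rho_pos[OF l])
    have "(mode (of_real l) (of_real (1 * rho m l - m)) (R n) l t - mode (of_real l) (of_real (- 1 * rho m l - m)) (R n) l t) / of_real (2 * rho m l)
       = trunc_Y2 (R n) l t + 1 * trunc_Y2 (R n) (- l) t"
      unfolding mode_difference using pos by (simp add: field_simps)
    moreover have "norm ((mode (of_real l) (of_real (1 * rho m l - m)) (R n) l t - mode (of_real l) (of_real (- 1 * rho m l - m)) (R n) l t) / of_real (2 * rho m l)
      - second_transform t l) \<le> \<delta> n"
      unfolding \<delta>_def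
      by (rule half_sum_approximation[OF t m l symbol_relations(3,4) symbol_relations(3,4) nb(2) nb(2) B dom g f Rpos]) auto
    ultimately show "norm (trunc_Y2 (R n) l t + 1 * trunc_Y2 (R n) (- l) t
      - second_transform t l) \<le> \<delta> n"
      by simp
  qed auto
qed

end

abbreviation source_hat where
  "source_hat m t \<sigma> \<epsilon> f \<equiv> (\<lambda>l. tilde_hat f (\<epsilon> * l) (signed_omega \<sigma> m l) t)"

section \<open>Comparison with the solution formula\<close>

text \<open>The shape shared by the integrands that involve initial values or sources.\<close>

definition Gterm where
  "Gterm \<sigma> m x t q r u v l =
     kern (signed_omega \<sigma> m l) l x t * (of_real l * u l + of_real (q * rho m l + r * m) * v l) / of_real (2 * rho m l)"

lemma Gterm_eq_symb:
  "Gterm \<sigma> m x t q r u v l =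
     1 / 2 * (kern (signed_omega \<sigma> m l) l x t * of_real (symbol 1 0 0 m l) * u l)
     + 1 / 2 * (kern (signed_omega \<sigma> m l) l x t * of_real (symbol 0 q r m l) * v l)"
proof -
  have alg: "k * (L * a + c * b) / (2 * d) = 1 / 2 * (k * (L / d) * a) + 1 / 2 * (k * (c / d) * b)"
    for k L a c b d :: complex
    by (cases "d = 0") (simp_all add: field_simps)
  show ?thesis
    using alg[of _ _ _ _ _ "of_real (rho m l)"] by (simp add: Gterm_def symbol_def)
qed

lemma initial_Gterm:
  fixes q r :: real
  assumes "half_line_schwartz gu" "half_line_schwartz gv" "m \<ge> 0" "x > 0" "t > 0" "x \<noteq> t"
    "is_sign \<sigma>" "is_sign \<epsilon>"
  defines "F \<equiv> Gterm \<sigma> m x t q r (\<lambda>l. hat gu (\<epsilon> * l)) (\<lambda>l. hat gv (\<epsilon> * l))"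
  shows "has_gen_integral F (gen_integral F)"
proof -
  obtain L where "has_gen_integral F L"
    using has_gen_integral_add[OF
        has_gen_integral_cmult[OF initial_term_converges[OF assms(1,3-8), of 1 0 0], of "1/2"]
        has_gen_integral_cmult[OF initial_term_converges[OF assms(2-8), of 0 q r], of "1/2"]]
    unfolding F_def Gterm_eq_symb[abs_def] by blast
  with has_gen_integral_eq[OF this] show ?thesis by simp
qed

lemma source_Gterm:
  fixes q r x :: real
  assumes "quad_smooth fu" "rapidly_decreasing_in_x fu" "quad_smooth fv" "rapidly_decreasing_in_x fv"
    "m \<ge> 0" "t > 0" "is_sign \<sigma>" "is_sign \<epsilon>"
  defines "F \<equiv> Gterm \<sigma> m x t q r (source_hat m t \<sigma> \<epsilon> fu) (source_hat m t \<sigma> \<epsilon> fv)"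
  shows "has_gen_integral F (LINT l|lborel. F l)"
proof (rule has_gen_integral_integrable)
  show "integrable lborel F"
    unfolding F_def Gterm_eq_symb[abs_def]
    by (intro Bochner_Integration.integrable_add integrable_mult_right
        source_term_integrable[OF assms(1,2,5-8)] source_term_integrable[OF assms(3,4,5-8)])
qed

text \<open>The shape shared by the integrands that involve the boundary value.\<close>

definition Hterm where
  "Hterm \<sigma> m x t p q r h l =
     kern (signed_omega \<sigma> m l) l x t * of_real (symbol p q r m l) * time_transform h (signed_omega \<sigma> m l) t"

lemma boundary_Hterm:
  assumes "half_line_smooth h" "m \<ge> 0" "x > 0" "t > 0" "x \<noteq> t" "is_sign \<sigma>"
  shows "has_gen_integral (Hterm \<sigma> m x t p q r h) (gen_integral (Hterm \<sigma> m x t p q r h))"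
  using boundary_term_converges[OF assms, of p q r] unfolding Hterm_def[abs_def] .

lemma i_times_omega: "\<i> * signed_omega \<sigma> m l + of_real m = of_real (- \<sigma> * rho m l + m)"
  by (simp add: signed_omega_def flip: mult.assoc)

lemma G_eqs:
  "G11 m g1 g2 x t = gen_integral (Gterm 1 m x t 1 1 (\<lambda>l. hat g2 (1 * l)) (\<lambda>l. hat g1 (1 * l)))"
  "G12 m g1 g2 x t = gen_integral (Gterm 1 m x t (- 1) (- 1) (\<lambda>l. hat g2 (- 1 * l)) (\<lambda>l. hat g1 (- 1 * l)))"
  "G13 m g1 g2 x t = gen_integral (Gterm (- 1) m x t (- 1) 1 (\<lambda>l. hat g2 (1 * l)) (\<lambda>l. hat g1 (1 * l)))"
  "G14 m g1 g2 x t = gen_integral (Gterm (- 1) m x t 1 (- 1) (\<lambda>l. hat g2 (- 1 * l)) (\<lambda>l. hat g1 (- 1 * l)))"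
  "G21 m g1 g2 x t = gen_integral (Gterm 1 m x t 1 (- 1) (\<lambda>l. hat g1 (1 * l)) (\<lambda>l. hat g2 (1 * l)))"
  "G22 m g1 g2 x t = gen_integral (Gterm 1 m x t (- 1) 1 (\<lambda>l. hat g1 (- 1 * l)) (\<lambda>l. hat g2 (- 1 * l)))"
  "G23 m g1 g2 x t = gen_integral (Gterm (- 1) m x t (- 1) (- 1) (\<lambda>l. hat g1 (1 * l)) (\<lambda>l. hat g2 (1 * l)))"
  "G24 m g1 g2 x t = gen_integral (Gterm (- 1) m x t 1 1 (\<lambda>l. hat g1 (- 1 * l)) (\<lambda>l. hat g2 (- 1 * l)))"
  unfolding G11_def G12_def G13_def G14_def G21_def G22_def G23_def G24_def Gterm_def[abs_def] omega_eq_signed i_times_omega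
  by (auto intro!: arg_cong[of _ _ gen_integral] simp: fun_eq_iff algebra_simps)

lemma H_eqs:
  "H11 m h x t = gen_integral (Hterm 1 m x t 1 0 0 h)"
  "H12 m h x t = gen_integral (Hterm (- 1) m x t 1 0 0 h)"
  "H21 m h x t = gen_integral (Hterm 1 m x t 0 (- 1) 1 h)"
  "H22 m h x t = gen_integral (Hterm (- 1) m x t 0 1 1 h)"
  unfolding H11_def H12_def H21_def H22_def Hterm_def[abs_def] omega_eq_signed i_times_omega symbol_def
  by (auto intro!: arg_cong[of _ _ gen_integral] simp: fun_eq_iff)

lemma F_eqs:
  "F11 m f1 f2 x t =
     (LINT l|lborel. Gterm 1 m x t 1 1 (source_hat m t 1 1 f2) (source_hat m t 1 1 f1) l)
   + (LINT l|lborel. Gterm 1 m x t (- 1) (- 1) (source_hat m t 1 (- 1) f2) (source_hat m t 1 (- 1) f1) l)"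
  "F12 m f1 f2 x t =
   - (LINT l|lborel. Gterm (- 1) m x t (- 1) 1 (source_hat m t (- 1) 1 f2) (source_hat m t (- 1) 1 f1) l)
   - (LINT l|lborel. Gterm (- 1) m x t 1 (- 1) (source_hat m t (- 1) (- 1) f2) (source_hat m t (- 1) (- 1) f1) l)"
  "F21 m f1 f2 x t =
     (LINT l|lborel. Gterm 1 m x t 1 (- 1) (source_hat m t 1 1 f1) (source_hat m t 1 1 f2) l)
   - (LINT l|lborel. Gterm 1 m x t (- 1) 1 (source_hat m t 1 (- 1) f1) (source_hat m t 1 (- 1) f2) l)"
  "F22 m f1 f2 x t =
   - (LINT l|lborel. Gterm (- 1) m x t (- 1) (- 1) (source_hat m t (- 1) 1 f1) (source_hat m t (- 1) 1 f2) l)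
   + (LINT l|lborel. Gterm (- 1) m x t 1 1 (source_hat m t (- 1) (- 1) f1) (source_hat m t (- 1) (- 1) f2) l)"
  unfolding F11_def F12_def F21_def F22_def Gterm_def omega_eq_signed i_times_omega
  by (auto intro!: arg_cong2[of _ _ _ _ "(+)"] arg_cong2[of _ _ _ _ "(-)"] arg_cong[of _ _ uminus]
      arg_cong[of _ _ "integral\<^sup>L lborel"] simp: fun_eq_iff algebra_simps)

text \<open>The integrands with exponent \<open>\<sigma>\<close> in the formula for the first component add up to one mode with the
  weights \<open>(\<sigma> rho + m, l)\<close>.\<close>

lemma first_component_sum:
  "Gterm \<sigma> m x t \<sigma> 1 (\<lambda>l. hat g2 (1 * l)) (\<lambda>l. hat g1 (1 * l)) l
   + Gterm \<sigma> m x t (- \<sigma>) (- 1) (\<lambda>l. hat g2 (- 1 * l)) (\<lambda>l. hat g1 (- 1 * l)) l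
   + Hterm \<sigma> m x t 1 0 0 h1 l
   + (Gterm \<sigma> m x t \<sigma> 1 (source_hat m t \<sigma> 1 f2) (source_hat m t \<sigma> 1 f1) l
   + Gterm \<sigma> m x t (- \<sigma>) (- 1) (source_hat m t \<sigma> (- 1) f2) (source_hat m t \<sigma> (- 1) f1) l)
   = exp (\<i> * of_real l * of_real x) * (exp (- signed_omega \<sigma> m l * of_real t)
       * fourier_data g1 g2 h1 f1 f2 t (of_real (\<sigma> * rho m l + m)) (of_real l) (signed_omega \<sigma> m l) l) / of_real (2 * rho m l)"
proof -
  have k: "kern (signed_omega \<sigma> m l) l x t = exp (\<i> * of_real l * of_real x) * exp (- signed_omega \<sigma> m l * of_real t)"
    by (simp add: kern_def flip: exp_add)
  have H: "of_real (symbol 1 0 0 m l) = 2 * of_real l * inverse (complex_of_real (2 * rho m l))"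
    by (cases "rho m l = 0") (simp_all add: symbol_def field_simps)
  have c: "complex_of_real (- \<sigma> * rho m l + - 1 * m) = - of_real (\<sigma> * rho m l + 1 * m)" by simp
  have alg: "E * e * (L * u1 + d * v1) * i + E * e * (L * u2 + - d * v2) * i + E * e * (2 * L * i) * h
      + (E * e * (L * U1 + d * V1) * i + E * e * (L * U2 + - d * V2) * i)
    = E * (e * (d * (v1 - v2) + L * (u1 + u2) + 2 * L * h + d * (V1 - V2) + L * (U1 + U2))) * i"
    for E e L d u1 u2 v1 v2 U1 U2 V1 V2 h i :: complex
    by (simp add: algebra_simps)
  show ?thesis
    unfolding Gterm_def Hterm_def fourier_data_def k H c divide_inverse
    unfolding mult_1 mult_minus1
    by (rule alg)
qed

text \<open>The analogue for the second component has the weights \<open>(l, \<sigma> rho - m)\<close>.\<close>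

lemma second_component_sum:
  "Gterm \<sigma> m x t \<sigma> (- 1) (\<lambda>l. hat g1 (1 * l)) (\<lambda>l. hat g2 (1 * l)) l
   - Gterm \<sigma> m x t (- \<sigma>) 1 (\<lambda>l. hat g1 (- 1 * l)) (\<lambda>l. hat g2 (- 1 * l)) l
   - Hterm \<sigma> m x t 0 (- \<sigma>) 1 h1 l
   + (Gterm \<sigma> m x t \<sigma> (- 1) (source_hat m t \<sigma> 1 f1) (source_hat m t \<sigma> 1 f2) l
   - Gterm \<sigma> m x t (- \<sigma>) 1 (source_hat m t \<sigma> (- 1) f1) (source_hat m t \<sigma> (- 1) f2) l)
   = exp (\<i> * of_real l * of_real x) * (exp (- signed_omega \<sigma> m l * of_real t)
       * fourier_data g1 g2 h1 f1 f2 t (of_real l) (of_real (\<sigma> * rho m l - m)) (signed_omega \<sigma> m l) l) / of_real (2 * rho m l)"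
proof -
  have k: "kern (signed_omega \<sigma> m l) l x t = exp (\<i> * of_real l * of_real x) * exp (- signed_omega \<sigma> m l * of_real t)"
    by (simp add: kern_def flip: exp_add)
  have H: "of_real (symbol 0 (- \<sigma>) 1 m l) = 2 * - of_real (\<sigma> * rho m l - m) * inverse (complex_of_real (2 * rho m l))"
    by (cases "rho m l = 0") (simp_all add: symbol_def field_simps)
  have c: "complex_of_real (\<sigma> * rho m l + - 1 * m) = of_real (\<sigma> * rho m l - m)"
    "complex_of_real (- \<sigma> * rho m l + 1 * m) = - of_real (\<sigma> * rho m l - m)" by simp_all
  have alg: "E * e * (L * u1 + d * v1) * i - E * e * (L * u2 + - d * v2) * i - E * e * (2 * - d * i) * h
      + (E * e * (L * U1 + d * V1) * i - E * e * (L * U2 + - d * V2) * i)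
    = E * (e * (L * (u1 - u2) + d * (v1 + v2) + 2 * d * h + L * (U1 - U2) + d * (V1 + V2))) * i"
    for E e L d u1 u2 v1 v2 U1 U2 V1 V2 h i :: complex
    by (simp add: algebra_simps)
  show ?thesis
    unfolding Gterm_def Hterm_def fourier_data_def k H c divide_inverse
    unfolding mult_1 mult_minus1
    by (rule alg)
qed

text \<open>Every point of the punctured closed quadrant is a limit of off-diagonal points of its interior, so a
  continuous function determines the extension of its restriction to that set.\<close>

lemma extend_off_diag_eq:
  assumes Y: "continuous_on punctured_quad (\<lambda>(x, t). Y x t)"
    and eq: "\<And>x t. 0 < x \<Longrightarrow> 0 < t \<Longrightarrow> x \<noteq> t \<Longrightarrow> u x t = Y x t"
    and p: "(x, t) \<in> punctured_quad"
  shows "extend_off_diag u x t = Y x t"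
proof (cases "(x, t) \<in> off_diag")
  case True
  then show ?thesis using eq[of x t] by (simp add: extend_off_diag_def off_diag_def)
next
  case False
  have sub: "off_diag \<subseteq> punctured_quad" by (auto simp: off_diag_def Quad_closed_def)
  have "(x, t) islimpt off_diag"
    unfolding islimpt_approachable
  proof (intro allI impI)
    fix e :: real assume e: "e > 0"
    \<comment> \<open>Moving both coordinates by \<open>e / 4\<close> enters the open quadrant; unequal shifts leave the diagonal.\<close>
    define d where "d = (if x + e / 4 = t + e / 4 then e / 8 else e / 4)"
    have d: "0 < d" "d \<le> e / 4" "x + e / 4 \<noteq> t + d" using e by (auto simp: d_def)
    have xt: "0 \<le> x" "0 \<le> t" using p by (auto simp: Quad_closed_def)
    have in_off: "(x + e / 4, t + d) \<in> off_diag" using xt d e by (auto simp: off_diag_def)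
    have "dist (x + e / 4, t + d) (x, t) \<le> \<bar>e / 4\<bar> + \<bar>d\<bar>"
      unfolding dist_Pair_Pair dist_real_def using sqrt_sum_squares_le_sum_abs[of "e/4" d] e d by simp
    also have "\<dots> < e" using d e by simp
    finally show "\<exists>q\<in>off_diag. q \<noteq> (x, t) \<and> dist q (x, t) < e"
      using in_off e by (intro bexI[of _ "(x + e / 4, t + d)"] conjI) auto
  qed
  then have nb: "at (x, t) within off_diag \<noteq> bot" by (simp add: trivial_limit_within)
  have "((\<lambda>(y, s). Y y s) \<longlongrightarrow> Y x t) (at (x, t) within punctured_quad)"
    using Y[unfolded continuous_on_def, rule_format, OF p] by simp
  then have "((\<lambda>(y, s). Y y s) \<longlongrightarrow> Y x t) (at (x, t) within off_diag)"
    by (rule tendsto_within_subset[OF _ sub])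
  then have "((\<lambda>(y, s). u y s) \<longlongrightarrow> Y x t) (at (x, t) within off_diag)"
    by (rule Lim_transform_eventually) (auto intro!: always_eventually simp: eventually_at_filter off_diag_def eq)
  then show ?thesis using False nb by (simp add: extend_off_diag_def tendsto_Lim)
qed

theorem proposition3:
  fixes m :: real
    and g1 g2 h1 :: "real \<Rightarrow> complex"
    and f1 f2 Y1 Y2 :: "real \<Rightarrow> real \<Rightarrow> complex"
  assumes m: "m \<ge> 0"
    and g: "half_line_schwartz g1" "half_line_schwartz g2"
    and h: "half_line_smooth h1"
    and f: "quad_smooth f1" "quad_smooth f2"
           "rapidly_decreasing_in_x f1" "rapidly_decreasing_in_x f2"
    and compat: "h1 0 = g1 0" "hderiv h1 0 = - hderiv g2 0 + f1 0 0"
    and Y_C1: "Ck_on 1 (Quad_closed - {(0, 0)}) Y1" "Ck_on 1 (Quad_closed - {(0, 0)}) Y2"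
    and pde1: "\<And>x t. (x, t) \<in> Quad \<Longrightarrow>
           dt Y1 x t = - dx Y2 x t - \<i> * of_real m * Y1 x t + f1 x t"
    and pde2: "\<And>x t. (x, t) \<in> Quad \<Longrightarrow>
           dt Y2 x t = - dx Y1 x t + \<i> * of_real m * Y2 x t + f2 x t"
    and init1: "\<And>x. x > 0 \<Longrightarrow> ((\<lambda>t. Y1 x t) \<longlongrightarrow> g1 x) (at_right 0)"
    and init2: "\<And>x. x > 0 \<Longrightarrow> ((\<lambda>t. Y2 x t) \<longlongrightarrow> g2 x) (at_right 0)"
    and bdry: "\<And>t. t > 0 \<Longrightarrow> ((\<lambda>x. Y1 x t) \<longlongrightarrow> h1 t) (at_right 0)"
    and decay1: "\<And>t. t > 0 \<Longrightarrow> ((\<lambda>x. Y1 x t) \<longlongrightarrow> 0) at_top"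
    and bounded2: "\<And>t. t > 0 \<Longrightarrow> bdd_above ((\<lambda>x. cmod (Y2 x t)) ` {1..})"
    and dominated: "\<And>T. T > 0 \<Longrightarrow> \<exists>B :: real \<Rightarrow> real.
           (\<forall>x>0. B x > 0) \<and> set_integrable lebesgue {0<..} B \<and>
           (\<forall>x>0. \<forall>t. 0 < t \<and> t \<le> T \<longrightarrow>
              (cmod (Y1 x t))\<^sup>2 \<le> B x \<and> (cmod (Y2 x t))\<^sup>2 \<le> B x \<and>
              (cmod (dt Y1 x t))\<^sup>2 \<le> B x \<and> (cmod (dt Y2 x t))\<^sup>2 \<le> B x)"
  shows "\<forall>(x, t) \<in> Quad_closed - {(0, 0)}.
           Psi1 m g1 g2 h1 f1 f2 x t = Y1 x t \<and> Psi2 m g1 g2 h1 f1 f2 x t = Y2 x t"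
proof -
  interpret dirac_half_line m g1 g2 h1 f1 f2 Y1 Y2
    by unfold_locales
      (use Y_C1 pde1 pde2 init1 init2 bdry quad_smooth_continuous[OF f(1)] quad_smooth_continuous[OF f(2)]
        half_line_smooth_continuous[OF h, of 0] in simp_all)
  have off: "Psi1_formula m g1 g2 h1 f1 f2 x t = Y1 x t \<and> Psi2_formula m g1 g2 h1 f1 f2 x t = Y2 x t"
    if xt: "0 < x" "0 < t" "x \<noteq> t" for x t
  proof -
    obtain B where B: "set_integrable lebesgue {0<..} B"
      and dom: "\<And>y s. 0 < y \<Longrightarrow> 0 < s \<Longrightarrow> s \<le> t \<Longrightarrow> (norm (Y1 y s))\<^sup>2 \<le> B y \<and> (norm (Y2 y s))\<^sup>2 \<le> B y"
      using dominated[OF xt(2)] by blast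
    have mono: "quadratic_decay C u \<Longrightarrow> C \<le> C' \<Longrightarrow> quadratic_decay C' u" for C C' u
      unfolding quadratic_decay_def by (meson divide_right_mono order_trans add_nonneg_nonneg zero_le_one zero_le_power2)
    obtain Cg1 Cg2 where Cg: "quadratic_decay Cg1 g1" "quadratic_decay Cg2 g2"
      using half_line_schwartz_quadratic_decay[OF g(1), of 0] half_line_schwartz_quadratic_decay[OF g(2), of 0] by auto
    obtain Cf1 Cf2 where Cf: "decaying_source f1 Cf1 t" "decaying_source f2 Cf2 t"
      using tilde_hat_decay[OF f(1,3) xt(2)] tilde_hat_decay[OF f(2,4) xt(2)] by blast
    define C where "C = max (max Cg1 Cg2) (max Cf1 Cf2)"
    have gC: "quadratic_decay C g1" "quadratic_decay C g2"
      by (rule mono[OF Cg(1)] mono[OF Cg(2)]; simp add: C_def)+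
    have fC: "decaying_source f1 C t" "decaying_source f2 C t"
      using Cf unfolding decaying_source_def by (auto intro: mono simp: C_def)
    have s: "is_sign (1::real)" "is_sign (- 1::real)" by auto
    note Gi12 = initial_Gterm[OF g m xt] and Gi21 = initial_Gterm[OF g(2,1) m xt]
    note Si12 = source_Gterm[OF f(1,3) f(2,4) m xt(2)] and Si21 = source_Gterm[OF f(2,4) f(1,3) m xt(2)]
    note Hi = boundary_Hterm[OF h m xt]
    have split: "E * ((a - b) / d) = E * a / d - E * b / d" for E a b d :: complex
      by (simp add: diff_divide_distrib right_diff_distrib)
    have scale: "2 * of_real pi * (z / of_real (2 * pi)) = z" for z :: complex by simp
    \<comment> \<open>The formula lists its terms by kind; inversion needs them grouped by the sign of the exponent.\<close>
    have regroup1: "a + b - c - d + e - f + (p + q) + (- r - s) = (a + b + e + (p + q)) - (c + d + f + (r + s))"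
      and regroup2: "a - b - c + d - e + f + (p - q) + (- r + s) = (a - b - e + (p - q)) - (c - d - f + (r - s))"
      for a b c d e f p q r s :: complex by simp_all
    note sol = solution_from_transform[OF xt(2) m xt(1) B dom gC fC]
    have "2 * of_real pi * Psi1_formula m g1 g2 h1 f1 f2 x t = 2 * of_real pi * Y1 x t"
    proof (rule sol(1))
      have side: "has_gen_integral (\<lambda>l. exp (\<i> * of_real l * of_real x) * (exp (- signed_omega \<sigma> m l * of_real t)
       * fourier_data g1 g2 h1 f1 f2 t (of_real (\<sigma> * rho m l + m)) (of_real l) (signed_omega \<sigma> m l) l) / of_real (2 * rho m l))
        (gen_integral (Gterm \<sigma> m x t \<sigma> 1 (\<lambda>l. hat g2 (1 * l)) (\<lambda>l. hat g1 (1 * l)))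
       + gen_integral (Gterm \<sigma> m x t (- \<sigma>) (- 1) (\<lambda>l. hat g2 (- 1 * l)) (\<lambda>l. hat g1 (- 1 * l)))
       + gen_integral (Hterm \<sigma> m x t 1 0 0 h1)
       + ((LINT l|lborel. Gterm \<sigma> m x t \<sigma> 1 (source_hat m t \<sigma> 1 f2) (source_hat m t \<sigma> 1 f1) l)
       + (LINT l|lborel. Gterm \<sigma> m x t (- \<sigma>) (- 1) (source_hat m t \<sigma> (- 1) f2) (source_hat m t \<sigma> (- 1) f1) l)))"
        if \<sigma>: "is_sign \<sigma>" for \<sigma>
        unfolding first_component_sum[symmetric]
        by (intro has_gen_integral_add Gi21 Hi Si21 \<sigma> s)
      note diff = has_gen_integral_diff [OF side[OF s(1)] side[OF s(2)], unfolded minus_minus]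
      show "has_gen_integral (\<lambda>l. exp (\<i> * of_real l * of_real x) *
        first_transform t l)
        (2 * of_real pi * Psi1_formula m g1 g2 h1 f1 f2 x t)"
        unfolding Psi1_formula_def scale G_eqs H_eqs F_eqs regroup1
        unfolding half_sum_def split
        by (rule diff)
    qed
    moreover have "2 * of_real pi * Psi2_formula m g1 g2 h1 f1 f2 x t = 2 * of_real pi * Y2 x t"
    proof (rule sol(2))
      have side: "has_gen_integral (\<lambda>l. exp (\<i> * of_real l * of_real x) * (exp (- signed_omega \<sigma> m l * of_real t)
       * fourier_data g1 g2 h1 f1 f2 t (of_real l) (of_real (\<sigma> * rho m l - m)) (signed_omega \<sigma> m l) l) / of_real (2 * rho m l))
        (gen_integral (Gterm \<sigma> m x t \<sigma> (- 1) (\<lambda>l. hat g1 (1 * l)) (\<lambda>l. hat g2 (1 * l)))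
       - gen_integral (Gterm \<sigma> m x t (- \<sigma>) 1 (\<lambda>l. hat g1 (- 1 * l)) (\<lambda>l. hat g2 (- 1 * l)))
       - gen_integral (Hterm \<sigma> m x t 0 (- \<sigma>) 1 h1)
       + ((LINT l|lborel. Gterm \<sigma> m x t \<sigma> (- 1) (source_hat m t \<sigma> 1 f1) (source_hat m t \<sigma> 1 f2) l)
       - (LINT l|lborel. Gterm \<sigma> m x t (- \<sigma>) 1 (source_hat m t \<sigma> (- 1) f1) (source_hat m t \<sigma> (- 1) f2) l)))"
        if \<sigma>: "is_sign \<sigma>" for \<sigma>
        unfolding second_component_sum[symmetric]
        by (intro has_gen_integral_add has_gen_integral_diff Gi12 Hi Si12 \<sigma> s)
      note diff = has_gen_integral_diff [OF side[OF s(1)] side[OF s(2)], unfolded minus_minus]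
      show "has_gen_integral (\<lambda>l. exp (\<i> * of_real l * of_real x) *
        second_transform t l)
        (2 * of_real pi * Psi2_formula m g1 g2 h1 f1 f2 x t)"
        unfolding Psi2_formula_def scale G_eqs H_eqs F_eqs regroup2
        unfolding half_sum_def split
        by (rule diff)
    qed
    ultimately show ?thesis by simp
  qed
  show ?thesis
    unfolding Psi1_def Psi2_def
    using extend_off_diag_eq[OF Y1D(1), of "Psi1_formula m g1 g2 h1 f1 f2"]
      extend_off_diag_eq[OF Y2D(1), of "Psi2_formula m g1 g2 h1 f1 f2"] off by auto
qed

end
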